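(* Let $J$ be an integer. Let $\mathsf{N}_j$, $j\ge J$, be $d\times d$ real-valued invertible matrices such that $$\Lambda:=\bigcup_{j=J}^\infty[\mathsf{N}_j^{-1}\mathbb{Z}^d]\ \text{has no accumulation point}\quad\text{and}\quad\lim_{j\to+\infty}\|\mathsf{N}_jk\|=0\qquad\forall k\in\Lambda.$$ Let $\mathbf{\Phi}=\{\boldsymbol\varphi^1,\ldots,\boldsymbol\varphi^r\}$, $\tilde{\mathbf{\Phi}}=\{\tilde{\boldsymbol\varphi}^1,\ldots,\tilde{\boldsymbol\varphi}^r\}$ and $\mathbf{\Psi}_j=\{\boldsymbol\psi^{j,1},\ldots,\boldsymbol\psi^{j,s_j}\}$, $\tilde{\mathbf{\Psi}}_j=\{\tilde{\boldsymbol\psi}^{j,1},\ldots,\tilde{\boldsymbol\psi}^{j,s_j}\}$ be finite subsets of $L_2^{loc}(\mathbb{R}^d)$ for all integers $j\ge J$. Then the pair $$(\mathsf{FWS}_J(\mathbf{\Phi};\{\mathbf{\Psi}_j\}_{j=J}^\infty),\ \mathsf{FWS}_J(\tilde{\mathbf{\Phi}};\{\tilde{\mathbf{\Psi}}_j\}_{j=J}^\infty))$$ is a pair of frequency-based nonstationary dual wavelet frames in the distribution space $\mathscr{D}'(\mathbb{R}^d)$ if and only if $$\lim_{J'\to+\infty}\Big\langle\mathcal{I}^0_{\mathbf{\Phi}}(\mathsf{N}_J\cdot)+\sum_{j=J}^{J'-1}\mathcal{I}^0_{\mathbf{\Psi}_j}(\mathsf{N}_j\cdot),\mathbf{h}\Big\rangle=\langle1,\mathbf{h}\rangle\qquad\forall\mathbf{h}\in\mathscr{D}(\mathbb{R}^d)$$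 and $$\mathcal{I}^{\mathsf{N}_Jk}_{\mathbf{\Phi}}(\mathsf{N}_J\xi)+\sum_{j=J}^\infty\mathcal{I}^{\mathsf{N}_jk}_{\mathbf{\Psi}_j}(\mathsf{N}_j\xi)=0,\qquad\text{a.e. }\xi\in\mathbb{R}^d,\ k\in\Lambda\setminus\{0\}$$ (the infinite sums here are in fact finite), where $$\mathcal{I}^k_{\mathbf{\Phi}}(\xi):=\sum_{\ell=1}^r\overline{\boldsymbol\varphi^\ell(\xi)}\,\tilde{\boldsymbol\varphi}^\ell(\xi+2\pi k),\ k\in\mathbb{Z}^d,\qquad\mathcal{I}^k_{\mathbf{\Phi}}:=0,\ k\in\mathbb{R}^d\setminus\mathbb{Z}^d,$$ $$\mathcal{I}^k_{\mathbf{\Psi}_j}(\xi):=\sum_{\ell=1}^{s_j}\overline{\boldsymbol\psi^{j,\ell}(\xi)}\,\tilde{\boldsymbol\psi}^{j,\ell}(\xi+2\pi k),\ k\in\mathbb{Z}^d,\qquad\mathcal{I}^k_{\mathbf{\Psi}_j}:=0,\ k\in\mathbb{R}^d\setminus\mathbb{Z}^d.$$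
   Context: $\mathscr{D}(\mathbb{R}^d)$ is the space of compactly supported $C^\infty$ functions and $\mathscr{D}'(\mathbb{R}^d)$ its dual. $L_2^{loc}(\mathbb{R}^d)$ is the space of measurable functions square integrable on every compact set. For $\mathbf{f}\in\mathscr{D}(\mathbb{R}^d)$ and locally integrable $\boldsymbol\psi$: $\langle\mathbf{f},\boldsymbol\psi\rangle:=\int_{\mathbb{R}^d}\mathbf{f}\,\overline{\boldsymbol\psi}$ and $\langle\boldsymbol\psi,\mathbf{f}\rangle:=\int_{\mathbb{R}^d}\boldsymbol\psi\,\overline{\mathbf{f}}$. For a function $f$, real invertible $U$ and $k\in\mathbb{R}^d$, $f_{U;0,k}(\xi):=|\det U|^{1/2}e^{-ik\cdot U\xi}f(U\xi)$. Sets of generators are counted with multiplicity. Define $$\mathsf{FWS}_J(\mathbf{\Phi};\{\mathbf{\Psi}_j\}_{j=J}^\infty)=\{\boldsymbol\varphi_{\mathsf{N}_J;0,k}:k\in\mathbb{Z}^d,\boldsymbol\varphi\in\mathbf{\Phi}\}\cup\bigcup_{j=J}^\infty\{\boldsymbol\psi_{\mathsf{N}_j;0,k}:k\in\mathbb{Z}^d,\boldsymbol\psi\in\mathbf{\Psi}_j\}.$$ The pair of systems is a pair of frequency-based nonstationary dual wavelet frames in the distribution space $\mathscr{D}'(\mathbb{R}^d)$ if for all $\mathbf{f},\mathbf{g}\in\mathscr{D}(\mathbb{R}^d)$: (1) the series $\sum_{\ell=1}^r\sum_{k\in\mathbb{Z}^d}\langle\mathbf{f},\boldsymbol\varphi^\ell_{\mathsf{N}_J;0,k}\rangle\langle\tilde{\boldsymbol\varphi}^\ell_{\mathsf{N}_J;0,k},\mathbf{g}\rangle$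 and $\sum_{\ell=1}^{s_j}\sum_{k\in\mathbb{Z}^d}\langle\mathbf{f},\boldsymbol\psi^{j,\ell}_{\mathsf{N}_j;0,k}\rangle\langle\tilde{\boldsymbol\psi}^{j,\ell}_{\mathsf{N}_j;0,k},\mathbf{g}\rangle$ converge absolutely for all integers $j\ge J$; and (2) the following limit exists and $$\lim_{J'\to+\infty}\Big(\sum_{\ell=1}^r\sum_{k\in\mathbb{Z}^d}\langle\mathbf{f},\boldsymbol\varphi^\ell_{\mathsf{N}_J;0,k}\rangle\langle\tilde{\boldsymbol\varphi}^\ell_{\mathsf{N}_J;0,k},\mathbf{g}\rangle+\sum_{j=J}^{J'-1}\sum_{\ell=1}^{s_j}\sum_{k\in\mathbb{Z}^d}\langle\mathbf{f},\boldsymbol\psi^{j,\ell}_{\mathsf{N}_j;0,k}\rangle\langle\tilde{\boldsymbol\psi}^{j,\ell}_{\mathsf{N}_j;0,k},\mathbf{g}\rangle\Big)=(2\pi)^d\langle\mathbf{f},\mathbf{g}\rangle.$$ *)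

theory Defs
  imports "HOL-Analysis.Analysis"
begin

primrec times_differentiable ::
  "nat \<Rightarrow> ('a::euclidean_space \<Rightarrow> 'b::real_normed_vector) \<Rightarrow> bool" where
  "times_differentiable 0 f \<longleftrightarrow> continuous_on UNIV f"
| "times_differentiable (Suc n) f \<longleftrightarrow>
     (\<forall>x. f differentiable at x) \<and>
     (\<forall>v. times_differentiable n (\<lambda>x. frechet_derivative f (at x) v))"

definition test_functions :: "(real ^ 'd \<Rightarrow> complex) set" where
  "test_functions =
     {f. (\<forall>n. times_differentiable n f) \<and> compact (closure {x. f x \<noteq> 0})}"

definition L2_loc :: "(real ^ 'd \<Rightarrow> complex) set" where
  "L2_loc = {f \<in> borel_measurable lebesgue.
     \<forall>K. compact K \<longrightarrow> set_integrable lebesgue K (\<lambda>x. (cmod (f x))\<^sup>2)}"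

definition pairing :: "(real ^ 'd \<Rightarrow> complex) \<Rightarrow> (real ^ 'd \<Rightarrow> complex) \<Rightarrow> complex" where
  "pairing u v = (LINT x|lebesgue. u x * cnj (v x))"

definition int_lattice :: "(real ^ 'd) set" where
  "int_lattice = {k. \<forall>i. k $ i \<in> \<int>}"

definition union_lattice :: "int \<Rightarrow> (int \<Rightarrow> real ^ 'd ^ 'd) \<Rightarrow> (real ^ 'd) set" where
  "union_lattice J N = (\<Union>j\<in>{J..}. (*v) (matrix_inv (N j)) ` int_lattice)"

definition dilate_modulate ::
  "real ^ 'd ^ 'd \<Rightarrow> real ^ 'd \<Rightarrow> (real ^ 'd \<Rightarrow> complex) \<Rightarrow> real ^ 'd \<Rightarrow> complex" where
  "dilate_modulate U k f \<xi> =
     complex_of_real (sqrt \<bar>det U\<bar>) * exp (- \<i> * complex_of_real (k \<bullet> (U *v \<xi>))) * f (U *v \<xi>)"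

text \<open>
  A system whose generators are counted with multiplicity is a family: \<open>Scaling \<ell> k\<close>
  is the index of the \<open>k\<close>-th modulate of the \<open>\<ell>\<close>-th generator in \<open>\<Phi>\<close>, and \<open>Wavelet j \<ell> k\<close>
  that of the \<open>\<ell>\<close>-th generator in \<open>\<Psi>\<^sub>j\<close>.  The relevant indices have
  \<open>k\<close> in the integer lattice, \<open>1 \<le> \<ell> \<le> r\<close> respectively \<open>J \<le> j\<close> and \<open>1 \<le> \<ell> \<le> s j\<close>.
\<close>

datatype 'k fws_index = Scaling nat 'k | Wavelet int nat 'k

primrec FWS ::
  "int \<Rightarrow> (int \<Rightarrow> real ^ 'd ^ 'd) \<Rightarrow> (nat \<Rightarrow> real ^ 'd \<Rightarrow> complex) \<Rightarrow>
   (int \<Rightarrow> nat \<Rightarrow> real ^ 'd \<Rightarrow> complex) \<Rightarrow> (real ^ 'd) fws_index \<Rightarrow> real ^ 'd \<Rightarrow> complex" where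
  "FWS J N \<phi> \<psi> (Scaling l k) = dilate_modulate (N J) k (\<phi> l)"
| "FWS J N \<phi> \<psi> (Wavelet j l k) = dilate_modulate (N j) k (\<psi> j l)"

definition frame_term ::
  "('i \<Rightarrow> real ^ 'd \<Rightarrow> complex) \<Rightarrow> ('i \<Rightarrow> real ^ 'd \<Rightarrow> complex) \<Rightarrow>
   (real ^ 'd \<Rightarrow> complex) \<Rightarrow> (real ^ 'd \<Rightarrow> complex) \<Rightarrow> 'i \<Rightarrow> complex" where
  "frame_term F G f g i = pairing f (F i) * pairing (G i) g"

definition frequency_dual_wavelet_frames ::
  "int \<Rightarrow> nat \<Rightarrow> (int \<Rightarrow> nat) \<Rightarrow> ((real ^ 'd) fws_index \<Rightarrow> real ^ 'd \<Rightarrow> complex) \<Rightarrow>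
   ((real ^ 'd) fws_index \<Rightarrow> real ^ 'd \<Rightarrow> complex) \<Rightarrow> bool" where
  "frequency_dual_wavelet_frames J r s F G \<longleftrightarrow>
     (\<forall>f\<in>test_functions. \<forall>g\<in>test_functions.
        (\<lambda>(l, k). cmod (frame_term F G f g (Scaling l k))) summable_on ({1..r} \<times> int_lattice) \<and>
        (\<forall>j\<ge>J. (\<lambda>(l, k). cmod (frame_term F G f g (Wavelet j l k)))
                  summable_on ({1..s j} \<times> int_lattice)) \<and>
        ((\<lambda>J'. (\<Sum>l=1..r. \<Sum>\<^sub>\<infinity>k\<in>int_lattice. frame_term F G f g (Scaling l k)) +
               (\<Sum>j\<in>{J..<J'}. \<Sum>l=1..s j. \<Sum>\<^sub>\<infinity>k\<in>int_lattice.
                  frame_term F G f g (Wavelet j l k)))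
           \<longlongrightarrow> (2 * complex_of_real pi) ^ CARD('d) * pairing f g) at_top)"

definition cross_sum ::
  "nat \<Rightarrow> (nat \<Rightarrow> real ^ 'd \<Rightarrow> complex) \<Rightarrow> (nat \<Rightarrow> real ^ 'd \<Rightarrow> complex) \<Rightarrow>
   real ^ 'd \<Rightarrow> real ^ 'd \<Rightarrow> complex" where
  "cross_sum r \<phi> \<phi>' k \<xi> =
     (if k \<in> int_lattice then \<Sum>l=1..r. cnj (\<phi> l \<xi>) * \<phi>' l (\<xi> + (2 * pi) *\<^sub>R k) else 0)"

end

theory Submission
  imports Defs
begin

text \<open>
  The theorem is a Parseval identity, applied at every scale, followed by an analysis of which lattice shifts
  survive.

  \<^bold>\<open>One scale.\<close> Fix an invertible matrix \<open>U\<close>. For generators \<open>\<phi>\<close> and \<open>\<phi>'\<close> the numbers \<open>\<langle>f, \<phi>\<^sub>k\<rangle>\<close> and \<open>\<langle>\<phi>'\<^sub>k, g\<rangle>\<close>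
  are, up to a factor and a conjugation, the Fourier coefficients of \<open>F \<xi> = f \<xi> * cnj (\<phi> (U \<xi>))\<close> and
  \<open>G \<xi> = g \<xi> * cnj (\<phi>' (U \<xi>))\<close>. These have bounded support and are square integrable, since \<open>\<phi>\<close> and \<open>\<phi>'\<close> are
  so locally; so their periodizations with respect to the lattice of the vectors \<open>2 pi U\<^sup>-\<^sup>1 n\<close> are square
  integrable over a fundamental cell. Parseval's identity on the cell, unfolded again (\<open>lattice_parseval\<close>),
  gives absolute convergence for all locally square-integrable generators and, with \<open>k = U\<^sup>-\<^sup>1 n\<close>,
  \<open>\<Sum> \<langle>f, \<phi>\<^sub>k\<rangle> \<langle>\<phi>'\<^sub>k, g\<rangle> = (2 pi)^d \<Sum>\<^sub>k \<integral> f \<xi> * cnj (g (\<xi> + 2 pi k)) * cnj (\<phi> (U \<xi>)) * \<phi>' (U (\<xi> + 2 pi k)) d\<xi>\<close>.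
  Summed over the generators the last two factors form \<open>cross_sum\<close> (\<open>scale_series\<close>). So only the
  limit condition is at stake.

  \<^bold>\<open>All scales.\<close> Only shifts \<open>k\<close> for which the supports of \<open>f\<close> and of the translate of \<open>g\<close> meet contribute.
  They form a bounded subset of \<open>\<Lambda>\<close>, which is finite because \<open>\<Lambda>\<close> has no accumulation point. Hence the
  partial series up to scale \<open>J'\<close> is a finite sum over \<open>k\<close> of integrals of \<open>f \<xi> * cnj (g (\<xi> + 2 pi k))\<close> against
  the partial cross sum at \<open>k\<close> (\<open>partial_series_eq\<close>). For \<open>k \<noteq> 0\<close> only finitely many scales are active,
  because \<open>N j k\<close> tends to zero while a nonzero integer vector has norm at least 1; so the partial cross
  sums at \<open>k\<close> are eventually constant in \<open>J'\<close>.

  \<^bold>\<open>The equivalence.\<close> If the cross sums at all \<open>k \<noteq> 0\<close> vanish almost everywhere, the partial series is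
  eventually its term at \<open>k = 0\<close>, which is the pairing of the first condition with \<open>h = cnj f * g\<close>; every test
  function \<open>h\<close> arises in this way (\<open>test_function_factorization\<close>). Conversely, let the series converge to
  \<open>(2 pi)^d \<langle>f, g\<rangle>\<close>. Taking for \<open>f\<close> a bump on a small cube and for \<open>g\<close> its translate by \<open>2 pi k\<close> with \<open>k \<noteq> 0\<close>
  isolates the shift \<open>k\<close> and makes \<open>\<langle>f, g\<rangle>\<close> zero; so the cross sum at \<open>k\<close> has integral zero over all small
  cubes and vanishes almost everywhere by Lebesgue's differentiation theorem (\<open>off_diagonal_vanishes\<close>).

  The analytic background developed on the way consists of smooth bump functions, the behaviour of Lebesgue
  measure under linear maps for an arbitrary finite index type, and the completeness of the trigonometric
  system on a cell, which rests on the Stone--Weierstrass theorem and inner regularity.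
\<close>

section \<open>Test functions\<close>

lemma times_differentiable_const: "times_differentiable n (\<lambda>x. c)"
  by (induction n arbitrary: c) auto

lemma times_differentiable_imp_continuous:
  assumes "times_differentiable n f"
  shows "continuous_on UNIV f"
proof (cases n)
  case (Suc m)
  then show ?thesis
    using assms by (auto intro!: continuous_at_imp_continuous_on differentiable_imp_continuous_within)
qed (use assms in simp)

lemma times_differentiable_SucD:
  "times_differentiable (Suc n) f \<Longrightarrow> times_differentiable n f"
proof (induction n arbitrary: f)
  case 0
  then show ?case using times_differentiable_imp_continuous[OF 0] by simp
qed auto

text \<open>
  The recursion defining \<^const>\<open>times_differentiable\<close> speaks of \<^const>\<open>frechet_derivative\<close>.
  Uniqueness of derivatives allows any derivative obtained from the usual rules in its place, so that
  closure properties follow by induction on the order.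
\<close>

lemma times_differentiable_SucI:
  assumes "\<And>x. (f has_derivative f' x) (at x)" "\<And>v. times_differentiable n (\<lambda>x. f' x v)"
  shows "times_differentiable (Suc n) f"
proof -
  have "frechet_derivative f (at x) = f' x" for x
    using frechet_derivative_at[OF assms(1)] by simp
  then show ?thesis
    using assms(2) assms(1)[THEN differentiableI] by simp
qed

lemma times_differentiable_Suc_has_derivative:
  assumes "times_differentiable (Suc n) f"
  shows "(f has_derivative frechet_derivative f (at x)) (at x)"
  using assms frechet_derivative_works by auto

lemma times_differentiable_add:
  "times_differentiable n f \<Longrightarrow> times_differentiable n g \<Longrightarrow> times_differentiable n (\<lambda>x. f x + g x)"
proof (induction n arbitrary: f g)
  case (Suc n)
  note D = times_differentiable_Suc_has_derivative
  show ?case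
    by (rule times_differentiable_SucI[OF has_derivative_add[OF D[OF Suc.prems(1)] D[OF Suc.prems(2)]]])
      (use Suc in auto)
qed (auto intro: continuous_on_add)

lemma times_differentiable_bounded_linear:
  assumes L: "bounded_linear L"
  shows "times_differentiable n f \<Longrightarrow> times_differentiable n (\<lambda>x. L (f x))"
proof (induction n arbitrary: f)
  case (Suc n)
  show ?case
    by (rule times_differentiable_SucI[OF bounded_linear.has_derivative[OF L
              times_differentiable_Suc_has_derivative[OF Suc.prems]]])
      (use Suc in auto)
qed (use L in \<open>auto intro: bounded_linear.continuous_on\<close>)

lemma times_differentiable_mult:
  fixes f g :: "'a::euclidean_space \<Rightarrow> 'b::real_normed_algebra"
  shows "times_differentiable n f \<Longrightarrow> times_differentiable n g \<Longrightarrow> times_differentiable n (\<lambda>x. f x * g x)"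
proof (induction n arbitrary: f g)
  case (Suc n)
  note D = times_differentiable_Suc_has_derivative
  have "times_differentiable n (\<lambda>x. frechet_derivative f (at x) v)"
    "times_differentiable n (\<lambda>x. frechet_derivative g (at x) v)" for v
    using Suc.prems by auto
  then have "times_differentiable n (\<lambda>x. f x * frechet_derivative g (at x) v + frechet_derivative f (at x) v * g x)" for v
    using Suc.IH Suc.prems[THEN times_differentiable_SucD] by (intro times_differentiable_add) blast+
  then show ?case
    by (rule times_differentiable_SucI[OF has_derivative_mult[OF D[OF Suc.prems(1)] D[OF Suc.prems(2)]]])
qed (auto intro: continuous_on_mult)

lemma times_differentiable_prod:
  fixes f :: "'i \<Rightarrow> 'a::euclidean_space \<Rightarrow> 'b::{real_normed_algebra_1, comm_monoid_mult}"
  assumes "finite I" "\<And>i. i \<in> I \<Longrightarrow> times_differentiable n (f i)"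
  shows "times_differentiable n (\<lambda>x. \<Prod>i\<in>I. f i x)"
  using assms
  by (induction I) (auto intro!: times_differentiable_mult times_differentiable_const)

text \<open>
  The derivative of \<open>x \<mapsto> f (L x + d)\<close> in direction \<open>v\<close> is the derivative of \<open>f\<close> in the fixed
  direction \<open>L v\<close>, again composed with the same affine map; hence the induction closes.
\<close>

lemma times_differentiable_affine:
  fixes L :: "'a::euclidean_space \<Rightarrow> 'b::euclidean_space"
  assumes L: "linear L"
  shows "times_differentiable n f \<Longrightarrow> times_differentiable n (\<lambda>x. f (L x + d))"
proof (induction n arbitrary: f)
  case 0
  then have "continuous_on UNIV f" by simp
  then have "continuous_on UNIV (\<lambda>x. f (L x + d))"
    using L by (rule_tac continuous_on_compose2[of UNIV f, OF _ continuous_on_add[OF linear_continuous_on continuous_on_const]])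
      (auto simp: linear_conv_bounded_linear)
  then show ?case by simp
next
  case (Suc n)
  have "((\<lambda>x. L x + d) has_derivative L) (at x)" for x
    using has_derivative_add_const[OF linear_imp_has_derivative[OF L]] .
  then have "((\<lambda>x. f (L x + d)) has_derivative (\<lambda>v. frechet_derivative f (at (L x + d)) (L v))) (at x)" for x
    using has_derivative_compose times_differentiable_Suc_has_derivative[OF Suc.prems] by blast
  then show ?case
    by (rule times_differentiable_SucI) (use Suc in auto)
qed

lemma times_differentiable_real_SucI:
  fixes f :: "real \<Rightarrow> real"
  assumes "\<And>x. (f has_real_derivative f' x) (at x)" "times_differentiable n f'"
  shows "times_differentiable (Suc n) f"
  by (rule times_differentiable_SucI[OF assms(1)[unfolded has_field_derivative_def]])
    (use assms(2) times_differentiable_bounded_linear[OF bounded_linear_mult_left] in blast)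

text \<open>
  The functions \<open>p (1/t) exp (-1/t)\<close>, continued by zero to the left of the origin, form a class that is
  closed under differentiation. The case \<open>p = 1\<close> is the classical smooth function that is flat at the
  origin but not zero.
\<close>

definition flat_exp :: "real poly \<Rightarrow> real \<Rightarrow> real" where
  "flat_exp p t = (if t > 0 then poly p (1 / t) * exp (- (1 / t)) else 0)"

lemma poly_over_exp_tendsto_0: "((\<lambda>s. poly p s * exp (- s)) \<longlongrightarrow> 0) (at_top :: real filter)"
proof (induction p)
  case (pCons a p)
  have *: "((\<lambda>s. poly (monom c k) s * exp (- s)) \<longlongrightarrow> 0) (at_top :: real filter)" for c k
  proof -
    have "((\<lambda>s. c * (s ^ k / exp s)) \<longlongrightarrow> c * 0) (at_top :: real filter)"
      by (intro tendsto_mult_left tendsto_power_div_exp_0)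
    then show ?thesis
      by (simp add: poly_monom exp_minus field_simps)
  qed
  have "((\<lambda>s. \<Sum>k\<le>degree (pCons a p). poly (monom (coeff (pCons a p) k) k) s * exp (- s)) \<longlongrightarrow> (\<Sum>k\<le>degree (pCons a p). 0))
      (at_top :: real filter)"
    by (intro tendsto_sum *)
  then show ?case
    by (simp only: sum_distrib_right[symmetric] poly_sum[symmetric] poly_as_sum_of_monoms) simp
qed simp

text \<open>
  Away from the origin this is the product rule. At the origin the difference quotient is
  \<open>s p(s) exp (-s)\<close> with \<open>s = 1/t\<close>, which tends to zero as \<open>s\<close> grows.
\<close>

lemma flat_exp_has_derivative:
  "(flat_exp p has_real_derivative flat_exp (monom 1 2 * (p - pderiv p)) t) (at t)"
proof -
  consider "t > 0" | "t < 0" | "t = 0" by linarith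
  then show ?thesis
  proof cases
    case 1
    have "((\<lambda>t. poly p (1 / t) * exp (- (1 / t))) has_real_derivative
        flat_exp (monom 1 2 * (p - pderiv p)) t) (at t)"
      using 1 by (auto intro!: derivative_eq_intros
          simp: flat_exp_def poly_monom power2_eq_square algebra_simps)
    then show ?thesis
    proof (rule has_field_derivative_transform_within_open)
      show "open {0::real<..}" by simp
    qed (use 1 in \<open>auto simp: flat_exp_def\<close>)
  next
    case 2
    have "((\<lambda>t. 0) has_real_derivative 0) (at t)" by simp
    then have "(flat_exp p has_real_derivative 0) (at t)"
    proof (rule has_field_derivative_transform_within_open)
      show "open {..<0::real}" by simp
    qed (use 2 in \<open>auto simp: flat_exp_def\<close>)
    then show ?thesis using 2 by (simp add: flat_exp_def)
  next
    case 3
    have "((\<lambda>h. flat_exp p h / h) \<longlongrightarrow> 0) (at 0)"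
    proof (rule filterlim_split_at)
      have "((\<lambda>h. flat_exp p h / h) \<longlongrightarrow> 0) (at_left 0) \<longleftrightarrow> ((\<lambda>h. 0::real) \<longlongrightarrow> 0) (at_left (0::real))"
        by (intro filterlim_cong eventually_at_leftI[of "-1"]) (auto simp: flat_exp_def)
      then show "((\<lambda>h. flat_exp p h / h) \<longlongrightarrow> 0) (at_left 0)" by simp
      have "((\<lambda>h. poly (monom 1 1 * p) (inverse h) * exp (- inverse h)) \<longlongrightarrow> 0) (at_right (0::real))"
        by (rule filterlim_compose[OF poly_over_exp_tendsto_0 filterlim_inverse_at_top_right])
      moreover have "((\<lambda>h. flat_exp p h / h) \<longlongrightarrow> 0) (at_right 0) \<longleftrightarrow>
          ((\<lambda>h. poly (monom 1 1 * p) (inverse h) * exp (- inverse h)) \<longlongrightarrow> 0) (at_right (0::real))"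
        by (intro filterlim_cong eventually_at_rightI[of _ 1])
          (auto simp: flat_exp_def poly_monom field_simps)
      ultimately show "((\<lambda>h. flat_exp p h / h) \<longlongrightarrow> 0) (at_right 0)" by simp
    qed
    then show ?thesis
      using 3 by (simp add: has_field_derivative_iff flat_exp_def)
  qed
qed

lemma times_differentiable_flat_exp: "times_differentiable n (flat_exp p)"
proof (induction n arbitrary: p)
  case 0
  then show ?case
    using DERIV_isCont[OF flat_exp_has_derivative] by (simp add: continuous_at_imp_continuous_on)
next
  case (Suc n)
  show ?case
    by (rule times_differentiable_real_SucI[OF flat_exp_has_derivative Suc])
qed

text \<open>
  Such a step is the normalized primitive of the bump \<open>flat_exp 1 t * flat_exp 1 (1 - t)\<close>, which is
  positive exactly on the open unit interval.
\<close>

lemma smooth_step_exists: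
  obtains \<theta> :: "real \<Rightarrow> real" where
    "\<And>n. times_differentiable n \<theta>" "\<And>t. 0 \<le> \<theta> t" "\<And>t. \<theta> t \<le> 1"
    "\<And>t. t \<le> 0 \<Longrightarrow> \<theta> t = 0" "\<And>t. t \<ge> 1 \<Longrightarrow> \<theta> t = 1"
proof -
  define \<rho> :: "real \<Rightarrow> real" where "\<rho> t = flat_exp 1 t * flat_exp 1 (1 - t)" for t
  have \<rho>: "times_differentiable n \<rho>" for n
    unfolding \<rho>_def
    using times_differentiable_affine[OF linear_uminus times_differentiable_flat_exp, of n 1 1]
    by (intro times_differentiable_mult times_differentiable_flat_exp) simp
  then have cont: "continuous_on A \<rho>" for A
    using times_differentiable_imp_continuous continuous_on_subset by blast
  have nonneg: "\<rho> t \<ge> 0" and zero: "t \<le> 0 \<or> t \<ge> 1 \<Longrightarrow> \<rho> t = 0" and pos: "0 < t \<Longrightarrow> t < 1 \<Longrightarrow> \<rho> t > 0" for t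
    by (auto simp: \<rho>_def flat_exp_def)
  \<comment> \<open>Starting at -1 makes the origin an interior point of the range of integration.\<close>
  define I where "I t = integral {-1..t} \<rho>" for t
  have int: "\<rho> integrable_on {a..b}" for a b
    using cont by (rule integrable_continuous_real)
  have mono: "I s \<le> I t" if "s \<le> t" for s t
    unfolding I_def using that nonneg by (intro integral_subset_le int) auto
  have I0: "I t = 0" if "t \<le> 0" for t
    unfolding I_def using that zero by (intro integral_unique has_integral_is_0) auto
  have DI: "(I has_real_derivative \<rho> t) (at t)" for t
  proof (cases "t > -1")
    case True
    have "(I has_real_derivative \<rho> t) (at t within {-1..t+1})"
      unfolding I_def using True by (intro integral_has_real_derivative cont) auto
    then show ?thesis
      using True at_within_Icc_at[of "-1" t "t + 1"] by simp
  next
    case False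
    have "((\<lambda>t. 0) has_real_derivative 0) (at t)" by simp
    then have "(I has_real_derivative 0) (at t)"
    proof (rule has_field_derivative_transform_within_open)
      show "open {..<0::real}" by simp
    qed (use False I0 in auto)
    then show ?thesis using False zero[of t] by simp
  qed
  have I1: "I t = I 1" if "t \<ge> 1" for t
  proof -
    have "I t = I 1 + integral {1..t} \<rho>"
      unfolding I_def using that by (intro Henstock_Kurzweil_Integration.integral_combine[symmetric] int) auto
    moreover have "integral {1..t} \<rho> = 0"
      using zero by (intro integral_unique has_integral_is_0) auto
    ultimately show ?thesis by simp
  qed
  have "I 0 < I 1"
  proof (rule DERIV_pos_imp_increasing_open[where f = I])
    show "continuous_on {0..1} I"
      using DI by (meson DERIV_isCont continuous_at_imp_continuous_on)
  qed (use DI pos in auto)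
  then have c: "I 1 > 0" using I0 by simp
  have "times_differentiable n I" for n
    by (rule times_differentiable_SucD, rule times_differentiable_real_SucI[OF DI \<rho>])
  then have "times_differentiable n (\<lambda>t. I t / I 1)" for n
    using times_differentiable_bounded_linear[OF bounded_linear_divide] by blast
  moreover have "0 \<le> I t" "I t \<le> I 1" for t
    using mono[of 0 t] mono[of t 1] I0[of t] I0[of 0] I1[of t] c by linarith+
  moreover have "I t / I 1 = 1" if "t \<ge> 1" for t
    using I1[OF that] c by simp
  ultimately show thesis
    using c I0 by (intro that[of "\<lambda>t. I t / I 1"]) (simp_all del: divide_eq_1_iff)
qed

definition smooth_step :: "real \<Rightarrow> real" where
  "smooth_step = (SOME \<theta>. (\<forall>n. times_differentiable n \<theta>) \<and> (\<forall>t. 0 \<le> \<theta> t \<and> \<theta> t \<le> 1) \<and>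
     (\<forall>t\<le>0. \<theta> t = 0) \<and> (\<forall>t\<ge>1. \<theta> t = 1))"

lemma smooth_step:
  "times_differentiable n smooth_step" "0 \<le> smooth_step t" "smooth_step t \<le> 1"
  "t \<le> 0 \<Longrightarrow> smooth_step t = 0" "t \<ge> 1 \<Longrightarrow> smooth_step t = 1"
proof -
  obtain \<theta> :: "real \<Rightarrow> real" where
    "\<And>n. times_differentiable n \<theta>" "\<And>t. 0 \<le> \<theta> t" "\<And>t. \<theta> t \<le> 1"
    "\<And>t. t \<le> 0 \<Longrightarrow> \<theta> t = 0" "\<And>t. t \<ge> 1 \<Longrightarrow> \<theta> t = 1"
    by (rule smooth_step_exists) (rule that)
  then have "\<exists>\<theta> :: real \<Rightarrow> real. (\<forall>n. times_differentiable n \<theta>) \<and> (\<forall>t. 0 \<le> \<theta> t \<and> \<theta> t \<le> 1) \<and>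
     (\<forall>t\<le>0. \<theta> t = 0) \<and> (\<forall>t\<ge>1. \<theta> t = (1::real))"
    by (intro exI[of _ \<theta>]) simp
  from someI_ex[OF this, folded smooth_step_def]
  show "times_differentiable n smooth_step" "0 \<le> smooth_step t" "smooth_step t \<le> 1"
    "t \<le> 0 \<Longrightarrow> smooth_step t = 0" "t \<ge> 1 \<Longrightarrow> smooth_step t = 1" by blast+
qed

text \<open>
  The parameter \<open>c\<close> is the steepness of the faces: the bump lives in the open box with corners \<open>a\<close> and \<open>b\<close>
  and equals 1 at distance at least \<open>1/c\<close> from all faces. So it serves both as a cutoff function (\<open>c\<close> fixed,
  box large) and as a smooth approximation of the indicator of the box (\<open>c\<close> large).
\<close>

definition box_bump :: "real \<Rightarrow> real ^ 'd \<Rightarrow> real ^ 'd \<Rightarrow> real ^ 'd \<Rightarrow> real" where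
  "box_bump c a b x = (\<Prod>i\<in>UNIV. smooth_step (c * (x $ i - a $ i)) * smooth_step (c * (b $ i - x $ i)))"

lemma box_bump_bounds: "0 \<le> box_bump c a b x" "box_bump c a b x \<le> 1"
  unfolding box_bump_def by (auto intro!: prod_nonneg prod_le_1 mult_le_one simp: smooth_step)

lemma box_bump_nonzero:
  assumes "c > 0" "box_bump c a b x \<noteq> 0"
  shows "x \<in> box a b"
proof -
  have "c * (x $ i - a $ i) > 0 \<and> c * (b $ i - x $ i) > 0" for i
  proof -
    have "smooth_step (c * (x $ i - a $ i)) \<noteq> 0" "smooth_step (c * (b $ i - x $ i)) \<noteq> 0"
      using assms(2) by (auto simp: box_bump_def)
    then show ?thesis
      using smooth_step(4) not_le by blast
  qed
  then show ?thesis
    using assms(1) by (simp add: mem_box_cart zero_less_mult_iff)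
qed

lemma box_bump_eq_1:
  assumes "\<And>i. c * (x $ i - a $ i) \<ge> 1" "\<And>i. c * (b $ i - x $ i) \<ge> 1"
  shows "box_bump c a b x = 1"
  using assms by (simp add: box_bump_def smooth_step)

lemma box_bump_tendsto_indicator:
  "(\<lambda>n. box_bump (real (Suc n)) a b x) \<longlonglongrightarrow> indicator (box a b) x"
proof (cases "x \<in> box a b")
  case True
  have "\<forall>\<^sub>F n in sequentially. real (Suc n) * u \<ge> 1" if "u > 0" for u :: real
  proof -
    obtain m :: nat where "1 < real m * u"
      using \<open>u > 0\<close> reals_Archimedean3 by blast
    then have "real (Suc n) * u \<ge> 1" if "n \<ge> m" for n
      using that \<open>u > 0\<close> mult_right_mono[of "real m" "real (Suc n)" u] by linarith
    then show ?thesis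
      by (auto simp: eventually_sequentially)
  qed
  then have "\<forall>\<^sub>F n in sequentially. \<forall>i. real (Suc n) * (x $ i - a $ i) \<ge> 1 \<and> real (Suc n) * (b $ i - x $ i) \<ge> 1"
    using True by (intro eventually_all_finite eventually_conj) (auto simp: mem_box_cart)
  then have "\<forall>\<^sub>F n in sequentially. box_bump (real (Suc n)) a b x = 1"
    by eventually_elim (auto intro: box_bump_eq_1)
  then show ?thesis
    using True by (simp add: tendsto_eventually)
next
  case False
  then have "box_bump (real (Suc n)) a b x = 0" for n
    using box_bump_nonzero[of "real (Suc n)"] by fastforce
  then show ?thesis using False by simp
qed

lemma test_functionsI:
  "(\<And>n. times_differentiable n f) \<Longrightarrow> bounded {x. f x \<noteq> 0} \<Longrightarrow> f \<in> test_functions"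
  by (simp add: test_functions_def compact_closure)

lemma test_functionsD:
  assumes "f \<in> test_functions"
  shows "times_differentiable n f" "continuous_on UNIV f" "bounded {x. f x \<noteq> 0}"
  using assms times_differentiable_imp_continuous[of 0 f]
  by (auto simp: test_functions_def compact_closure)

lemma test_functions_mult:
  assumes "f \<in> test_functions" "g \<in> test_functions"
  shows "(\<lambda>x. f x * g x) \<in> test_functions"
proof (rule test_functionsI)
  show "times_differentiable n (\<lambda>x. f x * g x)" for n
    using assms by (intro times_differentiable_mult test_functionsD(1))
  show "bounded {x. f x * g x \<noteq> 0}"
    by (rule bounded_subset[OF test_functionsD(3)[OF assms(1)]]) auto
qed

lemma test_functions_cnj:
  assumes "f \<in> test_functions"
  shows "(\<lambda>x. cnj (f x)) \<in> test_functions"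
proof (rule test_functionsI)
  show "times_differentiable n (\<lambda>x. cnj (f x))" for n
    using assms by (intro times_differentiable_bounded_linear[OF bounded_linear_cnj] test_functionsD(1))
  show "bounded {x. cnj (f x) \<noteq> 0}"
    using test_functionsD(3)[OF assms] by simp
qed

lemma box_bump_test_function:
  assumes "c > 0"
  shows "(\<lambda>x. complex_of_real (box_bump c a b x)) \<in> test_functions"
proof (rule test_functionsI)
  fix n
  have affine: "times_differentiable n (\<lambda>x :: real ^ 'a. smooth_step (k * x $ i + d))" for k d i
  proof -
    have "linear (\<lambda>x :: real ^ 'a. k * x $ i)"
      by (rule linearI) (simp_all add: algebra_simps)
    from times_differentiable_affine[OF this smooth_step(1)] show ?thesis .
  qed
  have "times_differentiable n (\<lambda>x. smooth_step (c * (x $ i - a $ i)) * smooth_step (c * (b $ i - x $ i)))" for i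
    using times_differentiable_mult[OF affine[of c i "- (c * a $ i)"] affine[of "- c" i "c * b $ i"]]
    by (simp add: right_diff_distrib)
  then have "times_differentiable n (box_bump c a b)"
    using times_differentiable_prod[of UNIV n "\<lambda>i x. smooth_step (c * (x $ i - a $ i)) * smooth_step (c * (b $ i - x $ i))"]
    unfolding box_bump_def[abs_def] by simp
  then show "times_differentiable n (\<lambda>x. complex_of_real (box_bump c a b x))"
    by (rule times_differentiable_bounded_linear[OF bounded_linear_of_real])
  have "{x. complex_of_real (box_bump c a b x) \<noteq> 0} \<subseteq> box a b"
    using box_bump_nonzero[OF assms] by auto
  then show "bounded {x. complex_of_real (box_bump c a b x) \<noteq> 0}"
    using bounded_subset bounded_box by blast
qed

section \<open>Linear changes of variables\<close>

text \<open>
  Linear maps are composed of maps with an identically zero coordinate, diagonal maps, transpositions of two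
  coordinates and shears, and composition multiplies determinants. A transposition is
  an involution, so its determinant has modulus 1, and the determinant of a shear is that of the
  identity after one row operation. These two arguments work for an arbitrary finite index type.
\<close>

proposition measure_linear_image_finite:
  fixes f :: "real ^ 'n \<Rightarrow> real ^ 'n"
  assumes "linear f" "S \<in> lmeasurable"
  shows "f ` S \<in> lmeasurable \<and> measure lebesgue (f ` S) = \<bar>det (matrix f)\<bar> * measure lebesgue S"
proof -
  let ?P = "\<lambda>f :: real ^ 'n \<Rightarrow> real ^ 'n. \<forall>S\<in>lmeasurable. f ` S \<in> lmeasurable \<and>
              measure lebesgue (f ` S) = \<bar>det (matrix f)\<bar> * measure lebesgue S"
  have "?P f"
    using \<open>linear f\<close>
  proof (rule induct_linear_elementary)
    fix f g :: "real ^ 'n \<Rightarrow> real ^ 'n"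
    assume *: "linear f" "linear g" "?P f" "?P g"
    show "?P (f \<circ> g)"
      using * by (auto simp: image_comp [symmetric] matrix_compose det_mul abs_mult simp del: o_apply image_cong_simp)
  next
    fix f :: "real ^ 'n \<Rightarrow> real ^ 'n" and i
    assume f: "linear f" "\<And>x. f x $ i = 0"
    have "\<not> surj f"
      using f(2) by (metis surjE vec_component zero_neq_one)
    then have ninj: "\<not> inj f"
      using f(1) linear_injective_imp_surjective by blast
    then have "negligible (f ` S)" for S
      using f(1) negligible_linear_singular_image by blast
    moreover have "det (matrix f) = 0"
      using ninj det_nz_iff_inj[OF f(1)] by blast
    ultimately show "?P f"
      using negligible_iff_measure by auto
  next
    fix c :: "'n \<Rightarrow> real"
    have "det (matrix (\<lambda>x. \<chi> i. c i * x $ i)) = prod c UNIV"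
      by (subst det_diagonal) (auto simp: matrix_def axis_def)
    then show "?P (\<lambda>x. \<chi> i. c i * x $ i)"
      by (auto simp: measurable_stretch measure_stretch)
  next
    fix m n :: 'n
    assume "m \<noteq> n"
    define h :: "real ^ 'n \<Rightarrow> real ^ 'n" where "h = (\<lambda>x. \<chi> i. x $ Transposition.transpose m n i)"
    have lin: "linear h"
      by (rule linearI) (simp_all add: h_def vec_eq_iff)
    have hh: "h (h x) = x" for x
      by (simp add: h_def vec_eq_iff)
    have "matrix h ** matrix h = mat 1"
      using matrix_compose[OF lin lin] hh by (simp add: o_def matrix_id_mat_1[unfolded id_def])
    then have "(det (matrix h))\<^sup>2 = 1"
      by (metis det_I det_mul power2_eq_square)
    then have "\<bar>det (matrix h)\<bar> = 1"
      by (simp add: abs_square_eq_1)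
    moreover have "measure lebesgue (h ` cbox a b) = measure lebesgue (cbox a b)" for a b
    proof -
      have "h ` cbox a b = cbox (h a) (h b)"
      proof safe
        fix x assume x: "x \<in> cbox (h a) (h b)"
        then have "h x \<in> cbox a b"
          unfolding mem_box_cart h_def by simp (metis transpose_involutory)
        then show "x \<in> h ` cbox a b"
          using hh by (metis image_eqI)
      qed (auto simp: mem_box_cart h_def)
      moreover have "(\<Prod>i\<in>UNIV. h b $ i - h a $ i) = (\<Prod>i\<in>UNIV. b $ i - a $ i)"
        unfolding h_def using prod.permute[OF permutes_swap_id, where S=UNIV and g="\<lambda>i. (b - a) $ i"]
        by (simp add: o_def)
      moreover have "cbox (h a) (h b) = {} \<longleftrightarrow> cbox a b = {}"
        using \<open>h ` cbox a b = cbox (h a) (h b)\<close> by (metis image_is_empty)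
      ultimately show ?thesis
        by (simp add: content_cbox_if_cart)
    qed
    ultimately have "?P h"
      by (metis (no_types) lin measure_linear_sufficient mult_1)
    then show "?P (\<lambda>x. \<chi> i. x $ Transposition.transpose m n i)"
      unfolding h_def .
  next
    fix m n :: 'n
    assume "m \<noteq> n"
    define h :: "real ^ 'n \<Rightarrow> real ^ 'n" where "h = (\<lambda>x. \<chi> i. if i = m then x $ m + x $ n else x $ i)"
    have lin: "linear h"
      by (rule linearI) (simp_all add: h_def vec_eq_iff algebra_simps)
    have "matrix h = (\<chi> k. if k = m then row m (mat 1) + 1 *s row n (mat 1) else row k (mat 1))"
      using \<open>m \<noteq> n\<close> by (simp add: matrix_def h_def vec_eq_iff row_def mat_def axis_def)
    then have "det (matrix h) = 1"
      using det_row_operation[OF \<open>m \<noteq> n\<close>, of "mat 1 :: real ^ 'n ^ 'n" 1] by simp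
    moreover have "measure lebesgue (h ` cbox a b) = measure lebesgue (cbox a b)" for a b
    proof (cases "cbox a b = {}")
      case False
      \<comment> \<open>The volume of a sheared box is known for boxes with nonnegative lower corner.\<close>
    have box: "cbox a b = (+) a ` cbox 0 (b - a)"
        using cbox_translation[of a 0 "b - a"] by simp
      have ne: "cbox 0 (b - a) \<noteq> {}"
        using False unfolding box by blast
      have "h ` cbox a b = (+) (h a) ` h ` cbox 0 (b - a)"
        unfolding box image_image using lin by (simp add: linear_add)
      then have "measure lebesgue (h ` cbox a b) = measure lebesgue (h ` cbox 0 (b - a))"
        by (simp only: measure_translation)
      also have "\<dots> = measure lebesgue (cbox 0 (b - a))"
        unfolding h_def using measure_shear_interval[OF \<open>m \<noteq> n\<close> ne] by simp
      also have "\<dots> = measure lebesgue (cbox a b)"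
        unfolding box by (simp only: measure_translation)
      finally show ?thesis .
    qed simp
    ultimately have eqs: "det (matrix h) = 1" "\<And>a b. measure lebesgue (h ` cbox a b) = measure lebesgue (cbox a b)"
      by blast+
    have "?P h"
    proof
      fix S :: "(real ^ 'n) set"
      assume "S \<in> lmeasurable"
      then have "h ` S \<in> lmeasurable \<and> 1 * measure lebesgue S = measure lebesgue (h ` S)"
        by (rule measure_linear_sufficient[OF lin]) (simp only: eqs mult_1)
      then show "h ` S \<in> lmeasurable \<and> measure lebesgue (h ` S) = \<bar>det (matrix h)\<bar> * measure lebesgue S"
        by (simp only: eqs abs_one mult_1)
    qed
    then show "?P (\<lambda>x. \<chi> i. if i = m then x $ m + x $ n else x $ i)"
      unfolding h_def .
  qed
  then show ?thesis using assms(2) by blast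
qed

lemma matrix_inv_inverse:
  fixes U :: "real ^ 'n ^ 'n"
  assumes "invertible U"
  shows "U ** matrix_inv U = mat 1" "matrix_inv U ** U = mat 1"
  using assms someI_ex[of "\<lambda>V. U ** V = mat 1 \<and> V ** U = mat 1"]
  by (auto simp: invertible_def matrix_inv_def)

lemma matrix_inv_vector [simp]:
  fixes U :: "real ^ 'n ^ 'n"
  assumes "invertible U"
  shows "matrix_inv U *v (U *v x) = x" "U *v (matrix_inv U *v x) = x"
  using assms by (simp_all add: matrix_vector_mul_assoc matrix_inv_inverse)

lemma invertible_image_eq_vimage:
  fixes U :: "real ^ 'n ^ 'n"
  assumes "invertible U"
  shows "(*v) (matrix_inv U) ` S = (*v) U -` S"
  using assms by (force simp: image_iff)

lemma det_matrix_inv: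
  fixes U :: "real ^ 'n ^ 'n"
  assumes "invertible U"
  shows "det (matrix_inv U) = inverse (det U)"
  using assms by (metis det_I det_mul inverse_unique matrix_inv_inverse(1))

lemma measurable_matrix_vector_mult_lebesgue:
  fixes U :: "real ^ 'n ^ 'n"
  assumes "invertible U"
  shows "(*v) U \<in> lebesgue \<rightarrow>\<^sub>M lebesgue"
proof (rule measurableI)
  fix S :: "(real ^ 'n) set"
  assume S: "S \<in> sets lebesgue"
  have "S = (\<Union>n. S \<inter> cball 0 (real n))"
    by (auto intro: real_arch_simple)
  moreover have "(*v) (matrix_inv U) ` (S \<inter> cball 0 (real n)) \<in> sets lebesgue" for n
  proof -
    have "S \<inter> cball 0 (real n) \<in> lmeasurable"
      using S by (auto intro!: bounded_set_imp_lmeasurable bounded_Int)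
    then show ?thesis
      using measure_linear_image_finite[of "(*v) (matrix_inv U)"] fmeasurableD by blast
  qed
  ultimately have "(*v) (matrix_inv U) ` S \<in> sets lebesgue"
    by (metis (no_types, lifting) image_UN sets.countable_UN' countableI_type image_subset_iff)
  then show "(*v) U -` S \<inter> space lebesgue \<in> sets lebesgue"
    by (simp add: invertible_image_eq_vimage[OF assms])
qed simp

lemma measure_matrix_vimage:
  fixes U :: "real ^ 'n ^ 'n"
  assumes "invertible U" "S \<in> lmeasurable"
  shows "(*v) U -` S \<in> lmeasurable" "measure lebesgue ((*v) U -` S) = measure lebesgue S / \<bar>det U\<bar>"
  using measure_linear_image_finite[of "(*v) (matrix_inv U)" S] assms
  by (simp_all add: invertible_image_eq_vimage det_matrix_inv abs_inverse divide_inverse mult.commute)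

text \<open>
  Sets of infinite measure are reached by exhausting them with their intersections with balls.
\<close>

lemma emeasure_matrix_vimage:
  fixes U :: "real ^ 'n ^ 'n"
  assumes "invertible U" "S \<in> sets lebesgue"
  shows "emeasure lebesgue ((*v) U -` S) = emeasure lebesgue S / ennreal \<bar>det U\<bar>"
proof -
  have d: "\<bar>det U\<bar> > 0"
    using assms(1) invertible_det_nz by auto
  have m: "(*v) U -` T \<in> sets lebesgue" if "T \<in> sets lebesgue" for T
    using measurable_sets[OF measurable_matrix_vector_mult_lebesgue[OF assms(1)] that] by simp
  define B where "B n = S \<inter> cball 0 (real n)" for n
  have B: "B n \<in> lmeasurable" for n
    using assms(2) by (auto simp: B_def intro!: bounded_set_imp_lmeasurable bounded_Int)
  have S: "S = (\<Union>n. B n)"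
    by (auto simp: B_def intro: real_arch_simple)
  have inc: "incseq B"
    by (rule incseq_SucI) (auto simp: B_def)
  have "(\<lambda>n. emeasure lebesgue (B n) / ennreal \<bar>det U\<bar>) \<longlonglongrightarrow> emeasure lebesgue S / ennreal \<bar>det U\<bar>"
    unfolding S using d B inc
    by (simp only: divide_ennreal_def mult.commute[of _ "inverse (ennreal \<bar>det U\<bar>)"])
      (intro ennreal_tendsto_cmult Lim_emeasure_incseq; auto simp: fmeasurableD inverse_ennreal)
  moreover have "emeasure lebesgue (B n) / ennreal \<bar>det U\<bar> = emeasure lebesgue ((*v) U -` B n)" for n
    using measure_matrix_vimage[OF assms(1) B[of n]] B d
    by (simp add: emeasure_eq_measure2 divide_ennreal)
  moreover have "(\<lambda>n. emeasure lebesgue ((*v) U -` B n)) \<longlonglongrightarrow> emeasure lebesgue ((*v) U -` S)"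
    unfolding S vimage_UN using B inc
    by (intro Lim_emeasure_incseq) (auto simp: m fmeasurableD incseq_def intro!: vimage_mono)
  ultimately show ?thesis
    using LIMSEQ_unique by auto
qed

lemma nn_integral_matrix:
  fixes U :: "real ^ 'n ^ 'n"
  assumes U: "invertible U" and g: "g \<in> borel_measurable lebesgue"
  shows "(\<integral>\<^sup>+x. g (U *v x) \<partial>lebesgue) = (\<integral>\<^sup>+x. g x \<partial>lebesgue) / ennreal \<bar>det U\<bar>"
proof -
  note mU = measurable_matrix_vector_mult_lebesgue[OF U]
  have d: "\<bar>det U\<bar> > 0"
    using U invertible_det_nz by auto
  have "distr lebesgue lebesgue ((*v) U) = density lebesgue (\<lambda>_. inverse (ennreal \<bar>det U\<bar>))"
  proof (rule measure_eqI)
    fix A assume "A \<in> sets (distr lebesgue lebesgue ((*v) U))"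
    then have "A \<in> sets lebesgue" by simp
    then show "emeasure (distr lebesgue lebesgue ((*v) U)) A
        = emeasure (density lebesgue (\<lambda>_. inverse (ennreal \<bar>det U\<bar>))) A"
      using emeasure_matrix_vimage[OF U] mU
      by (simp add: emeasure_distr emeasure_density_const divide_ennreal_def mult.commute)
  qed simp
  moreover have "(\<integral>\<^sup>+x. g (U *v x) \<partial>lebesgue) = (\<integral>\<^sup>+x. g x \<partial>distr lebesgue lebesgue ((*v) U))"
    using mU g by (simp add: nn_integral_distr)
  ultimately have "(\<integral>\<^sup>+x. g (U *v x) \<partial>lebesgue) = (\<integral>\<^sup>+x. inverse (ennreal \<bar>det U\<bar>) * g x \<partial>lebesgue)"
    using g by (simp add: nn_integral_density)
  also have "\<dots> = (\<integral>\<^sup>+x. g x \<partial>lebesgue) / ennreal \<bar>det U\<bar>"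
    using g by (subst nn_integral_cmult) (simp_all add: divide_ennreal_def mult.commute)
  finally show ?thesis .
qed

section \<open>Square-integrable functions\<close>

text \<open>
  Translation is the affine map with all scaling factors equal to 1.
\<close>

lemma distr_lebesgue_translation:
  fixes t :: "'a::euclidean_space"
  shows "(+) t \<in> lebesgue \<rightarrow>\<^sub>M lebesgue" "distr lebesgue lebesgue ((+) t) = lebesgue"
proof -
  have T: "(\<lambda>x. t + (\<Sum>j\<in>Basis. (1 * (x \<bullet> j)) *\<^sub>R j)) = (+) t"
    by (simp add: euclidean_representation)
  show "(+) t \<in> lebesgue \<rightarrow>\<^sub>M lebesgue"
    using lebesgue_affine_measurable[of "\<lambda>_::'a. 1" t] unfolding T by simp
  show "distr lebesgue lebesgue ((+) t) = lebesgue"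
    using lebesgue_affine_euclidean[of "\<lambda>_::'a. 1" t] unfolding T by (simp add: density_1)
qed

lemma measurable_lebesgue_translation:
  fixes t :: "'a::euclidean_space"
  assumes "f \<in> borel_measurable lebesgue"
  shows "(\<lambda>x. f (x + t)) \<in> borel_measurable lebesgue"
  using measurable_compose[OF distr_lebesgue_translation(1)[of t] assms] by (simp add: add.commute)

lemma integral_lebesgue_translation:
  fixes f :: "'a::euclidean_space \<Rightarrow> 'b::{banach, second_countable_topology}"
  assumes "f \<in> borel_measurable lebesgue"
  shows "(\<integral>x. f (x + t) \<partial>lebesgue) = (\<integral>x. f x \<partial>lebesgue)"
  using integral_distr[OF distr_lebesgue_translation(1)[of t] assms]
  by (simp add: distr_lebesgue_translation add.commute)

lemma integrable_lebesgue_translation: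
  fixes f :: "'a::euclidean_space \<Rightarrow> 'b::{banach, second_countable_topology}"
  assumes "integrable lebesgue f"
  shows "integrable lebesgue (\<lambda>x. f (x + t))"
  using integrable_distr[OF distr_lebesgue_translation(1)[of t], of f] assms
  by (simp add: distr_lebesgue_translation add.commute)

definition square_integrable :: "'a measure \<Rightarrow> ('a \<Rightarrow> complex) \<Rightarrow> bool" where
  "square_integrable M F \<longleftrightarrow> F \<in> borel_measurable M \<and> integrable M (\<lambda>x. (cmod (F x))\<^sup>2)"

lemma cmod_add_squared_le: "(cmod (a + b))\<^sup>2 \<le> 2 * (cmod a)\<^sup>2 + 2 * (cmod b)\<^sup>2"
proof -
  have "(cmod (a + b))\<^sup>2 \<le> (cmod a + cmod b)\<^sup>2"
    by (simp add: norm_triangle_ineq)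
  also have "\<dots> \<le> 2 * (cmod a)\<^sup>2 + 2 * (cmod b)\<^sup>2"
    using sum_squares_bound[of "cmod a" "cmod b"] by (simp add: power2_sum)
  finally show ?thesis .
qed

lemma square_integrable_add:
  assumes "square_integrable M F" "square_integrable M G"
  shows "square_integrable M (\<lambda>x. F x + G x)"
  unfolding square_integrable_def
proof
  have [measurable]: "F \<in> borel_measurable M" "G \<in> borel_measurable M"
    using assms by (auto simp: square_integrable_def)
  show "(\<lambda>x. F x + G x) \<in> borel_measurable M" by measurable
  have "integrable M (\<lambda>x. 2 * (cmod (F x))\<^sup>2 + 2 * (cmod (G x))\<^sup>2)"
    using assms by (auto simp: square_integrable_def)
  then show "integrable M (\<lambda>x. (cmod (F x + G x))\<^sup>2)"
    by (rule Bochner_Integration.integrable_bound) (use cmod_add_squared_le in \<open>auto intro!: AE_I2\<close>)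
qed

lemma square_integrable_cmult:
  "square_integrable M F \<Longrightarrow> square_integrable M (\<lambda>x. c * F x)"
  unfolding square_integrable_def by (auto simp: norm_mult power_mult_distrib)

lemma square_integrable_cnj:
  "square_integrable M F \<Longrightarrow> square_integrable M (\<lambda>x. cnj (F x))"
  unfolding square_integrable_def
  by (auto intro: measurable_compose[OF _ borel_measurable_continuous_onI[OF continuous_on_cnj[OF continuous_on_id]]])

lemma square_integrable_sum:
  "(\<And>i. i \<in> I \<Longrightarrow> square_integrable M (F i)) \<Longrightarrow> square_integrable M (\<lambda>x. \<Sum>i\<in>I. F i x)"
proof (induction I rule: infinite_finite_induct)
  case (insert i I)
  then show ?case by (simp add: square_integrable_add)
qed (auto simp: square_integrable_def)

lemma integrable_mult_square_integrable:
  assumes "square_integrable M F" "square_integrable M G"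
  shows "integrable M (\<lambda>x. F x * G x)"
proof (rule Bochner_Integration.integrable_bound)
  have [measurable]: "F \<in> borel_measurable M" "G \<in> borel_measurable M"
    using assms by (auto simp: square_integrable_def)
  show "integrable M (\<lambda>x. (cmod (F x))\<^sup>2 + (cmod (G x))\<^sup>2)"
    using assms by (auto simp: square_integrable_def)
  show "(\<lambda>x. F x * G x) \<in> borel_measurable M" by measurable
  have "cmod (a * b) \<le> (cmod a)\<^sup>2 + (cmod b)\<^sup>2" for a b
  proof -
    have "0 \<le> cmod a * cmod b" "2 * (cmod a * cmod b) \<le> (cmod a)\<^sup>2 + (cmod b)\<^sup>2"
      using sum_squares_bound[of "cmod a" "cmod b"] by simp_all
    then show ?thesis unfolding norm_mult by linarith
  qed
  then show "AE x in M. norm (F x * G x) \<le> norm ((cmod (F x))\<^sup>2 + (cmod (G x))\<^sup>2)"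
    by auto
qed

lemma square_integrable_translation:
  fixes F :: "'a::euclidean_space \<Rightarrow> complex"
  assumes "square_integrable lebesgue F"
  shows "square_integrable lebesgue (\<lambda>x. F (x + t))"
  using assms integrable_lebesgue_translation[of "\<lambda>x. (cmod (F x))\<^sup>2" t]
  by (auto simp: square_integrable_def intro: measurable_lebesgue_translation)

lemma (in finite_measure) square_integrable_bounded:
  assumes "F \<in> borel_measurable M" "\<And>x. x \<in> space M \<Longrightarrow> cmod (F x) \<le> B"
  shows "square_integrable M F"
  unfolding square_integrable_def
proof
  show "integrable M (\<lambda>x. (cmod (F x))\<^sup>2)"
    using assms by (intro integrable_const_bound[of _ "B\<^sup>2"]) (auto intro!: AE_I2 power_mono)
qed (rule assms)

lemma square_integrable_nn_integral:
  assumes "square_integrable M F"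
  shows "(\<integral>\<^sup>+x. ennreal ((cmod (F x))\<^sup>2) \<partial>M) = ennreal (\<integral>x. (cmod (F x))\<^sup>2 \<partial>M)"
  using assms by (intro nn_integral_eq_integral) (auto simp: square_integrable_def)

section \<open>The integer lattice and its fundamental cell\<close>

lemma int_lattice_closed [simp]:
  "0 \<in> int_lattice" "m \<in> int_lattice \<Longrightarrow> n \<in> int_lattice \<Longrightarrow> m + n \<in> int_lattice"
  "m \<in> int_lattice \<Longrightarrow> n \<in> int_lattice \<Longrightarrow> m - n \<in> int_lattice"
  "m \<in> int_lattice \<Longrightarrow> - m \<in> int_lattice" "axis i 1 \<in> int_lattice"
  by (auto simp: int_lattice_def axis_def)

locale dilated_torus =
  fixes U :: "real ^ 'd ^ 'd"
  assumes invertible_U: "invertible U"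
begin

definition period :: "real ^ 'd \<Rightarrow> real ^ 'd" where
  "period n = (2 * pi) *\<^sub>R (matrix_inv U *v n)"

text \<open>
  The preimage under \<open>U\<close> of the half-open cube of side \<open>2 pi\<close>; half-open, so that its translates by
  periods are disjoint and cover the space.
\<close>

definition cell :: "(real ^ 'd) set" where
  "cell = {x. \<forall>i. 0 \<le> (U *v x) $ i \<and> (U *v x) $ i < 2 * pi}"

text \<open>
  The index of the translate of the cell that contains \<open>x\<close>.
\<close>

definition tile :: "real ^ 'd \<Rightarrow> real ^ 'd" where
  "tile x = (\<chi> i. of_int \<lfloor>(U *v x) $ i / (2 * pi)\<rfloor>)"

text \<open>
  The sign of the exponent is the one in \<^const>\<open>dilate_modulate\<close>, so that the coefficients of a frame
  series become Fourier coefficients with respect to these characters.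
\<close>

definition char :: "real ^ 'd \<Rightarrow> real ^ 'd \<Rightarrow> complex" where
  "char k x = exp (- \<i> * complex_of_real (k \<bullet> (U *v x)))"

abbreviation "vol \<equiv> measure lebesgue cell"

lemma U_period [simp]: "U *v period n = (2 * pi) *\<^sub>R n"
  using invertible_U by (simp add: period_def matrix_vector_mult_scaleR)

lemma period_simps [simp]: "period 0 = 0" "period (m + n) = period m + period n"
  by (simp_all add: period_def matrix_vector_right_distrib algebra_simps)

lemma tile_in_lattice [simp]: "tile x \<in> int_lattice"
  by (simp add: tile_def int_lattice_def)

lemma tile_eq_iff:
  assumes "n \<in> int_lattice"
  shows "tile (x + period n) = n \<longleftrightarrow> x \<in> cell"
proof -
  have "\<lfloor>(U *v (x + period n)) $ i / (2 * pi)\<rfloor> = \<lfloor>n $ i\<rfloor> \<longleftrightarrow> 0 \<le> (U *v x) $ i \<and> (U *v x) $ i < 2 * pi" for i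
  proof -
    obtain m where m: "n $ i = of_int m"
      using assms by (auto simp: int_lattice_def elim: Ints_cases)
    have "(U *v (x + period n)) $ i / (2 * pi) = (U *v x) $ i / (2 * pi) + of_int m"
      by (simp add: matrix_vector_right_distrib m add_divide_distrib)
    then have "\<lfloor>(U *v (x + period n)) $ i / (2 * pi)\<rfloor> = \<lfloor>(U *v x) $ i / (2 * pi)\<rfloor> + m"
      by simp
    then have "\<lfloor>(U *v (x + period n)) $ i / (2 * pi)\<rfloor> = \<lfloor>n $ i\<rfloor> \<longleftrightarrow> \<lfloor>(U *v x) $ i / (2 * pi)\<rfloor> = 0"
      by (simp add: m)
    moreover have "\<lfloor>y / (2 * pi)\<rfloor> = 0 \<longleftrightarrow> 0 \<le> y \<and> y < 2 * pi" for y
      by (simp add: floor_eq_iff zero_le_divide_iff divide_less_eq) (use pi_gt_zero in linarith)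
    ultimately show ?thesis by simp
  qed
  moreover have "n $ i = of_int \<lfloor>n $ i\<rfloor>" for i
    using assms by (simp add: int_lattice_def of_int_floor)
  ultimately have "real_of_int \<lfloor>(U *v (x + period n)) $ i / (2 * pi)\<rfloor> = n $ i \<longleftrightarrow>
      0 \<le> (U *v x) $ i \<and> (U *v x) $ i < 2 * pi" for i
    by (metis of_int_eq_iff)
  then show ?thesis
    unfolding tile_def cell_def vec_eq_iff mem_Collect_eq vec_lambda_beta by simp
qed

lemma tile_translate:
  assumes "n \<in> int_lattice"
  shows "tile x = n \<longleftrightarrow> x - period n \<in> cell"
  using tile_eq_iff[OF assms, of "x - period n"] by simp

lemma finite_tiles:
  assumes "bounded B"
  shows "finite (tile ` B)"
proof -
  obtain C where C: "\<And>x. norm (U *v x) \<le> C * norm x"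
    using linear_bounded[OF matrix_vector_mul_linear[of U]] by (auto simp: mult.commute)
  obtain R where R: "\<And>x. x \<in> B \<Longrightarrow> norm x \<le> R"
    using assms by (auto simp: bounded_iff)
  have "tile ` B \<subseteq> (\<lambda>f. \<chi> i. of_int (f i)) ` (Pi\<^sub>E UNIV (\<lambda>_. {- \<lceil>\<bar>C\<bar> * \<bar>R\<bar>\<rceil> - 1..\<lceil>\<bar>C\<bar> * \<bar>R\<bar>\<rceil>}))"
  proof safe
    fix x assume x: "x \<in> B"
    have "\<lfloor>(U *v x) $ i / (2 * pi)\<rfloor> \<in> {- \<lceil>\<bar>C\<bar> * \<bar>R\<bar>\<rceil> - 1..\<lceil>\<bar>C\<bar> * \<bar>R\<bar>\<rceil>}" for i
    proof -
      have "\<bar>(U *v x) $ i\<bar> \<le> C * norm x"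
        using C[of x] component_le_norm_cart[of "U *v x" i] by linarith
      also have "\<dots> \<le> \<bar>C\<bar> * \<bar>R\<bar>"
        using R[OF x] by (intro mult_mono) auto
      finally have 1: "\<bar>(U *v x) $ i\<bar> \<le> \<bar>C\<bar> * \<bar>R\<bar>" .
      have "\<bar>(U *v x) $ i / (2 * pi)\<bar> \<le> \<bar>(U *v x) $ i\<bar>"
        using pi_ge_two by (simp add: abs_divide divide_le_eq mult_le_cancel_left1)
      with 1 show ?thesis
        using le_of_int_ceiling[of "\<bar>C\<bar> * \<bar>R\<bar>"] unfolding atLeastAtMost_iff le_floor_iff floor_le_iff
        by (simp only: of_int_diff of_int_minus of_int_1 of_int_add) linarith
    qed
    then show "tile x \<in> (\<lambda>f. \<chi> i. of_int (f i)) ` (Pi\<^sub>E UNIV (\<lambda>_. {- \<lceil>\<bar>C\<bar> * \<bar>R\<bar>\<rceil> - 1..\<lceil>\<bar>C\<bar> * \<bar>R\<bar>\<rceil>}))"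
      by (intro image_eqI[of _ _ "\<lambda>i. \<lfloor>(U *v x) $ i / (2 * pi)\<rfloor>"]) (auto simp: tile_def)
  qed
  then show ?thesis
    by (rule finite_subset) (intro finite_imageI finite_PiE; simp)
qed

lemma cell_vimage: "cell = (*v) U -` {y. \<forall>i. 0 \<le> y $ i \<and> y $ i < 2 * pi}"
  by (auto simp: cell_def)

lemma cell_lmeasurable: "cell \<in> lmeasurable"
  and vol: "vol = (2 * pi) ^ CARD('d) / \<bar>det U\<bar>"
  and bounded_cell: "bounded cell"
proof -
  define Q :: "(real ^ 'd) set" where "Q = {y. \<forall>i. 0 \<le> y $ i \<and> y $ i < 2 * pi}"
  have box: "box 0 (\<chi> i. 2 * pi) \<subseteq> Q" "Q \<subseteq> cbox 0 (\<chi> i. 2 * pi)"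
    by (auto simp: Q_def mem_box_cart less_imp_le)
  have bQ: "bounded Q"
    using box(2) bounded_cbox bounded_subset by blast
  have "Q = (\<Inter>i. {y. 0 \<le> y $ i} \<inter> {y. y $ i < 2 * pi})"
    by (auto simp: Q_def)
  moreover have "\<dots> \<in> sets borel"
    by (intro sets.finite_INT sets.Int borel_closed borel_open closed_Collect_le open_Collect_less continuous_intros) auto
  ultimately have Qb: "Q \<in> sets borel" by simp
  then have Q: "Q \<in> lmeasurable"
    using bQ by (intro bounded_set_imp_lmeasurable) auto
  have "measure lebesgue (box 0 (\<chi> i. 2 * pi) :: (real ^ 'd) set) \<le> measure lebesgue Q"
    using box Q by (intro measure_mono_fmeasurable) auto
  moreover have "measure lebesgue Q \<le> measure lebesgue (cbox 0 (\<chi> i. 2 * pi) :: (real ^ 'd) set)"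
    using box Q Qb by (intro measure_mono_fmeasurable) auto
  moreover have c: "measure lebesgue (cbox 0 (\<chi> i. 2 * pi) :: (real ^ 'd) set) = (2 * pi) ^ CARD('d)"
  proof -
    have "0 \<in> (cbox 0 (\<chi> i. 2 * pi) :: (real ^ 'd) set)"
      by (simp add: mem_box_cart)
    then show ?thesis
      using content_cbox_cart[of 0 "\<chi> i. 2 * pi :: real ^ 'd"] by fastforce
  qed
  moreover have "measure lebesgue (box 0 (\<chi> i. 2 * pi) :: (real ^ 'd) set) = measure lebesgue (cbox 0 (\<chi> i. 2 * pi) :: (real ^ 'd) set)"
    by (simp add: measure_lborel_box_eq measure_lborel_cbox_eq)
  ultimately have mQ: "measure lebesgue Q = (2 * pi) ^ CARD('d)" by linarith
  show "cell \<in> lmeasurable" "vol = (2 * pi) ^ CARD('d) / \<bar>det U\<bar>"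
    unfolding cell_vimage Q_def[symmetric]
    using measure_matrix_vimage[OF invertible_U Q] mQ by auto
  have "cell = (*v) (matrix_inv U) ` Q"
    unfolding cell_vimage Q_def[symmetric] by (simp add: invertible_image_eq_vimage[OF invertible_U])
  then show "bounded cell"
    using bQ by (simp add: bounded_linear_image linear_conv_bounded_linear[symmetric])
qed

lemma vol_pos: "vol > 0"
  using invertible_U by (simp add: vol invertible_det_nz)

lemma sets_cell [measurable]: "cell \<in> sets lebesgue"
  using cell_lmeasurable by blast

lemma finite_measure_cell: "finite_measure (lebesgue_on cell)"
  using cell_lmeasurable by (simp add: finite_measure_lebesgue_on)

lemma sets_tile: "n \<in> int_lattice \<Longrightarrow> {x. tile x = n} \<in> sets lebesgue"
  using measurable_sets[OF distr_lebesgue_translation(1)[of "- period n"] sets_cell]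
  by (simp add: tile_translate vimage_def)

lemma char_simps:
  "char 0 x = 1" "char (k + l) x = char k x * char l x" "cnj (char k x) = char (- k) x"
  "cmod (char k x) = 1" "char k (x + y) = char k x * char k y" "char (k - l) x = char k x * cnj (char l x)"
proof -
  show *: "char (k + l) x = char k x * char l x" for k l
    unfolding char_def inner_left_distrib of_real_add distrib_left exp_add ..
  show "char k (x + y) = char k x * char k y"
    unfolding char_def matrix_vector_right_distrib inner_right_distrib of_real_add distrib_left exp_add ..
  show c: "cnj (char k x) = char (- k) x" for k
    unfolding char_def by (simp add: exp_cnj)
  show "char (k - l) x = char k x * cnj (char l x)"
    using *[of k "- l"] by (simp add: c)
qed (simp_all add: char_def norm_exp_eq_Re)

lemma char_period:
  assumes "k \<in> int_lattice" "n \<in> int_lattice"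
  shows "char k (period n) = 1"
proof -
  have "k \<bullet> n = (\<Sum>i\<in>UNIV. k $ i * n $ i)"
    by (simp add: inner_vec_def)
  also have "\<dots> \<in> \<int>"
    using assms by (intro Ints_sum) (auto simp: int_lattice_def)
  finally obtain m where "k \<bullet> n = of_int m"
    by (auto elim: Ints_cases)
  then have "- \<i> * complex_of_real (k \<bullet> (U *v period n)) = complex_of_real (2 * real_of_int (- m) * pi) * \<i>"
    by simp
  then show ?thesis
    unfolding char_def by (simp only: exp_integer_2pi[OF Ints_of_int])
qed

lemma char_shift:
  assumes "k \<in> int_lattice" "n \<in> int_lattice"
  shows "char k (x + period n) = char k x"
  using char_period[OF assms] by (simp add: char_simps)

lemma continuous_char: "continuous_on A (char k)"
proof -
  have "continuous_on A ((*v) U)"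
    by (rule linear_continuous_on[OF matrix_vector_mul_bounded_linear])
  then have "continuous_on A (\<lambda>x. k \<bullet> (U *v x))"
    by (intro continuous_on_inner continuous_on_const)
  then show ?thesis
    unfolding char_def[abs_def] by (intro continuous_on_exp continuous_on_mult continuous_on_const continuous_on_of_real)
qed

lemma measurable_char [measurable]: "char k \<in> borel_measurable (lebesgue_on A)" "char k \<in> borel_measurable lebesgue"
proof -
  have "char k \<in> borel_measurable borel"
    by (intro borel_measurable_continuous_onI continuous_char)
  then show "char k \<in> borel_measurable lebesgue"
    by (simp add: measurable_completion)
  then show "char k \<in> borel_measurable (lebesgue_on A)"
    by (rule measurable_restrict_space1)
qed

text \<open>
  The translates of the cell tile the space, and only the tiles indexed by \<open>S\<close> can meet the support of
  \<open>F\<close>; each of them is moved back to the cell by a translation.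
\<close>

lemma integral_unfold:
  fixes F :: "real ^ 'd \<Rightarrow> complex"
  assumes F: "integrable lebesgue F" and S: "finite S" "S \<subseteq> int_lattice" "\<And>x. F x \<noteq> 0 \<Longrightarrow> tile x \<in> S"
  shows "(\<integral>x. F x \<partial>lebesgue) = (\<Sum>n\<in>S. \<integral>x. F (x + period n) \<partial>lebesgue_on cell)"
proof -
  have mF [measurable]: "F \<in> borel_measurable lebesgue"
    using F by (rule borel_measurable_integrable)
  have tile: "{x. tile x = n} \<in> sets lebesgue" if "n \<in> S" for n
    using sets_tile S(2) that by blast
  have "F x = (\<Sum>n\<in>S. indicat_real {x. tile x = n} x *\<^sub>R F x)" for x
  proof (cases "F x = 0")
    case False
    then show ?thesis
      using S by (subst sum.remove[of S "tile x"]) (auto intro!: sum.neutral)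
  qed simp
  then have "(\<integral>x. F x \<partial>lebesgue) = (\<integral>x. (\<Sum>n\<in>S. indicat_real {x. tile x = n} x *\<^sub>R F x) \<partial>lebesgue)"
    by simp
  also have "\<dots> = (\<Sum>n\<in>S. \<integral>x. indicat_real {x. tile x = n} x *\<^sub>R F x \<partial>lebesgue)"
    using F tile by (intro Bochner_Integration.integral_sum integrable_mult_indicator)
  also have "\<dots> = (\<Sum>n\<in>S. \<integral>x. F (x + period n) \<partial>lebesgue_on cell)"
  proof (rule sum.cong[OF refl])
    fix n assume n: "n \<in> S"
    have "(\<integral>x. indicat_real {x. tile x = n} x *\<^sub>R F x \<partial>lebesgue)
        = (\<integral>x. indicat_real {x. tile x = n} (x + period n) *\<^sub>R F (x + period n) \<partial>lebesgue)"
      using tile[OF n] by (subst integral_lebesgue_translation) auto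
    also have "\<dots> = (\<integral>x. indicat_real cell x *\<^sub>R F (x + period n) \<partial>lebesgue)"
      using n S(2) tile_eq_iff[of n] by (intro Bochner_Integration.integral_cong) (auto simp: indicator_def)
    also have "\<dots> = (\<integral>x. F (x + period n) \<partial>lebesgue_on cell)"
      by (subst integral_restrict_space) auto
    finally show "(\<integral>x. indicat_real {x. tile x = n} x *\<^sub>R F x \<partial>lebesgue) = (\<integral>x. F (x + period n) \<partial>lebesgue_on cell)" .
  qed
  finally show ?thesis .
qed

text \<open>
  The integral of a periodic function over a translate of the cell is its integral over the cell.
  Translation by \<open>t\<close> also multiplies \<open>char k\<close> by the constant \<open>char k t\<close>, and for \<open>k \<noteq> 0\<close> some \<open>t\<close> makes
  this constant equal to -1; so the integral equals its own negative.
\<close>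

lemma integral_char:
  assumes k: "k \<in> int_lattice" "k \<noteq> 0"
  shows "(\<integral>x. char k x \<partial>lebesgue_on cell) = 0"
proof -
  obtain i where i: "k $ i \<noteq> 0"
    using k(2) by (auto simp: vec_eq_iff)
  \<comment> \<open>Chosen so that the phase is pi.\<close>
  define t where "t = matrix_inv U *v axis i (pi / k $ i)"
  have "k \<bullet> (U *v t) = pi"
    using i invertible_U by (simp add: t_def inner_axis)
  then have t: "char k t = -1"
    by (simp add: char_def exp_minus) 
  define F where "F x = indicat_real cell (x - t) *\<^sub>R char k x" for x
  have int0: "integrable lebesgue (\<lambda>x. indicat_real cell x *\<^sub>R char k (x + t))"
    using finite_measure.integrable_const_bound[OF finite_measure_cell, of "\<lambda>x. char k (x + t)" 1]
    by (simp add: char_simps norm_mult integrable_restrict_space)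
  have F: "integrable lebesgue F"
    using integrable_lebesgue_translation[OF int0, of "- t"] by (simp add: F_def[abs_def])
  have "{x. F x \<noteq> 0} \<subseteq> (+) t ` cell"
    by (auto simp: F_def indicator_def image_iff split: if_splits) (metis add_diff_cancel_left' diff_add_cancel add.commute)
  then have "bounded {x. F x \<noteq> 0}"
    by (rule bounded_subset[rotated]) (intro bounded_translation bounded_cell)
  define S where "S = tile ` {x. F x \<noteq> 0}"
  have S: "finite S" "S \<subseteq> int_lattice" "\<And>x. F x \<noteq> 0 \<Longrightarrow> tile x \<in> S"
    using finite_tiles[OF \<open>bounded _\<close>] by (auto simp: S_def)
  have "char k t * (\<integral>x. char k x \<partial>lebesgue_on cell) = (\<integral>x. char k (x + t) \<partial>lebesgue_on cell)"
    by (simp add: char_simps mult.commute)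
  also have "\<dots> = (\<integral>x. indicat_real cell x *\<^sub>R char k (x + t) \<partial>lebesgue)"
    by (subst integral_restrict_space) auto
  also have "\<dots> = (\<integral>x. F (x + t) \<partial>lebesgue)"
    by (simp add: F_def)
  also have "\<dots> = (\<integral>x. F x \<partial>lebesgue)"
    using F by (intro integral_lebesgue_translation) auto
  also have "\<dots> = (\<Sum>n\<in>S. \<integral>x. F (x + period n) \<partial>lebesgue_on cell)"
    by (rule integral_unfold[OF F S])
  also have "\<dots> = (\<integral>x. (\<Sum>n\<in>S. F (x + period n)) \<partial>lebesgue_on cell)"
    using F integrable_lebesgue_translation[OF F] integrable_mult_indicator[OF sets_cell]
    by (intro Bochner_Integration.integral_sum[symmetric]) (auto simp: integrable_restrict_space)
  also have "\<dots> = (\<integral>x. char k x \<partial>lebesgue_on cell)"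
  proof (rule Bochner_Integration.integral_cong[OF refl])
    fix x assume "x \<in> space (lebesgue_on cell)"
    then have x: "x \<in> cell" by simp
    define m where "m = - tile (x - t)"
    have m: "m \<in> int_lattice" by (simp add: m_def)
    have eq: "F (x + period n) = (if n = m then char k x else 0)" if "n \<in> int_lattice" for n
    proof -
      have "x + period n - t \<in> cell \<longleftrightarrow> tile (x - t) = - n"
      proof -
        have "period (- n) = - period n"
          using period_simps(2)[of n "- n"] by (simp add: eq_neg_iff_add_eq_0 add.commute)
        then have "x - t - period (- n) = x + period n - t" by simp
        with tile_translate[OF int_lattice_closed(4)[OF that], of "x - t"] show ?thesis
          by (simp only:)
      qed
      then have "x + period n - t \<in> cell \<longleftrightarrow> n = m"
        using equation_minus_iff[of "tile (x - t)" n] by (simp only: m_def)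
      then show ?thesis
        using char_shift[OF k(1) that] by (simp add: F_def indicator_def)
    qed
    have "F (x + period m) \<noteq> 0"
      using eq[OF m] by (simp add: char_def)
    then have "m \<in> S"
      using S(3)[of "x + period m"] tile_eq_iff[OF m, of x] x by simp
    have "(\<Sum>n\<in>S. F (x + period n)) = (\<Sum>n\<in>S. if n = m then char k x else 0)"
      using S(2) by (intro sum.cong refl eq) auto
    then show "(\<Sum>n\<in>S. F (x + period n)) = char k x"
      using S(1) \<open>m \<in> S\<close> by simp
  qed
  finally have "char k t * (\<integral>x. char k x \<partial>lebesgue_on cell) = (\<integral>x. char k x \<partial>lebesgue_on cell)" .
  then show ?thesis
    unfolding t by simp
qed

end

section \<open>Density of trigonometric polynomials\<close>

context dilated_torus
begin

inductive_set trig_poly :: "(real ^ 'd \<Rightarrow> complex) set" where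
  char: "k \<in> int_lattice \<Longrightarrow> (\<lambda>x. c * char k x) \<in> trig_poly"
| add: "s \<in> trig_poly \<Longrightarrow> t \<in> trig_poly \<Longrightarrow> (\<lambda>x. s x + t x) \<in> trig_poly"

lemma trig_poly_const: "(\<lambda>x. c) \<in> trig_poly"
  using trig_poly.char[of 0 c] by (simp add: char_simps(1))

lemma trig_poly_mult:
  assumes "s \<in> trig_poly" "t \<in> trig_poly"
  shows "(\<lambda>x. s x * t x) \<in> trig_poly"
  using assms(1)
proof induction
  case (char k c)
  show ?case
    using assms(2)
  proof induction
    case (char l d)
    have "(\<lambda>x. (c * d) * char (k + l) x) \<in> trig_poly"
      using char \<open>k \<in> int_lattice\<close> by (intro trig_poly.char) simp
    then show ?case by (simp add: char_simps(2) algebra_simps)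
  next
    case (add s t)
    from trig_poly.add[OF add.IH] show ?case by (simp add: algebra_simps)
  qed
next
  case (add s t)
  from trig_poly.add[OF add.IH] show ?case by (simp add: algebra_simps)
qed

lemma trig_poly_cmult: "t \<in> trig_poly \<Longrightarrow> (\<lambda>x. c * t x) \<in> trig_poly"
  by (rule trig_poly_mult[OF trig_poly_const])

lemma trig_poly_representation:
  assumes "t \<in> trig_poly"
  obtains K a where "finite K" "K \<subseteq> int_lattice" "t = (\<lambda>x. \<Sum>k\<in>K. a k * char k x)"
proof -
  have "\<exists>K a. finite K \<and> K \<subseteq> int_lattice \<and> (\<forall>k. k \<notin> K \<longrightarrow> a k = 0) \<and> t = (\<lambda>x. \<Sum>k\<in>K. a k * char k x)"
    using assms
  proof induction
    case (char k c)
    then show ?case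
      by (intro exI[of _ "{k}"] exI[of _ "\<lambda>l. if l = k then c else 0"]) simp
  next
    case (add s t)
    obtain K a where K: "finite K" "K \<subseteq> int_lattice" "\<And>k. k \<notin> K \<Longrightarrow> a k = 0" "s = (\<lambda>x. \<Sum>k\<in>K. a k * char k x)"
      using add.IH(1) by blast
    obtain L b where L: "finite L" "L \<subseteq> int_lattice" "\<And>k. k \<notin> L \<Longrightarrow> b k = 0" "t = (\<lambda>x. \<Sum>k\<in>L. b k * char k x)"
      using add.IH(2) by blast
    have "(\<Sum>k\<in>K. a k * char k x) = (\<Sum>k\<in>K \<union> L. a k * char k x)" for x
      using K L by (intro sum.mono_neutral_left) auto
    moreover have "(\<Sum>k\<in>L. b k * char k x) = (\<Sum>k\<in>K \<union> L. b k * char k x)" for x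
      using K L by (intro sum.mono_neutral_left) auto
    ultimately have "(\<lambda>x. s x + t x) = (\<lambda>x. \<Sum>k\<in>K \<union> L. (a k + b k) * char k x)"
      unfolding K(4) L(4) by (simp add: sum.distrib distrib_right)
    then show ?case
      using K(1-3) L(1-3) by (intro exI[of _ "K \<union> L"] exI[of _ "\<lambda>k. a k + b k"]) auto
  qed
  then show thesis using that by blast
qed

definition torus :: "(complex ^ 'd) set" where
  "torus = {z. \<forall>i. cmod (z $ i) = 1}"

text \<open>
  Uniform approximation by trigonometric polynomials needs a compact space on which they are functions
  that separate points. Such a space is the torus, obtained from the cell by gluing opposite faces.
\<close>

definition wrap :: "real ^ 'd \<Rightarrow> complex ^ 'd" where
  "wrap x = (\<chi> i. cis ((U *v x) $ i))"

lemma wrap_in_torus [simp]: "wrap x \<in> torus"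
  by (simp add: wrap_def torus_def)

lemma compact_torus: "compact torus"
proof -
  have "closed torus"
    unfolding torus_def by (intro closed_Collect_all closed_Collect_eq continuous_intros)
  moreover have "norm z \<le> real CARD('d)" if "z \<in> torus" for z
  proof -
    have "norm z \<le> (\<Sum>i\<in>UNIV. norm (z $ i))"
      unfolding norm_vec_def by (rule L2_set_le_sum) simp
    then show ?thesis using that by (simp add: torus_def)
  qed
  then have "bounded torus"
    by (auto simp: bounded_iff)
  ultimately show ?thesis
    by (simp add: compact_eq_bounded_closed)
qed

lemma inj_on_wrap_cell: "inj_on wrap cell"
proof (rule inj_onI)
  fix x y
  assume xy: "x \<in> cell" "y \<in> cell" "wrap x = wrap y"
  have "(U *v x) $ i = (U *v y) $ i" for i
  proof -
    have "cis ((U *v x) $ i) = cis ((U *v y) $ i)"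
      using xy(3) by (simp add: wrap_def vec_eq_iff)
    then have "Arg2pi (cis ((U *v x) $ i)) = Arg2pi (cis ((U *v y) $ i))"
      by simp
    moreover have "Arg2pi (cis u) = u" if "0 \<le> u" "u < 2 * pi" for u
      using Arg2pi_unique[of 1 u "cis u"] that by (simp add: cis_conv_exp)
    ultimately show ?thesis
      using xy(1,2) by (simp add: cell_def)
  qed
  then have "U *v x = U *v y" by (simp add: vec_eq_iff)
  then show "x = y"
    by (metis matrix_inv_vector(1) invertible_U)
qed

lemma continuous_wrap: "continuous_on A wrap"
proof -
  have "continuous_on A (\<lambda>x. (U *v x) $ i)" for i
    by (intro continuous_on_component linear_continuous_on matrix_vector_mul_bounded_linear)
  then show ?thesis
    unfolding wrap_def[abs_def] by (intro continuous_on_vec_lambda continuous_on_cis)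
qed

lemma trig_poly_cos_sin:
  "(\<lambda>x. complex_of_real (cos ((U *v x) $ i))) \<in> trig_poly"
  "(\<lambda>x. complex_of_real (sin ((U *v x) $ i))) \<in> trig_poly"
proof -
  have e: "char (axis i 1) x = cis (- ((U *v x) $ i))" "char (- axis i 1) x = cis ((U *v x) $ i)" for x
    by (simp_all add: char_def cis_conv_exp inner_axis')
  have "(\<lambda>x. (1/2) * char (axis i 1) x + (1/2) * char (- axis i 1) x) \<in> trig_poly"
    by (intro trig_poly.intros int_lattice_closed)
  moreover have "(1/2) * char (axis i 1) x + (1/2) * char (- axis i 1) x = complex_of_real (cos ((U *v x) $ i))" for x
    unfolding e by (simp add: complex_eq_iff)
  ultimately show "(\<lambda>x. complex_of_real (cos ((U *v x) $ i))) \<in> trig_poly" by simp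
  have "(\<lambda>x. (\<i>/2) * char (axis i 1) x + (-\<i>/2) * char (- axis i 1) x) \<in> trig_poly"
    by (intro trig_poly.intros int_lattice_closed)
  moreover have "(\<i>/2) * char (axis i 1) x + (-\<i>/2) * char (- axis i 1) x = complex_of_real (sin ((U *v x) $ i))" for x
    unfolding e by (simp add: complex_eq_iff)
  ultimately show "(\<lambda>x. complex_of_real (sin ((U *v x) $ i))) \<in> trig_poly" by simp
qed

text \<open>
  Stone--Weierstrass on the torus, for the ring of those real continuous functions whose composition with
  \<^const>\<open>wrap\<close> is a trigonometric polynomial. It separates points, since it contains the real and
  imaginary part of every coordinate.
\<close>

lemma trig_poly_uniform_approx:
  assumes f: "continuous_on torus f" and e: "e > 0"
  obtains t where "t \<in> trig_poly" "\<And>x. cmod (complex_of_real (f (wrap x)) - t x) < e"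
proof -
  define R where "R = {f. continuous_on torus f \<and> (\<lambda>x. complex_of_real (f (wrap x))) \<in> trig_poly}"
  interpret function_ring_on R torus
  proof
    show "compact torus" by (rule compact_torus)
    show "(\<lambda>x. f x + g x) \<in> R" "(\<lambda>x. f x * g x) \<in> R" if "f \<in> R" "g \<in> R" for f g
      using that by (auto simp: R_def intro: continuous_intros trig_poly.add trig_poly_mult)
    show "(\<lambda>_. c) \<in> R" for c
      by (simp add: R_def trig_poly_const)
    show "continuous_on torus f" if "f \<in> R" for f
      using that by (simp add: R_def)
    fix x y assume xy: "x \<in> torus" "y \<in> torus" "x \<noteq> y"
    then obtain i where i: "x $ i \<noteq> y $ i"
      by (auto simp: vec_eq_iff)
    have re: "(\<lambda>z. Re (z $ i)) \<in> R"
      using trig_poly_cos_sin(1)[of i]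
      by (auto simp: R_def wrap_def intro!: continuous_on_Re continuous_on_component continuous_on_id)
    have im: "(\<lambda>z. Im (z $ i)) \<in> R"
      using trig_poly_cos_sin(2)[of i]
      by (auto simp: R_def wrap_def intro!: continuous_on_Im continuous_on_component continuous_on_id)
    from i consider "Re (x $ i) \<noteq> Re (y $ i)" | "Im (x $ i) \<noteq> Im (y $ i)"
      by (auto simp: complex_eq_iff)
    then show "\<exists>f\<in>R. f x \<noteq> f y"
      by cases (rule bexI[OF _ re], assumption, rule bexI[OF _ im], assumption)
  qed
  obtain F where F: "F \<in> UNIV \<rightarrow> R" "LIM n sequentially. F n :> uniformly_on torus f"
    using Stone_Weierstrass[OF f] by blast
  then have "\<forall>\<^sub>F n in sequentially. \<forall>z\<in>torus. dist (F n z) (f z) < e"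
    using e by (simp add: uniform_limit_iff)
  then obtain n where n: "\<And>z. z \<in> torus \<Longrightarrow> dist (F n z) (f z) < e"
    by (auto simp: eventually_sequentially)
  show thesis
  proof
    show "(\<lambda>x. complex_of_real (F n (wrap x))) \<in> trig_poly"
      using F(1) by (auto simp: R_def Pi_def)
    fix x
    have "cmod (complex_of_real (f (wrap x)) - complex_of_real (F n (wrap x))) = dist (F n (wrap x)) (f (wrap x))"
      by (simp only: of_real_diff[symmetric] norm_of_real dist_norm real_norm_def abs_minus_commute)
    then show "cmod (complex_of_real (f (wrap x)) - complex_of_real (F n (wrap x))) < e"
      using n by simp
  qed
qed

abbreviation "cell_measure \<equiv> lebesgue_on cell"

lemma measurable_trig_poly [measurable]:
  assumes "t \<in> trig_poly"
  shows "t \<in> borel_measurable cell_measure"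
  using assms
proof induction
  case (char k c)
  show ?case by measurable
next
  case (add s t)
  then show ?case by (intro borel_measurable_add)
qed

text \<open>
  The mean-square distance is a nonnegative extended integral, so that approximability makes sense for
  every function and no integrability has to be carried along.
\<close>

definition trig_approximable :: "(real ^ 'd \<Rightarrow> complex) \<Rightarrow> bool" where
  "trig_approximable P \<longleftrightarrow> (\<forall>e>0. \<exists>t\<in>trig_poly.
     (\<integral>\<^sup>+x. ennreal ((cmod (P x - t x))\<^sup>2) \<partial>cell_measure) < ennreal e)"

lemma nn_integral_square_triangle:
  assumes [measurable]: "P \<in> borel_measurable M" "Q \<in> borel_measurable M"
  shows "(\<integral>\<^sup>+x. ennreal ((cmod (P x + Q x))\<^sup>2) \<partial>M)
    \<le> 2 * (\<integral>\<^sup>+x. ennreal ((cmod (P x))\<^sup>2) \<partial>M) + 2 * (\<integral>\<^sup>+x. ennreal ((cmod (Q x))\<^sup>2) \<partial>M)"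
proof -
  have "(\<integral>\<^sup>+x. ennreal ((cmod (P x + Q x))\<^sup>2) \<partial>M)
      \<le> (\<integral>\<^sup>+x. 2 * ennreal ((cmod (P x))\<^sup>2) + 2 * ennreal ((cmod (Q x))\<^sup>2) \<partial>M)"
  proof (rule nn_integral_mono)
    fix x
    have "ennreal ((cmod (P x + Q x))\<^sup>2) \<le> ennreal (2 * (cmod (P x))\<^sup>2 + 2 * (cmod (Q x))\<^sup>2)"
      by (rule ennreal_leI[OF cmod_add_squared_le])
    also have "\<dots> = 2 * ennreal ((cmod (P x))\<^sup>2) + 2 * ennreal ((cmod (Q x))\<^sup>2)"
      by (simp add: ennreal_plus ennreal_mult)
    finally show "ennreal ((cmod (P x + Q x))\<^sup>2) \<le> 2 * ennreal ((cmod (P x))\<^sup>2) + 2 * ennreal ((cmod (Q x))\<^sup>2)" .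
  qed
  also have "\<dots> = 2 * (\<integral>\<^sup>+x. ennreal ((cmod (P x))\<^sup>2) \<partial>M) + 2 * (\<integral>\<^sup>+x. ennreal ((cmod (Q x))\<^sup>2) \<partial>M)"
    by (subst nn_integral_add; simp add: nn_integral_cmult)
  finally show ?thesis .
qed

lemma ennreal_two_quarters:
  fixes a b :: ennreal
  assumes "a < ennreal (e / 4)" "b < ennreal (e / 4)" "e > 0"
  shows "2 * a + 2 * b < ennreal e"
proof -
  obtain a' where a: "a = ennreal a'" "0 \<le> a'"
    using assms(1) by (cases a) auto
  obtain b' where b: "b = ennreal b'" "0 \<le> b'"
    using assms(2) by (cases b) auto
  have "a' < e / 4" "b' < e / 4"
    using assms a b by (simp_all add: ennreal_less_iff)
  moreover have "2 * a + 2 * b = ennreal (2 * a' + 2 * b')"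
    using a b by (simp add: ennreal_plus ennreal_mult)
  ultimately show ?thesis
    using a(2) b(2) by (simp only:) (subst ennreal_less_iff; simp)
qed

lemma trig_approximable_closed:
  assumes P [measurable]: "P \<in> borel_measurable cell_measure"
    and ex: "\<And>e. e > 0 \<Longrightarrow> \<exists>Q. Q \<in> borel_measurable cell_measure \<and> trig_approximable Q \<and>
      (\<integral>\<^sup>+x. ennreal ((cmod (P x - Q x))\<^sup>2) \<partial>cell_measure) < ennreal e"
  shows "trig_approximable P"
  unfolding trig_approximable_def
proof (intro allI impI)
  fix e :: real assume e: "e > 0"
  then have e4: "e / 4 > 0" by simp
  from ex[OF e4] obtain Q where Q [measurable]: "Q \<in> borel_measurable cell_measure"
    and Q': "trig_approximable Q" "(\<integral>\<^sup>+x. ennreal ((cmod (P x - Q x))\<^sup>2) \<partial>cell_measure) < ennreal (e / 4)"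
    by blast
  obtain t where t: "t \<in> trig_poly" "(\<integral>\<^sup>+x. ennreal ((cmod (Q x - t x))\<^sup>2) \<partial>cell_measure) < ennreal (e / 4)"
    using Q'(1) e4 unfolding trig_approximable_def by blast
  note [measurable] = measurable_trig_poly[OF t(1)]
  have "(\<integral>\<^sup>+x. ennreal ((cmod (P x - t x))\<^sup>2) \<partial>cell_measure)
      = (\<integral>\<^sup>+x. ennreal ((cmod ((P x - Q x) + (Q x - t x)))\<^sup>2) \<partial>cell_measure)"
    by simp
  also have "\<dots> \<le> 2 * (\<integral>\<^sup>+x. ennreal ((cmod (P x - Q x))\<^sup>2) \<partial>cell_measure) + 2 * (\<integral>\<^sup>+x. ennreal ((cmod (Q x - t x))\<^sup>2) \<partial>cell_measure)"
    by (rule nn_integral_square_triangle) measurable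
  also have "\<dots> < ennreal e"
    by (rule ennreal_two_quarters[OF Q'(2) t(2) e])
  finally show "\<exists>t\<in>trig_poly. (\<integral>\<^sup>+x. ennreal ((cmod (P x - t x))\<^sup>2) \<partial>cell_measure) < ennreal e"
    using t(1) by blast
qed

lemma trig_approximable_limit:
  assumes [measurable]: "P \<in> borel_measurable cell_measure" "\<And>n. Q n \<in> borel_measurable cell_measure"
    and Q: "\<And>n. trig_approximable (Q n)"
    and lim: "\<And>x. x \<in> cell \<Longrightarrow> (\<lambda>n. Q n x) \<longlonglongrightarrow> P x"
    and bound: "\<And>n x. x \<in> cell \<Longrightarrow> (cmod (P x - Q n x))\<^sup>2 \<le> w x"
    and [measurable]: "w \<in> borel_measurable cell_measure"
    and w: "(\<integral>\<^sup>+x. ennreal (w x) \<partial>cell_measure) < \<infinity>"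
  shows "trig_approximable P"
proof (rule trig_approximable_closed)
  fix e :: real assume e: "e > 0"
  have "(\<lambda>n. \<integral>\<^sup>+x. ennreal ((cmod (P x - Q n x))\<^sup>2) \<partial>cell_measure) \<longlonglongrightarrow> (\<integral>\<^sup>+x. 0 \<partial>cell_measure)"
  proof (rule nn_integral_dominated_convergence[where w = "\<lambda>x. ennreal (w x)"])
    show "AE x in cell_measure. (\<lambda>n. ennreal ((cmod (P x - Q n x))\<^sup>2)) \<longlonglongrightarrow> 0"
    proof (rule AE_I2)
      fix x assume "x \<in> space cell_measure"
      then have "(\<lambda>n. (cmod (P x - Q n x))\<^sup>2) \<longlonglongrightarrow> (cmod (P x - P x))\<^sup>2"
        by (intro tendsto_power tendsto_norm tendsto_diff tendsto_const lim) simp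
      then have "(\<lambda>n. ennreal ((cmod (P x - Q n x))\<^sup>2)) \<longlonglongrightarrow> ennreal ((cmod (P x - P x))\<^sup>2)"
        by (rule tendsto_ennrealI)
      then show "(\<lambda>n. ennreal ((cmod (P x - Q n x))\<^sup>2)) \<longlonglongrightarrow> 0" by simp
    qed
    show "AE x in cell_measure. ennreal ((cmod (P x - Q n x))\<^sup>2) \<le> ennreal (w x)" for n
      using bound by (intro AE_I2 ennreal_leI) simp
  qed (use w in auto)
  then have "\<forall>\<^sub>F n in sequentially. (\<integral>\<^sup>+x. ennreal ((cmod (P x - Q n x))\<^sup>2) \<partial>cell_measure) < ennreal e"
    using e by (intro order_tendstoD(2)) auto
  then obtain n where "(\<integral>\<^sup>+x. ennreal ((cmod (P x - Q n x))\<^sup>2) \<partial>cell_measure) < ennreal e"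
    by (auto simp: eventually_sequentially)
  then show "\<exists>Q. Q \<in> borel_measurable cell_measure \<and> trig_approximable Q \<and>
      (\<integral>\<^sup>+x. ennreal ((cmod (P x - Q x))\<^sup>2) \<partial>cell_measure) < ennreal e"
    using Q assms(2) by blast
qed (rule assms)

lemma trig_approximable_add:
  assumes [measurable]: "P \<in> borel_measurable cell_measure" "Q \<in> borel_measurable cell_measure"
    and "trig_approximable P" "trig_approximable Q"
  shows "trig_approximable (\<lambda>x. P x + Q x)"
  unfolding trig_approximable_def
proof (intro allI impI)
  fix e :: real assume e: "e > 0"
  then have e4: "e / 4 > 0" by simp
  obtain s where s: "s \<in> trig_poly" "(\<integral>\<^sup>+x. ennreal ((cmod (P x - s x))\<^sup>2) \<partial>cell_measure) < ennreal (e / 4)"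
    using assms(3) e4 unfolding trig_approximable_def by blast
  obtain t where t: "t \<in> trig_poly" "(\<integral>\<^sup>+x. ennreal ((cmod (Q x - t x))\<^sup>2) \<partial>cell_measure) < ennreal (e / 4)"
    using assms(4) e4 unfolding trig_approximable_def by blast
  note [measurable] = measurable_trig_poly[OF s(1)] measurable_trig_poly[OF t(1)]
  have "(\<integral>\<^sup>+x. ennreal ((cmod (P x + Q x - (s x + t x)))\<^sup>2) \<partial>cell_measure)
      = (\<integral>\<^sup>+x. ennreal ((cmod ((P x - s x) + (Q x - t x)))\<^sup>2) \<partial>cell_measure)"
    by (simp add: algebra_simps)
  also have "\<dots> \<le> 2 * (\<integral>\<^sup>+x. ennreal ((cmod (P x - s x))\<^sup>2) \<partial>cell_measure) + 2 * (\<integral>\<^sup>+x. ennreal ((cmod (Q x - t x))\<^sup>2) \<partial>cell_measure)"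
    by (rule nn_integral_square_triangle) measurable
  also have "\<dots> < ennreal e"
    by (rule ennreal_two_quarters[OF s(2) t(2) e])
  finally show "\<exists>t\<in>trig_poly. (\<integral>\<^sup>+x. ennreal ((cmod (P x + Q x - t x))\<^sup>2) \<partial>cell_measure) < ennreal e"
    by (rule bexI[OF _ trig_poly.add[OF s(1) t(1)]])
qed

lemma trig_approximable_cmult:
  assumes [measurable]: "P \<in> borel_measurable cell_measure" and "trig_approximable P"
  shows "trig_approximable (\<lambda>x. c * P x)"
  unfolding trig_approximable_def
proof (intro allI impI)
  fix e :: real assume e: "e > 0"
  \<comment> \<open>The summand 1 keeps d positive when c = 0.\<close>
  define d where "d = (cmod c)\<^sup>2 + 1"
  have d: "d > 0" by (simp add: d_def add_nonneg_pos)
  obtain t where t: "t \<in> trig_poly" "(\<integral>\<^sup>+x. ennreal ((cmod (P x - t x))\<^sup>2) \<partial>cell_measure) < ennreal (e / d)"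
    using assms(2) e d unfolding trig_approximable_def by (meson divide_pos_pos)
  note [measurable] = measurable_trig_poly[OF t(1)]
  have "(\<integral>\<^sup>+x. ennreal ((cmod (c * P x - c * t x))\<^sup>2) \<partial>cell_measure)
      \<le> (\<integral>\<^sup>+x. ennreal d * ennreal ((cmod (P x - t x))\<^sup>2) \<partial>cell_measure)"
  proof (rule nn_integral_mono)
    fix x
    have "(cmod (c * P x - c * t x))\<^sup>2 \<le> d * (cmod (P x - t x))\<^sup>2"
      unfolding right_diff_distrib[symmetric] norm_mult power_mult_distrib d_def
      by (intro mult_right_mono) auto
    then show "ennreal ((cmod (c * P x - c * t x))\<^sup>2) \<le> ennreal d * ennreal ((cmod (P x - t x))\<^sup>2)"
      using d by (simp add: ennreal_mult[symmetric] ennreal_leI)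
  qed
  also have "\<dots> = ennreal d * (\<integral>\<^sup>+x. ennreal ((cmod (P x - t x))\<^sup>2) \<partial>cell_measure)"
    by (rule nn_integral_cmult) measurable
  also have "\<dots> < ennreal d * ennreal (e / d)"
    using t(2) d by (intro ennreal_mult_strict_left_mono) auto
  also have "\<dots> = ennreal e"
    using d e by (simp add: ennreal_mult[symmetric])
  finally show "\<exists>t\<in>trig_poly. (\<integral>\<^sup>+x. ennreal ((cmod (c * P x - t x))\<^sup>2) \<partial>cell_measure) < ennreal e"
    by (rule bexI[OF _ trig_poly_cmult[OF t(1)]])
qed

lemma trig_approximable_zero: "trig_approximable (\<lambda>x. 0)"
  unfolding trig_approximable_def using trig_poly_const[of 0] by (auto intro!: bexI[of _ "\<lambda>x. 0"])

lemma trig_approximable_sum: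
  assumes "\<And>i. i \<in> I \<Longrightarrow> P i \<in> borel_measurable cell_measure" "\<And>i. i \<in> I \<Longrightarrow> trig_approximable (P i)"
  shows "trig_approximable (\<lambda>x. \<Sum>i\<in>I. P i x)"
  using assms
  by (induction I rule: infinite_finite_induct)
    (auto intro!: trig_approximable_zero trig_approximable_add borel_measurable_sum)

lemma emeasure_cell_finite: "emeasure cell_measure cell < \<infinity>"
  using finite_measure.emeasure_finite[OF finite_measure_cell, of cell] by (simp add: less_top)

lemma trig_approximable_continuous:
  assumes f: "continuous_on torus f"
  shows "trig_approximable (\<lambda>x. complex_of_real (f (wrap x)))"
  unfolding trig_approximable_def
proof (intro allI impI)
  fix e :: real assume e: "e > 0"
  \<comment> \<open>A uniform error d on the cell gives the squared mean error at most d^2 vol = e/2.\<close>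
  define d where "d = sqrt (e / (2 * vol))"
  have d: "d > 0" "d\<^sup>2 * vol < e"
    using e vol_pos by (simp_all add: d_def)
  obtain t where t: "t \<in> trig_poly" "\<And>x. cmod (complex_of_real (f (wrap x)) - t x) < d"
    using trig_poly_uniform_approx[OF f d(1)] by blast
  have "(\<integral>\<^sup>+x. ennreal ((cmod (complex_of_real (f (wrap x)) - t x))\<^sup>2) \<partial>cell_measure) \<le> (\<integral>\<^sup>+x. ennreal (d\<^sup>2) \<partial>cell_measure)"
    using t(2) by (intro nn_integral_mono ennreal_leI power_mono) (auto intro: less_imp_le)
  also have "\<dots> = ennreal (d\<^sup>2) * ennreal vol"
    using cell_lmeasurable by (simp add: emeasure_restrict_space emeasure_eq_measure2)
  also have "\<dots> < ennreal e"
    using d vol_pos by (simp add: ennreal_mult[symmetric] ennreal_less_iff)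
  finally show "\<exists>t\<in>trig_poly. (\<integral>\<^sup>+x. ennreal ((cmod (complex_of_real (f (wrap x)) - t x))\<^sup>2) \<partial>cell_measure) < ennreal e"
    using t(1) by blast
qed

text \<open>
  Since \<^const>\<open>wrap\<close> is injective on the cell, \<open>T\<close> is there the preimage of a closed subset \<open>W\<close> of the torus,
  and its indicator is the limit of the continuous functions \<open>max 0 (1 - n dist (wrap x, W))\<close>.
\<close>

lemma trig_approximable_compact:
  assumes T: "compact T" "T \<subseteq> cell"
  shows "trig_approximable (indicator T)"
proof (cases "T = {}")
  case True
  then have "indicator T = (\<lambda>x. 0 :: complex)" by (simp add: fun_eq_iff)
  then show ?thesis using trig_approximable_zero by simp
next
  case False
  define W where "W = wrap ` T"
  have W: "closed W" "W \<noteq> {}"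
    using T(1) False compact_continuous_image[OF continuous_wrap] by (auto simp: W_def compact_imp_closed)
  define f where "f n z = max 0 (1 - real n * infdist z W)" for n z
  have cf: "continuous_on A (f n)" for n A
    unfolding f_def[abs_def] by (intro continuous_intros)
  have mem: "wrap x \<in> W \<longleftrightarrow> x \<in> T" if "x \<in> cell" for x
    using inj_on_image_mem_iff[OF inj_on_wrap_cell that T(2)] by (simp add: W_def)
  have f01: "0 \<le> f n z" "f n z \<le> 1" for n z
    by (auto simp: f_def infdist_nonneg)
  have T_sets: "T \<in> sets lebesgue"
    using T(1) by (simp add: compact_imp_closed borel_closed)
  have [measurable]: "(\<lambda>x. complex_of_real (f n (wrap x))) \<in> borel_measurable cell_measure" for n
  proof -
    have "continuous_on UNIV (\<lambda>x. complex_of_real (f n (wrap x)))"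
      by (intro continuous_on_of_real continuous_on_compose2[OF cf continuous_wrap]) auto
    then have "(\<lambda>x. complex_of_real (f n (wrap x))) \<in> borel_measurable borel"
      by (rule borel_measurable_continuous_onI)
    then show ?thesis
      by (intro measurable_restrict_space1) (simp add: measurable_completion)
  qed
  show ?thesis
  proof (rule trig_approximable_limit[where Q = "\<lambda>n x. complex_of_real (f n (wrap x))" and w = "\<lambda>x. 1"])
    show "indicator T \<in> borel_measurable cell_measure"
      by (intro measurable_restrict_space1 borel_measurable_indicator T_sets)
    show "trig_approximable (\<lambda>x. complex_of_real (f n (wrap x)))" for n
      by (rule trig_approximable_continuous[OF cf])
    show "(\<lambda>n. complex_of_real (f n (wrap x))) \<longlonglongrightarrow> indicator T x" if x: "x \<in> cell" for x
    proof (cases "x \<in> T")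
      case True
      then have "f n (wrap x) = 1" for n
        using mem[OF x] by (simp add: f_def)
      then show ?thesis using True by simp
    next
      case False
      then have "infdist (wrap x) W > 0"
        using W mem[OF x] in_closed_iff_infdist_zero[OF W] infdist_nonneg[of "wrap x" W] by auto
      then obtain m :: nat where "1 < real m * infdist (wrap x) W"
        using reals_Archimedean3 by blast
      then have "f n (wrap x) = 0" if "n \<ge> m" for n
      proof -
        have "real m * infdist (wrap x) W \<le> real n * infdist (wrap x) W"
          using that by (intro mult_right_mono infdist_nonneg) simp
        then show ?thesis
          using \<open>1 < real m * infdist (wrap x) W\<close> by (simp add: f_def)
      qed
      then have "\<forall>\<^sub>F n in sequentially. complex_of_real (f n (wrap x)) = 0"
        by (auto simp: eventually_sequentially)
      then show ?thesis
        using False by (simp add: tendsto_eventually)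
    qed
    show "(cmod (indicator T x - complex_of_real (f n (wrap x))))\<^sup>2 \<le> 1" for n x
    proof -
      have "indicator T x - complex_of_real (f n (wrap x)) = complex_of_real (indicat_real T x - f n (wrap x))"
        by (simp add: indicator_def)
      moreover have "\<bar>indicat_real T x - f n (wrap x)\<bar> \<le> 1"
        using f01[of n "wrap x"] by (simp add: indicator_def abs_le_iff)
      ultimately show ?thesis
        by (simp only: norm_of_real) (simp add: abs_square_le_1)
    qed
    show "(\<integral>\<^sup>+x. ennreal 1 \<partial>cell_measure) < \<infinity>"
      using emeasure_cell_finite by simp
  qed auto
qed

text \<open>
  Inner regularity: a measurable subset of the cell contains a closed, hence compact, set that exhausts it
  up to measure \<open>e\<close>.
\<close>

lemma trig_approximable_indicator:
  assumes A: "A \<in> sets lebesgue" "A \<subseteq> cell"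
  shows "trig_approximable (indicator A)"
proof (rule trig_approximable_closed)
  show mA: "indicator A \<in> borel_measurable cell_measure"
    by (intro measurable_restrict_space1 borel_measurable_indicator A)
  fix e :: real assume e: "e > 0"
  obtain T where T: "closed T" "T \<subseteq> A" "A - T \<in> lmeasurable" "emeasure lebesgue (A - T) < ennreal e"
    using sets_lebesgue_inner_closed[OF A(1) e] by blast
  have "compact T"
    using T A(2) bounded_cell by (meson bounded_subset compact_eq_bounded_closed order_trans)
  then have "trig_approximable (indicator T)"
    using T A by (intro trig_approximable_compact) auto
  moreover have "indicator T \<in> borel_measurable cell_measure"
    using T(1) by (intro measurable_restrict_space1 borel_measurable_indicator) (simp add: borel_closed)
  moreover have "(\<integral>\<^sup>+x. ennreal ((cmod (indicator A x - indicator T x))\<^sup>2) \<partial>cell_measure) < ennreal e"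
  proof -
    have "(\<integral>\<^sup>+x. ennreal ((cmod (indicator A x - indicator T x))\<^sup>2) \<partial>cell_measure)
        = (\<integral>\<^sup>+x. ennreal ((cmod (indicator A x - indicator T x))\<^sup>2) * indicator cell x \<partial>lebesgue)"
      by (intro nn_integral_restrict_space) simp
    also have "\<dots> = (\<integral>\<^sup>+x. indicator (A - T) x \<partial>lebesgue)"
      using T(2) A(2) by (intro nn_integral_cong) (auto simp: indicator_def)
    also have "\<dots> = emeasure lebesgue (A - T)"
      using T(3) by (intro nn_integral_indicator) auto
    finally show ?thesis using T(4) by simp
  qed
  ultimately show "\<exists>Q. Q \<in> borel_measurable cell_measure \<and> trig_approximable Q \<and>
      (\<integral>\<^sup>+x. ennreal ((cmod (indicator A x - Q x))\<^sup>2) \<partial>cell_measure) < ennreal e"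
    by blast
qed

lemma trig_approximable_simple:
  assumes s: "simple_function cell_measure s"
  shows "trig_approximable s"
proof -
  have A: "s -` {y} \<inter> cell \<in> sets lebesgue" for y
  proof -
    have "s -` {y} \<inter> space cell_measure \<in> sets cell_measure"
      using s by (rule simple_functionD)
    then show ?thesis
      using sets_restrict_space_iff[of cell lebesgue] by simp
  qed
  have I: "(indicator (s -` {y} \<inter> cell) :: real ^ 'd \<Rightarrow> complex) \<in> borel_measurable cell_measure" for y
    by (rule measurable_restrict_space1[OF borel_measurable_indicator[OF A]])
  have "trig_approximable (indicator (s -` {y} \<inter> cell))" for y
    by (rule trig_approximable_indicator[OF A]) simp
  then have "trig_approximable (\<lambda>x. \<Sum>y\<in>s ` cell. y * indicator (s -` {y} \<inter> cell) x)"
    by (rule trig_approximable_sum[OF borel_measurable_times[OF borel_measurable_const I] trig_approximable_cmult[OF I]])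
  moreover have "(\<Sum>y\<in>s ` cell. y * indicator (s -` {y} \<inter> cell) x) = s x" if "x \<in> cell" for x
  proof -
    have "s x = (\<Sum>y\<in>s ` cell. indicator (s -` {y} \<inter> cell) x *\<^sub>R y)"
      using simple_function_indicator_representation_banach[OF s, of x] that
      by (simp only: space_lebesgue_on)
    also have "\<dots> = (\<Sum>y\<in>s ` cell. y * indicator (s -` {y} \<inter> cell) x)"
      by (intro sum.cong refl) (simp add: indicator_def)
    finally show ?thesis by (rule sym)
  qed
  then have "(\<integral>\<^sup>+x. ennreal ((cmod ((\<Sum>y\<in>s ` cell. y * indicator (s -` {y} \<inter> cell) x) - t x))\<^sup>2) \<partial>cell_measure)
      = (\<integral>\<^sup>+x. ennreal ((cmod (s x - t x))\<^sup>2) \<partial>cell_measure)" for t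
    by (intro nn_integral_cong) simp
  ultimately show ?thesis
    unfolding trig_approximable_def by simp
qed

text \<open>
  Simple functions are dense among the square-integrable functions on the cell, and they are combinations
  of the indicators treated above.
\<close>

lemma trig_approximable_square_integrable:
  assumes P: "square_integrable cell_measure P"
  shows "trig_approximable P"
proof -
  have mP [measurable]: "P \<in> borel_measurable cell_measure"
    using P by (simp add: square_integrable_def)
  obtain s where s: "\<And>i. simple_function cell_measure (s i)"
      "\<And>x. x \<in> space cell_measure \<Longrightarrow> (\<lambda>i. s i x) \<longlonglongrightarrow> P x"
      "\<And>i x. x \<in> space cell_measure \<Longrightarrow> dist (s i x) 0 \<le> 2 * dist (P x) 0"
    using borel_measurable_implies_sequence_metric[OF mP, of 0] by blast
  show ?thesis
  \<comment> \<open>The approximating simple functions are at most twice as large as P, and 9 is the square of 1 + 2.\<close>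
  proof (rule trig_approximable_limit[where Q = s and w = "\<lambda>x. 9 * (cmod (P x))\<^sup>2"])
    show "s n \<in> borel_measurable cell_measure" for n
      using s(1) by (rule borel_measurable_simple_function)
    show "(cmod (P x - s n x))\<^sup>2 \<le> 9 * (cmod (P x))\<^sup>2" if "x \<in> cell" for n x
    proof -
      have "cmod (P x - s n x) \<le> 3 * cmod (P x)"
        using norm_triangle_ineq4[of "P x" "s n x"] s(3)[of x n] that by simp
      then have "(cmod (P x - s n x))\<^sup>2 \<le> (3 * cmod (P x))\<^sup>2"
        by (intro power_mono) auto
      then show ?thesis by (simp add: power_mult_distrib)
    qed
    have "(\<integral>\<^sup>+x. ennreal (9 * (cmod (P x))\<^sup>2) \<partial>cell_measure) = 9 * (\<integral>\<^sup>+x. ennreal ((cmod (P x))\<^sup>2) \<partial>cell_measure)"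
      by (simp add: ennreal_mult nn_integral_cmult)
    also have "\<dots> < \<infinity>"
      unfolding square_integrable_nn_integral[OF P] by (simp add: ennreal_mult_less_top)
    finally show "(\<integral>\<^sup>+x. ennreal (9 * (cmod (P x))\<^sup>2) \<partial>cell_measure) < \<infinity>" .
  qed (use s trig_approximable_simple in auto)
qed

end

section \<open>Parseval identity\<close>

context dilated_torus
begin

definition coeff :: "(real ^ 'd \<Rightarrow> complex) \<Rightarrow> real ^ 'd \<Rightarrow> complex" where
  "coeff P k = (\<integral>x. P x * cnj (char k x) \<partial>cell_measure)"

lemma measurable_cnj_char [measurable]:
  "(\<lambda>x. cnj (char k x)) \<in> borel_measurable (lebesgue_on A)" "(\<lambda>x. cnj (char k x)) \<in> borel_measurable lebesgue"
  unfolding char_simps(3) by measurable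

lemma square_integrable_char: "square_integrable cell_measure (char k)"
  by (rule finite_measure.square_integrable_bounded[OF finite_measure_cell, of _ 1])
    (auto simp: char_simps(4))

lemma integrable_coeff:
  assumes "square_integrable cell_measure P"
  shows "integrable cell_measure (\<lambda>x. P x * cnj (char k x))"
  by (rule integrable_mult_square_integrable[OF assms square_integrable_cnj[OF square_integrable_char]])

lemma coeff_char:
  assumes "k \<in> int_lattice" "l \<in> int_lattice"
  shows "coeff (char l) k = (if k = l then complex_of_real vol else 0)"
proof -
  have "coeff (char l) k = (\<integral>x. char (l - k) x \<partial>cell_measure)"
    by (simp add: coeff_def char_simps(6))
  also have "\<dots> = (if k = l then complex_of_real vol else 0)"
  proof (cases "k = l")
    case True
    have "(\<integral>x. char 0 x \<partial>cell_measure) = complex_of_real vol"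
      unfolding char_simps(1) using cell_lmeasurable by (simp add: measure_restrict_space scaleR_conv_of_real)
    then show ?thesis using True by simp
  next
    case False
    then show ?thesis using integral_char[of "l - k"] assms by simp
  qed
  finally show ?thesis .
qed

lemma integral_sum_coeff:
  assumes P: "square_integrable cell_measure P"
  shows "(\<integral>x. P x * cnj (\<Sum>k\<in>K. a k * char k x) \<partial>cell_measure) = (\<Sum>k\<in>K. cnj (a k) * coeff P k)"
proof -
  have "(\<integral>x. P x * cnj (\<Sum>k\<in>K. a k * char k x) \<partial>cell_measure)
      = (\<integral>x. (\<Sum>k\<in>K. cnj (a k) * (P x * cnj (char k x))) \<partial>cell_measure)"
    by (simp add: sum_distrib_left mult.left_commute)
  also have "\<dots> = (\<Sum>k\<in>K. \<integral>x. cnj (a k) * (P x * cnj (char k x)) \<partial>cell_measure)"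
    by (intro Bochner_Integration.integral_sum Bochner_Integration.integrable_mult_right integrable_coeff P)
  also have "\<dots> = (\<Sum>k\<in>K. cnj (a k) * coeff P k)"
    unfolding coeff_def by simp
  finally show ?thesis .
qed

lemma square_integrable_trig_sum:
  "square_integrable cell_measure (\<lambda>x. \<Sum>k\<in>K. a k * char k x)"
  by (intro square_integrable_sum square_integrable_cmult square_integrable_char)

lemma coeff_trig_sum:
  assumes "finite K" "K \<subseteq> int_lattice" "l \<in> K"
  shows "coeff (\<lambda>x. \<Sum>k\<in>K. a k * char k x) l = a l * vol"
proof -
  have "coeff (\<lambda>x. \<Sum>k\<in>K. a k * char k x) l = (\<integral>x. (\<Sum>k\<in>K. a k * (char k x * cnj (char l x))) \<partial>cell_measure)"
    unfolding coeff_def by (simp add: sum_distrib_right mult.assoc)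
  also have "\<dots> = (\<Sum>k\<in>K. \<integral>x. a k * (char k x * cnj (char l x)) \<partial>cell_measure)"
    by (intro Bochner_Integration.integral_sum Bochner_Integration.integrable_mult_right integrable_coeff
        square_integrable_char)
  also have "\<dots> = (\<Sum>k\<in>K. a k * coeff (char k) l)"
    unfolding coeff_def by simp
  also have "\<dots> = (\<Sum>k\<in>K. if k = l then a k * vol else 0)"
    using assms by (intro sum.cong refl) (auto simp: coeff_char subset_eq)
  also have "\<dots> = a l * vol"
    using assms by simp
  finally show ?thesis .
qed

text \<open>
  Completing the square in each coefficient. The choice \<open>a k = coeff P k / vol\<close> removes the last sum and
  yields Bessel's inequality; dropping the last sum yields a lower bound for the coefficients from any
  approximation of \<open>P\<close>.
\<close>

lemma distance_to_trig_sum: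
  assumes P: "square_integrable cell_measure P" and K: "finite K" "K \<subseteq> int_lattice"
  shows "(\<integral>x. (cmod (P x - (\<Sum>k\<in>K. a k * char k x)))\<^sup>2 \<partial>cell_measure)
    = (\<integral>x. (cmod (P x))\<^sup>2 \<partial>cell_measure) - (\<Sum>k\<in>K. (cmod (coeff P k))\<^sup>2) / vol
      + vol * (\<Sum>k\<in>K. (cmod (a k - coeff P k / vol))\<^sup>2)"
proof -
  define t where "t x = (\<Sum>k\<in>K. a k * char k x)" for x
  have t: "square_integrable cell_measure t"
    unfolding t_def[abs_def] by (rule square_integrable_trig_sum)
  note int = integrable_mult_square_integrable[OF _ square_integrable_cnj]
  have Pt: "(\<integral>x. P x * cnj (t x) \<partial>cell_measure) = (\<Sum>k\<in>K. cnj (a k) * coeff P k)"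
    unfolding t_def by (rule integral_sum_coeff[OF P])
  have "(\<integral>x. t x * cnj (t x) \<partial>cell_measure) = (\<Sum>k\<in>K. cnj (a k) * coeff t k)"
    using integral_sum_coeff[OF t, of a K] by (simp add: t_def)
  also have "\<dots> = (\<Sum>k\<in>K. cnj (a k) * (a k * vol))"
    unfolding t_def[abs_def] using K by (intro sum.cong refl) (simp add: coeff_trig_sum)
  finally have tt: "(\<integral>x. t x * cnj (t x) \<partial>cell_measure) = (\<Sum>k\<in>K. cnj (a k) * (a k * vol))" .
  have tP: "(\<integral>x. t x * cnj (P x) \<partial>cell_measure) = (\<Sum>k\<in>K. a k * cnj (coeff P k))"
  proof -
    have "(\<integral>x. t x * cnj (P x) \<partial>cell_measure) = (\<integral>x. cnj (P x * cnj (t x)) \<partial>cell_measure)"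
      by (simp add: mult.commute)
    also have "\<dots> = cnj (\<integral>x. P x * cnj (t x) \<partial>cell_measure)"
      by (simp only: Bochner_Integration.integral_cnj)
    finally show ?thesis unfolding Pt by simp
  qed
  have "complex_of_real (\<integral>x. (cmod (P x - t x))\<^sup>2 \<partial>cell_measure) = (\<integral>x. complex_of_real ((cmod (P x - t x))\<^sup>2) \<partial>cell_measure)"
    by (simp only: integral_complex_of_real)
  also have "\<dots> = (\<integral>x. P x * cnj (P x) - P x * cnj (t x) - t x * cnj (P x) + t x * cnj (t x) \<partial>cell_measure)"
  proof (rule Bochner_Integration.integral_cong[OF refl])
    fix x
    show "complex_of_real ((cmod (P x - t x))\<^sup>2) = P x * cnj (P x) - P x * cnj (t x) - t x * cnj (P x) + t x * cnj (t x)"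
      unfolding complex_norm_square complex_cnj_diff by (simp only: left_diff_distrib right_diff_distrib) simp
  qed
  also have "\<dots> = (\<integral>x. P x * cnj (P x) \<partial>cell_measure) - (\<Sum>k\<in>K. cnj (a k) * coeff P k)
      - (\<Sum>k\<in>K. a k * cnj (coeff P k)) + (\<Sum>k\<in>K. cnj (a k) * (a k * vol))"
    unfolding Pt[symmetric] tP[symmetric] tt[symmetric]
    by (rule has_bochner_integral_integral_eq)
      (intro has_bochner_integral_add has_bochner_integral_diff has_bochner_integral_integrable int P t)
  also have "(\<integral>x. P x * cnj (P x) \<partial>cell_measure) = complex_of_real (\<integral>x. (cmod (P x))\<^sup>2 \<partial>cell_measure)"
    unfolding complex_norm_square[symmetric] by (simp only: integral_complex_of_real)
  also have "complex_of_real (\<integral>x. (cmod (P x))\<^sup>2 \<partial>cell_measure) - (\<Sum>k\<in>K. cnj (a k) * coeff P k)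
      - (\<Sum>k\<in>K. a k * cnj (coeff P k)) + (\<Sum>k\<in>K. cnj (a k) * (a k * vol))
    = complex_of_real (\<integral>x. (cmod (P x))\<^sup>2 \<partial>cell_measure)
      + (\<Sum>k\<in>K. cnj (a k) * (a k * vol) - cnj (a k) * coeff P k - a k * cnj (coeff P k))"
    by (simp add: sum.distrib sum_subtractf)
  also have "(\<Sum>k\<in>K. cnj (a k) * (a k * vol) - cnj (a k) * coeff P k - a k * cnj (coeff P k))
    = (\<Sum>k\<in>K. complex_of_real (vol * (cmod (a k - coeff P k / vol))\<^sup>2 - (cmod (coeff P k))\<^sup>2 / vol))"
  proof (rule sum.cong[OF refl])
    fix k
    have v: "complex_of_real vol \<noteq> 0" using vol_pos by simp
    show "cnj (a k) * (a k * vol) - cnj (a k) * coeff P k - a k * cnj (coeff P k)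
      = complex_of_real (vol * (cmod (a k - coeff P k / vol))\<^sup>2 - (cmod (coeff P k))\<^sup>2 / vol)"
      unfolding of_real_diff of_real_mult of_real_divide complex_norm_square using v by (simp add: field_simps)
  qed
  also have "complex_of_real (\<integral>x. (cmod (P x))\<^sup>2 \<partial>cell_measure)
      + (\<Sum>k\<in>K. complex_of_real (vol * (cmod (a k - coeff P k / vol))\<^sup>2 - (cmod (coeff P k))\<^sup>2 / vol))
    = complex_of_real ((\<integral>x. (cmod (P x))\<^sup>2 \<partial>cell_measure) - (\<Sum>k\<in>K. (cmod (coeff P k))\<^sup>2) / vol
      + vol * (\<Sum>k\<in>K. (cmod (a k - coeff P k / vol))\<^sup>2))"
    unfolding of_real_sum[symmetric] of_real_add[symmetric] of_real_eq_iff
    by (simp add: sum_subtractf sum_distrib_left sum_divide_distrib)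
  finally show ?thesis
    unfolding of_real_eq_iff t_def .
qed

text \<open>
  Bessel's inequality bounds the finite partial sums from above. Density of trigonometric polynomials
  provides a finite set \<open>K\<close> for which the sum is at least the limit minus \<open>e\<close>, and larger sets only
  increase it.
\<close>

proposition parseval_norm:
  assumes P: "square_integrable cell_measure P"
  shows "((\<lambda>k. (cmod (coeff P k))\<^sup>2) has_sum (vol * (\<integral>x. (cmod (P x))\<^sup>2 \<partial>cell_measure))) int_lattice"
proof -
  define I where "I = (\<integral>x. (cmod (P x))\<^sup>2 \<partial>cell_measure)"
  have upper: "(\<Sum>k\<in>K. (cmod (coeff P k))\<^sup>2) \<le> vol * I" if K: "finite K" "K \<subseteq> int_lattice" for K
  proof -
    have "0 \<le> (\<integral>x. (cmod (P x - (\<Sum>k\<in>K. (coeff P k / vol) * char k x)))\<^sup>2 \<partial>cell_measure)"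
      by simp
    also have "\<dots> = I - (\<Sum>k\<in>K. (cmod (coeff P k))\<^sup>2) / vol"
      unfolding distance_to_trig_sum[OF P K] by (simp add: I_def)
    finally show ?thesis
      using vol_pos by (simp add: field_simps)
  qed
  have "((\<lambda>K. \<Sum>k\<in>K. (cmod (coeff P k))\<^sup>2) \<longlongrightarrow> vol * I) (finite_subsets_at_top int_lattice)"
  proof (rule tendstoI)
    fix e :: real assume e: "e > 0"
    then have "e / vol > 0" using vol_pos by simp
    then obtain t where t: "t \<in> trig_poly" "(\<integral>\<^sup>+x. ennreal ((cmod (P x - t x))\<^sup>2) \<partial>cell_measure) < ennreal (e / vol)"
      using trig_approximable_square_integrable[OF P] unfolding trig_approximable_def by blast
    obtain K a where K: "finite K" "K \<subseteq> int_lattice" "t = (\<lambda>x. \<Sum>k\<in>K. a k * char k x)"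
      by (rule trig_poly_representation[OF t(1)])
    have "square_integrable cell_measure (\<lambda>x. P x + (-1) * t x)"
      unfolding K(3) by (intro square_integrable_add P square_integrable_cmult square_integrable_trig_sum)
    then have "(\<integral>x. (cmod (P x - t x))\<^sup>2 \<partial>cell_measure) < e / vol"
      using t(2) square_integrable_nn_integral[of cell_measure "\<lambda>x. P x + (-1) * t x"] \<open>e / vol > 0\<close>
      by (simp add: ennreal_less_iff)
    then have "I - (\<Sum>k\<in>K. (cmod (coeff P k))\<^sup>2) / vol + vol * (\<Sum>k\<in>K. (cmod (a k - coeff P k / vol))\<^sup>2) < e / vol"
      unfolding K(3) distance_to_trig_sum[OF P K(1,2)] I_def .
    moreover have "vol * (\<Sum>k\<in>K. (cmod (a k - coeff P k / vol))\<^sup>2) \<ge> 0"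
      using vol_pos by (intro mult_nonneg_nonneg sum_nonneg) auto
    ultimately have "I < (e + (\<Sum>k\<in>K. (cmod (coeff P k))\<^sup>2)) / vol"
      unfolding add_divide_distrib by linarith
    then have lower: "vol * I - e < (\<Sum>k\<in>K. (cmod (coeff P k))\<^sup>2)"
      using vol_pos by (simp add: pos_less_divide_eq mult.commute)
    show "\<forall>\<^sub>F L in finite_subsets_at_top int_lattice. dist (\<Sum>k\<in>L. (cmod (coeff P k))\<^sup>2) (vol * I) < e"
      unfolding eventually_finite_subsets_at_top
    proof (intro exI[of _ K] conjI allI impI)
      fix L assume L: "finite L \<and> K \<subseteq> L \<and> L \<subseteq> int_lattice"
      then have "(\<Sum>k\<in>K. (cmod (coeff P k))\<^sup>2) \<le> (\<Sum>k\<in>L. (cmod (coeff P k))\<^sup>2)"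
        by (intro sum_mono2) auto
      then show "dist (\<Sum>k\<in>L. (cmod (coeff P k))\<^sup>2) (vol * I) < e"
        using lower upper[of L] L by (simp add: dist_real_def)
    qed (use K in auto)
  qed
  then show ?thesis
    by (simp add: has_sum_def I_def)
qed

lemma coeff_linear:
  assumes "square_integrable cell_measure P" "square_integrable cell_measure Q"
  shows "coeff (\<lambda>x. P x + c * Q x) k = coeff P k + c * coeff Q k"
proof -
  have "coeff (\<lambda>x. P x + c * Q x) k = (\<integral>x. P x * cnj (char k x) + c * (Q x * cnj (char k x)) \<partial>cell_measure)"
    by (simp add: coeff_def algebra_simps)
  also have "\<dots> = coeff P k + c * coeff Q k"
    unfolding coeff_def using integrable_coeff[OF assms(1)] integrable_coeff[OF assms(2)] by simp
  finally show ?thesis .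
qed

lemma polarization:
  "z * cnj w = (1/4) * (complex_of_real ((cmod (z + 1 * w))\<^sup>2) + (-1) * complex_of_real ((cmod (z + (-1) * w))\<^sup>2)
     + \<i> * (complex_of_real ((cmod (z + \<i> * w))\<^sup>2) + (-1) * complex_of_real ((cmod (z + (-\<i>) * w))\<^sup>2)))"
proof -
  have "z * cnj w = (1/4) * ((z + 1 * w) * (cnj z + 1 * cnj w) - (z + (-1) * w) * (cnj z + (-1) * cnj w)
     + \<i> * ((z + \<i> * w) * (cnj z + (-\<i>) * cnj w) - (z + (-\<i>) * w) * (cnj z + \<i> * cnj w)))"
    by (simp add: field_simps)
  then show ?thesis
    unfolding complex_norm_square complex_cnj_add complex_cnj_mult by simp
qed

text \<open>
  Polarization reduces the inner product to the norms of \<open>P + c Q\<close> for the fourth roots of unity \<open>c\<close>.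
\<close>

proposition parseval:
  assumes P: "square_integrable cell_measure P" and Q: "square_integrable cell_measure Q"
  shows "((\<lambda>k. coeff P k * cnj (coeff Q k)) has_sum (vol * (\<integral>x. P x * cnj (Q x) \<partial>cell_measure))) int_lattice"
proof -
  define n where "n c = (\<integral>x. (cmod (P x + c * Q x))\<^sup>2 \<partial>cell_measure)" for c
  have si: "square_integrable cell_measure (\<lambda>x. P x + c * Q x)" for c
    by (intro square_integrable_add P square_integrable_cmult Q)
  have "((\<lambda>k. (cmod (coeff P k + c * coeff Q k))\<^sup>2) has_sum (vol * n c)) int_lattice" for c
    using parseval_norm[OF si[of c]] unfolding coeff_linear[OF P Q] n_def .
  then have hs: "((\<lambda>k. complex_of_real ((cmod (coeff P k + c * coeff Q k))\<^sup>2)) has_sum complex_of_real (vol * n c)) int_lattice" for c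
    by (rule has_sum_of_real)
  have ni: "integrable cell_measure (\<lambda>x. complex_of_real ((cmod (P x + c * Q x))\<^sup>2))" for c
    using si[of c] by (intro integrable_of_real) (simp add: square_integrable_def)
  have nc: "(\<integral>x. complex_of_real ((cmod (P x + c * Q x))\<^sup>2) \<partial>cell_measure) = complex_of_real (n c)" for c
    unfolding n_def by (simp only: integral_complex_of_real)
  have eq: "(\<integral>x. P x * cnj (Q x) \<partial>cell_measure) = (1/4) * (complex_of_real (n 1) + (-1) * complex_of_real (n (-1))
      + \<i> * (complex_of_real (n \<i>) + (-1) * complex_of_real (n (-\<i>))))"
  proof -
    have "(\<integral>x. P x * cnj (Q x) \<partial>cell_measure) = (\<integral>x. (1/4) * (complex_of_real ((cmod (P x + 1 * Q x))\<^sup>2) + (-1) * complex_of_real ((cmod (P x + (-1) * Q x))\<^sup>2)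
       + \<i> * (complex_of_real ((cmod (P x + \<i> * Q x))\<^sup>2) + (-1) * complex_of_real ((cmod (P x + (-\<i>) * Q x))\<^sup>2))) \<partial>cell_measure)"
      by (rule Bochner_Integration.integral_cong[OF refl polarization])
    also have "\<dots> = (1/4) * (complex_of_real (n 1) + (-1) * complex_of_real (n (-1))
      + \<i> * (complex_of_real (n \<i>) + (-1) * complex_of_real (n (-\<i>))))"
      unfolding nc[symmetric] integral_mult_right_zero
      by (simp only: Bochner_Integration.integral_add Bochner_Integration.integral_diff integral_mult_right_zero
          Bochner_Integration.integrable_add Bochner_Integration.integrable_mult_right ni)
    finally show ?thesis .
  qed
  have "((\<lambda>k. (1/4) * (complex_of_real ((cmod (coeff P k + 1 * coeff Q k))\<^sup>2) + (-1) * complex_of_real ((cmod (coeff P k + (-1) * coeff Q k))\<^sup>2)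
       + \<i> * (complex_of_real ((cmod (coeff P k + \<i> * coeff Q k))\<^sup>2) + (-1) * complex_of_real ((cmod (coeff P k + (-\<i>) * coeff Q k))\<^sup>2)))) has_sum
     (1/4) * (complex_of_real (vol * n 1) + (-1) * complex_of_real (vol * n (-1)) + \<i> * (complex_of_real (vol * n \<i>) + (-1) * complex_of_real (vol * n (-\<i>))))) int_lattice"
    by (intro has_sum_cmult_right has_sum_add hs)
  moreover have "(1/4) * (complex_of_real (vol * n 1) + (-1) * complex_of_real (vol * n (-1)) + \<i> * (complex_of_real (vol * n \<i>) + (-1) * complex_of_real (vol * n (-\<i>))))
      = vol * (\<integral>x. P x * cnj (Q x) \<partial>cell_measure)"
    unfolding eq of_real_mult by (simp add: algebra_simps)
  ultimately show ?thesis
    unfolding polarization[symmetric] by (simp only:)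
qed

section \<open>Periodization\<close>

text \<open>
  On a bounded set the bounded factor is square integrable.
\<close>

lemma integrable_mult_bounded_support:
  assumes "square_integrable lebesgue F" "bounded {x. F x \<noteq> 0}" "G \<in> borel_measurable lebesgue" "\<And>x. cmod (G x) \<le> B"
  shows "integrable lebesgue (\<lambda>x. F x * G x)"
proof -
  obtain R where R: "{x. F x \<noteq> 0} \<subseteq> cball 0 R"
    using assms(2) by (meson bounded_subset_ballD ball_subset_cball order_trans)
  have "square_integrable lebesgue (\<lambda>x. indicator (cball 0 R) x * G x)"
    unfolding square_integrable_def
  proof
    show m: "(\<lambda>x. indicator (cball 0 R) x * G x) \<in> borel_measurable lebesgue"
      using assms(3) by (intro borel_measurable_times borel_measurable_indicator) auto
    have "integrable lebesgue (\<lambda>x. B\<^sup>2 * indicator (cball 0 R) x)"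
      by (intro integrable_mult_right integrable_real_indicator) (simp_all add: emeasure_bounded_finite[unfolded infinity_ennreal_def])
    then show "integrable lebesgue (\<lambda>x. (cmod (indicator (cball 0 R) x * G x))\<^sup>2)"
    proof (rule Bochner_Integration.integrable_bound)
      show "(\<lambda>x. (cmod (indicator (cball 0 R) x * G x))\<^sup>2) \<in> borel_measurable lebesgue"
        using m by measurable
      have "(cmod (indicator (cball 0 R) x * G x))\<^sup>2 \<le> B\<^sup>2 * indicator (cball 0 R) x" for x
        using power_mono[OF assms(4)[of x], of 2] by (simp add: indicator_def)
      then show "AE x in lebesgue. norm ((cmod (indicator (cball 0 R) x * G x))\<^sup>2) \<le> norm (B\<^sup>2 * indicator (cball 0 R) x)"
        by (intro AE_I2) (simp add: indicator_def)
    qed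
  qed
  from integrable_mult_square_integrable[OF assms(1) this]
  have "integrable lebesgue (\<lambda>x. F x * (indicator (cball 0 R) x * G x))" .
  moreover have "F x * (indicator (cball 0 R) x * G x) = F x * G x" for x
    using R by (auto simp: indicator_def)
  ultimately show ?thesis by simp
qed

lemma square_integrable_restrict:
  assumes "square_integrable lebesgue F"
  shows "square_integrable cell_measure F"
  using assms integrable_mult_indicator[OF sets_cell, of "\<lambda>x. (cmod (F x))\<^sup>2"]
  by (auto simp: square_integrable_def integrable_restrict_space intro: measurable_restrict_space1)

text \<open>
  The integrals on the left are the Fourier coefficients of the periodizations of \<open>F\<close> and \<open>G\<close>, which on the
  cell are finite sums of translates. Parseval's identity turns the series into the inner product over
  the cell of two periodizations, and unfolding one of them gives correlations of \<open>F\<close> with the translates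
  of \<open>G\<close> by periods.
\<close>

proposition lattice_parseval:
  assumes F: "square_integrable lebesgue F" "bounded {x. F x \<noteq> 0}"
    and G: "square_integrable lebesgue G" "bounded {x. G x \<noteq> 0}"
    and D: "finite D" "D \<subseteq> int_lattice" "\<And>x n. n \<in> int_lattice \<Longrightarrow> F x \<noteq> 0 \<Longrightarrow> G (x + period n) \<noteq> 0 \<Longrightarrow> n \<in> D"
  shows "((\<lambda>k. (\<integral>x. F x * cnj (char k x) \<partial>lebesgue) * cnj (\<integral>x. G x * cnj (char k x) \<partial>lebesgue)) has_sum
     (vol * (\<Sum>p\<in>D. \<integral>x. F x * cnj (G (x + period p)) \<partial>lebesgue))) int_lattice"
proof -
  define S where "S = tile ` ({x. F x \<noteq> 0} \<union> {x. G x \<noteq> 0})"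
  have S: "finite S" "S \<subseteq> int_lattice" "\<And>x. F x \<noteq> 0 \<Longrightarrow> tile x \<in> S" "\<And>x. G x \<noteq> 0 \<Longrightarrow> tile x \<in> S"
    unfolding S_def using F(2) G(2) by (auto intro!: finite_imageI finite_tiles simp: image_Un)
  define per where "per H x = (\<Sum>n\<in>S. H (x + period n))" for H :: "real ^ 'd \<Rightarrow> complex" and x
  have per: "square_integrable cell_measure (per H)" if "square_integrable lebesgue H" for H
    unfolding per_def[abs_def]
    by (intro square_integrable_sum square_integrable_restrict square_integrable_translation that)
  have coeff_per: "coeff (per H) k = (\<integral>x. H x * cnj (char k x) \<partial>lebesgue)"
    if H: "square_integrable lebesgue H" "bounded {x. H x \<noteq> 0}" "\<And>x. H x \<noteq> 0 \<Longrightarrow> tile x \<in> S" and k: "k \<in> int_lattice" for H k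
  proof -
    have int: "integrable lebesgue (\<lambda>x. H x * cnj (char k x))"
      by (rule integrable_mult_bounded_support[OF H(1,2), of _ 1]) (auto simp: char_simps(4))
    have "(\<integral>x. H x * cnj (char k x) \<partial>lebesgue) = (\<Sum>n\<in>S. \<integral>x. H (x + period n) * cnj (char k (x + period n)) \<partial>cell_measure)"
      using H(3) by (intro integral_unfold[OF int S(1,2)]) auto
    also have "\<dots> = (\<Sum>n\<in>S. \<integral>x. H (x + period n) * cnj (char k x) \<partial>cell_measure)"
      using S(2) k by (intro sum.cong refl) (auto simp: char_shift subset_eq)
    also have "\<dots> = (\<integral>x. (\<Sum>n\<in>S. H (x + period n) * cnj (char k x)) \<partial>cell_measure)"
      by (intro Bochner_Integration.integral_sum[symmetric] integrable_coeff square_integrable_restrict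
          square_integrable_translation H(1))
    also have "\<dots> = coeff (per H) k"
      by (simp add: coeff_def per_def sum_distrib_right)
    finally show ?thesis by (rule sym)
  qed
  note GF = integrable_mult_square_integrable[OF _ square_integrable_cnj]
  have "(\<integral>x. per F x * cnj (per G x) \<partial>cell_measure) = (\<Sum>p\<in>D. \<integral>x. F x * cnj (G (x + period p)) \<partial>lebesgue)"
  proof -
    have "(\<Sum>p\<in>D. \<integral>x. F x * cnj (G (x + period p)) \<partial>lebesgue)
        = (\<Sum>p\<in>D. \<Sum>m\<in>S. \<integral>x. F (x + period m) * cnj (G (x + period m + period p)) \<partial>cell_measure)"
      using S(3) by (intro sum.cong refl integral_unfold GF square_integrable_translation F(1) G(1) S(1,2)) auto
    also have "\<dots> = (\<integral>x. (\<Sum>p\<in>D. \<Sum>m\<in>S. F (x + period m) * cnj (G (x + (period m + period p)))) \<partial>cell_measure)"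
      unfolding add.assoc
      by (rule has_bochner_integral_integral_eq[symmetric])
        (intro has_bochner_integral_sum has_bochner_integral_integrable GF square_integrable_restrict
          square_integrable_translation F(1) G(1))
    also have "\<dots> = (\<integral>x. per F x * cnj (per G x) \<partial>cell_measure)"
    proof (rule Bochner_Integration.integral_cong[OF refl])
      fix x assume "x \<in> space cell_measure"
      then have x: "x \<in> cell" by simp
      have inner: "(\<Sum>p\<in>D. F (x + period m) * cnj (G (x + (period m + period p)))) = (\<Sum>n\<in>S. F (x + period m) * cnj (G (x + period n)))"
        if m: "m \<in> S" for m
      proof (cases "F (x + period m) = 0")
        case False
        have mL: "m \<in> int_lattice" using m S(2) by blast
        define h where "h n = F (x + period m) * cnj (G (x + period n))" for n
        have hS: "n \<in> S" if "n \<in> int_lattice" "h n \<noteq> 0" for n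
        proof -
          have "G (x + period n) \<noteq> 0" using that(2) by (simp add: h_def)
          then have "tile (x + period n) \<in> S" by (rule S(4))
          moreover have "tile (x + period n) = n" using tile_eq_iff[OF that(1), of x] x by blast
          ultimately show ?thesis by simp
        qed
        have hD: "n \<in> (+) m ` D" if "n \<in> int_lattice" "h n \<noteq> 0" for n
        proof -
          have "period m + period (n - m) = period n"
            unfolding period_simps(2)[symmetric] by simp
          then have "G (x + period m + period (n - m)) \<noteq> 0"
            using that(2) by (simp add: h_def add.assoc)
          then have "n - m \<in> D"
            using D(3)[of "n - m" "x + period m"] that(1) mL False by simp
          then show ?thesis by (intro image_eqI[of _ _ "n - m"]) simp_all
        qed
        \<comment> \<open>Both index sets contain every lattice vector at which h is nonzero.\<close>
        have "(\<Sum>p\<in>D. h (m + p)) = (\<Sum>n\<in>(+) m ` D. h n)"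
          by (simp add: sum.reindex)
        also have "\<dots> = (\<Sum>n\<in>S. h n)"
        proof (rule sum.mono_neutral_cong)
          have "(+) m ` D \<subseteq> int_lattice"
            using D(2) mL by auto
          then show "h n = 0" if "n \<in> (+) m ` D - S" for n
            using hS that by blast
          show "h n = 0" if "n \<in> S - (+) m ` D" for n
            using hD that S(2) by blast
        qed (use D(1) S(1) in simp_all)
        finally show ?thesis
          by (simp add: h_def)
      qed simp
      show "(\<Sum>p\<in>D. \<Sum>m\<in>S. F (x + period m) * cnj (G (x + (period m + period p)))) = per F x * cnj (per G x)"
        by (subst sum.swap) (simp add: inner per_def sum_product)
    qed
    finally show ?thesis by (rule sym)
  qed
  moreover have "((\<lambda>k. (\<integral>x. F x * cnj (char k x) \<partial>lebesgue) * cnj (\<integral>x. G x * cnj (char k x) \<partial>lebesgue)) has_sum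
     (vol * (\<integral>x. per F x * cnj (per G x) \<partial>cell_measure))) int_lattice"
    using parseval[OF per[OF F(1)] per[OF G(1)]] coeff_per[OF F S(3)] coeff_per[OF G S(4)]
    by (simp cong: has_sum_cong)
  ultimately show ?thesis
    by (simp only:)
qed

end

section \<open>Locally square-integrable functions\<close>

text \<open>
  The multipliers that turn locally square-integrable functions into square-integrable ones: test
  functions, their translates and products, and indicators of bounded sets.
\<close>

definition bounded_with_bounded_support :: "('a::euclidean_space \<Rightarrow> complex) \<Rightarrow> bool" where
  "bounded_with_bounded_support u \<longleftrightarrow>
     u \<in> borel_measurable lebesgue \<and> bounded (range u) \<and> bounded {x. u x \<noteq> 0}"

lemma bounded_with_bounded_support_mult:
  assumes "bounded_with_bounded_support u" "bounded_with_bounded_support v"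
  shows "bounded_with_bounded_support (\<lambda>x. u x * v x)"
proof -
  obtain A where A: "\<And>x. cmod (u x) \<le> A"
    using assms(1) by (auto simp: bounded_with_bounded_support_def bounded_iff)
  obtain B where B: "\<And>x. cmod (v x) \<le> B"
    using assms(2) by (auto simp: bounded_with_bounded_support_def bounded_iff)
  have "cmod (u x * v x) \<le> A * B" for x
    unfolding norm_mult by (intro mult_mono A B norm_ge_zero order_trans[OF norm_ge_zero A])
  then have "bounded (range (\<lambda>x. u x * v x))"
    by (auto simp: bounded_iff)
  moreover have "bounded {x. u x * v x \<noteq> 0}"
    using assms(1) unfolding bounded_with_bounded_support_def by (auto elim: bounded_subset)
  ultimately show ?thesis
    using assms unfolding bounded_with_bounded_support_def by auto
qed

lemma bounded_with_bounded_support_cnj: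
  assumes "bounded_with_bounded_support u"
  shows "bounded_with_bounded_support (\<lambda>x. cnj (u x))"
proof -
  have "(\<lambda>x. cnj (u x)) \<in> borel_measurable lebesgue"
    using assms measurable_compose[OF _ borel_measurable_continuous_onI[OF continuous_on_cnj[OF continuous_on_id]]]
    by (auto simp: bounded_with_bounded_support_def)
  then show ?thesis
    using assms by (auto simp: bounded_with_bounded_support_def bounded_iff)
qed

lemma bounded_with_bounded_support_translation:
  assumes "bounded_with_bounded_support u"
  shows "bounded_with_bounded_support (\<lambda>x. u (x + t))"
proof -
  have "{x. u (x + t) \<noteq> 0} \<subseteq> (+) (- t) ` {x. u x \<noteq> 0}"
  proof
    fix x assume "x \<in> {x. u (x + t) \<noteq> 0}"
    then show "x \<in> (+) (- t) ` {x. u x \<noteq> 0}"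
      by (intro image_eqI[of _ _ "x + t"]) simp_all
  qed
  moreover have "bounded ((+) (- t) ` {x. u x \<noteq> 0})"
    using assms by (intro bounded_translation) (simp add: bounded_with_bounded_support_def)
  ultimately have "bounded {x. u (x + t) \<noteq> 0}"
    by (rule bounded_subset[rotated])
  moreover have "bounded (range (\<lambda>x. u (x + t)))"
    using assms by (auto simp: bounded_with_bounded_support_def bounded_iff)
  ultimately show ?thesis
    using assms by (simp add: bounded_with_bounded_support_def measurable_lebesgue_translation)
qed

lemma bounded_with_bounded_support_indicator:
  assumes "S \<in> sets lebesgue" "bounded S"
  shows "bounded_with_bounded_support (indicator S)"
proof -
  have "{x. (indicator S x :: complex) \<noteq> 0} = S" by (auto simp: indicator_def)
  moreover have "bounded (range (indicator S :: 'a \<Rightarrow> complex))"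
    by (auto simp: bounded_iff indicator_def intro!: exI[of _ 1])
  ultimately show ?thesis
    using assms by (simp add: bounded_with_bounded_support_def)
qed

lemma test_function_bounded_with_bounded_support:
  assumes "f \<in> test_functions"
  shows "bounded_with_bounded_support f"
proof -
  have c: "continuous_on UNIV f" and b: "bounded {x. f x \<noteq> 0}"
    using assms by (rule test_functionsD)+
  have "compact (f ` closure {x. f x \<noteq> 0})"
    using b c by (intro compact_continuous_image) (auto intro: continuous_on_subset)
  then have "bounded (insert 0 (f ` closure {x. f x \<noteq> 0}))"
    using compact_imp_bounded by simp
  moreover have "range f \<subseteq> insert 0 (f ` closure {x. f x \<noteq> 0})"
    using closure_subset by fastforce
  ultimately have "bounded (range f)"
    by (rule bounded_subset)
  moreover have "f \<in> borel_measurable lebesgue"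
    using borel_measurable_continuous_onI[OF c] by (simp add: measurable_completion)
  ultimately show ?thesis
    using b by (simp add: bounded_with_bounded_support_def)
qed

text \<open>
  The substitution \<open>y = U x\<close> maps compact sets to compact sets and changes integrals by the factor
  \<open>1 / \<bar>det U\<bar>\<close>.
\<close>

lemma L2_loc_dilate:
  fixes U :: "real ^ 'd ^ 'd" and \<phi> :: "real ^ 'd \<Rightarrow> complex"
  assumes U: "invertible U" and \<phi>: "\<phi> \<in> L2_loc"
  shows "(\<lambda>x. \<phi> (U *v x)) \<in> L2_loc"
  unfolding L2_loc_def mem_Collect_eq
proof (intro conjI allI impI)
  have m: "\<phi> \<in> borel_measurable lebesgue"
    using \<phi> by (simp add: L2_loc_def)
  show mU: "(\<lambda>x. \<phi> (U *v x)) \<in> borel_measurable lebesgue"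
    using measurable_comp[OF measurable_matrix_vector_mult_lebesgue[OF U] m] by (simp add: o_def)
  fix K :: "(real ^ 'd) set" assume K: "compact K"
  define L where "L = (*v) U ` K"
  have L: "compact L"
    unfolding L_def by (intro compact_continuous_image K linear_continuous_on matrix_vector_mul_bounded_linear)
  have "inj ((*v) U)"
    by (rule inj_on_inverseI) (rule matrix_inv_vector(1)[OF U])
  then have "U *v x \<in> L \<longleftrightarrow> x \<in> K" for x
    unfolding L_def by (rule inj_image_mem_iff)
  then have ind: "indicator K x = (indicator L (U *v x) :: real)" for x
    by (simp add: indicator_def)
  have int: "integrable lebesgue (\<lambda>y. indicator L y *\<^sub>R (cmod (\<phi> y))\<^sup>2)"
    using \<phi> L by (simp add: L2_loc_def set_integrable_def)
  have "(\<integral>\<^sup>+x. ennreal (norm (indicator K x *\<^sub>R (cmod (\<phi> (U *v x)))\<^sup>2)) \<partial>lebesgue)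
      = (\<integral>\<^sup>+x. ennreal (norm (indicator L (U *v x) *\<^sub>R (cmod (\<phi> (U *v x)))\<^sup>2)) \<partial>lebesgue)"
    by (simp only: ind)
  also have "\<dots> = (\<integral>\<^sup>+y. ennreal (norm (indicator L y *\<^sub>R (cmod (\<phi> y))\<^sup>2)) \<partial>lebesgue) / ennreal \<bar>det U\<bar>"
    using int by (intro nn_integral_matrix[OF U, of "\<lambda>y. ennreal (norm (indicator L y *\<^sub>R (cmod (\<phi> y))\<^sup>2))"]) auto
  also have "\<dots> < \<infinity>"
  proof -
    have "(\<integral>\<^sup>+y. ennreal (norm (indicator L y *\<^sub>R (cmod (\<phi> y))\<^sup>2)) \<partial>lebesgue) < \<infinity>"
      using int by (simp only: integrable_iff_bounded)
    moreover have "\<bar>det U\<bar> > 0"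
      using U by (simp add: invertible_det_nz)
    ultimately show ?thesis
      by (simp add: ennreal_divide_eq_top_iff less_top[symmetric])
  qed
  finally have "(\<integral>\<^sup>+x. ennreal (norm (indicator K x *\<^sub>R (cmod (\<phi> (U *v x)))\<^sup>2)) \<partial>lebesgue) < \<infinity>" .
  moreover have "(\<lambda>x. indicator K x *\<^sub>R (cmod (\<phi> (U *v x)))\<^sup>2) \<in> borel_measurable lebesgue"
  proof -
    have "(indicator K :: real ^ 'd \<Rightarrow> real) \<in> borel_measurable lebesgue"
      using K by (intro borel_measurable_indicator) (simp add: compact_imp_closed borel_closed)
    then show ?thesis using mU by measurable
  qed
  ultimately show "set_integrable lebesgue K (\<lambda>x. (cmod (\<phi> (U *v x)))\<^sup>2)"
    unfolding set_integrable_def integrable_iff_bounded by blast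
qed

lemma square_integrable_mult_L2_loc:
  assumes u: "bounded_with_bounded_support u" and a: "a \<in> L2_loc"
  shows "square_integrable lebesgue (\<lambda>x. u x * a x)"
  unfolding square_integrable_def
proof
  have m: "u \<in> borel_measurable lebesgue" "a \<in> borel_measurable lebesgue"
    using u a by (auto simp: bounded_with_bounded_support_def L2_loc_def)
  show mm: "(\<lambda>x. u x * a x) \<in> borel_measurable lebesgue"
    using m by (rule borel_measurable_times)
  obtain B where B: "\<And>x. cmod (u x) \<le> B"
    using u by (auto simp: bounded_with_bounded_support_def bounded_iff)
  obtain R where R: "{x. u x \<noteq> 0} \<subseteq> ball 0 R"
    using u bounded_subset_ballD unfolding bounded_with_bounded_support_def by blast
  have "integrable lebesgue (\<lambda>x. B\<^sup>2 * (indicator (cball 0 R) x *\<^sub>R (cmod (a x))\<^sup>2))"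
    using a by (intro integrable_mult_right) (auto simp: L2_loc_def set_integrable_def)
  then show "integrable lebesgue (\<lambda>x. (cmod (u x * a x))\<^sup>2)"
  proof (rule Bochner_Integration.integrable_bound)
    show "(\<lambda>x. (cmod (u x * a x))\<^sup>2) \<in> borel_measurable lebesgue"
      using mm by measurable
    have "(cmod (u x * a x))\<^sup>2 \<le> B\<^sup>2 * (indicator (cball 0 R) x *\<^sub>R (cmod (a x))\<^sup>2)" for x
    proof (cases "u x = 0")
      case False
      then have "x \<in> cball 0 R" using R by auto
      then show ?thesis
        using mult_right_mono[OF power_mono[OF B[of x] norm_ge_zero, of 2], of "(cmod (a x))\<^sup>2"]
        by (simp add: norm_mult power_mult_distrib)
    qed simp
    then show "AE x in lebesgue. norm ((cmod (u x * a x))\<^sup>2) \<le> norm (B\<^sup>2 * (indicator (cball 0 R) x *\<^sub>R (cmod (a x))\<^sup>2))"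
      by (intro AE_I2) (simp add: abs_of_nonneg)
  qed
qed

section \<open>One scale\<close>

text \<open>
  A product of two square-integrable functions: \<open>u\<close> localizes the first factor, and the indicator of a ball
  containing the translated support of \<open>u\<close> localizes the second.
\<close>

lemma integrable_cross_term:
  fixes U :: "real ^ 'd ^ 'd"
  assumes U: "invertible U" and u: "bounded_with_bounded_support u"
    and \<phi>: "\<phi> \<in> L2_loc" "\<phi>' \<in> L2_loc"
  shows "integrable lebesgue (\<lambda>\<xi>. u \<xi> * (cnj (\<phi> (U *v \<xi>)) * \<phi>' (U *v (\<xi> + t))))"
proof -
  obtain R where R: "{x. u x \<noteq> 0} \<subseteq> ball 0 R"
    using u bounded_subset_ballD unfolding bounded_with_bounded_support_def by blast
  \<comment> \<open>The ball contains the translate by t of the support of u.\<close>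
  define b :: "real ^ 'd \<Rightarrow> complex" where "b = indicator (cball t R)"
  have b: "bounded_with_bounded_support b"
    unfolding b_def by (rule bounded_with_bounded_support_indicator) auto
  have 1: "square_integrable lebesgue (\<lambda>\<xi>. cnj (cnj (u \<xi>) * \<phi> (U *v \<xi>)))"
    by (intro square_integrable_cnj square_integrable_mult_L2_loc bounded_with_bounded_support_cnj L2_loc_dilate u U \<phi>)
  have 2: "square_integrable lebesgue (\<lambda>\<xi>. b (\<xi> + t) * \<phi>' (U *v (\<xi> + t)))"
    using square_integrable_translation[OF square_integrable_mult_L2_loc[OF b L2_loc_dilate[OF U \<phi>(2)]], of t] .
  have "cnj (cnj (u \<xi>) * \<phi> (U *v \<xi>)) * (b (\<xi> + t) * \<phi>' (U *v (\<xi> + t)))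
      = u \<xi> * (cnj (\<phi> (U *v \<xi>)) * \<phi>' (U *v (\<xi> + t)))" for \<xi>
  proof (cases "u \<xi> = 0")
    case False
    then have "\<xi> + t \<in> cball t R"
      using R by (auto simp: dist_norm norm_minus_commute)
    then show ?thesis by (simp add: b_def)
  qed simp
  then show ?thesis
    using integrable_mult_square_integrable[OF 1 2] by (simp only:)
qed

lemma cross_sum_dilate:
  fixes U :: "real ^ 'd ^ 'd"
  assumes "U *v k \<in> int_lattice"
  shows "cross_sum r \<phi> \<phi>' (U *v k) (U *v \<xi>) = (\<Sum>l=1..r. cnj (\<phi> l (U *v \<xi>)) * \<phi>' l (U *v (\<xi> + (2 * pi) *\<^sub>R k)))"
  using assms by (simp add: cross_sum_def matrix_vector_right_distrib matrix_vector_mult_scaleR)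

lemma integrable_cross_sum:
  fixes U :: "real ^ 'd ^ 'd"
  assumes U: "invertible U" and u: "bounded_with_bounded_support u"
    and \<phi>: "\<And>l. l \<in> {1..r} \<Longrightarrow> \<phi> l \<in> L2_loc" "\<And>l. l \<in> {1..r} \<Longrightarrow> \<phi>' l \<in> L2_loc"
  shows "integrable lebesgue (\<lambda>\<xi>. u \<xi> * cross_sum r \<phi> \<phi>' (U *v k) (U *v \<xi>))"
proof (cases "U *v k \<in> int_lattice")
  case True
  have "integrable lebesgue (\<lambda>\<xi>. \<Sum>l=1..r. u \<xi> * (cnj (\<phi> l (U *v \<xi>)) * \<phi>' l (U *v (\<xi> + (2 * pi) *\<^sub>R k))))"
    by (intro Bochner_Integration.integrable_sum integrable_cross_term U u \<phi>)
  then show ?thesis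
    by (simp add: cross_sum_dilate[OF True] sum_distrib_left)
next
  case False
  then show ?thesis by (simp add: cross_sum_def)
qed

text \<open>
  The lattice Parseval identity for \<open>F \<xi> = f \<xi> * cnj (\<phi> (U \<xi>))\<close> and \<open>G \<xi> = g \<xi> * cnj (\<phi>' (U \<xi>))\<close>.
  The normalizing factor \<open>\<bar>det U\<bar>\<close> of the dilations cancels the volume of the cell up to \<open>(2 pi)^d\<close>.
\<close>

lemma frame_series_has_sum:
  fixes U :: "real ^ 'd ^ 'd"
  assumes U: "invertible U" and f: "f \<in> test_functions" and g: "g \<in> test_functions"
    and \<phi>: "\<phi> \<in> L2_loc" "\<phi>' \<in> L2_loc"
    and K: "finite K" "\<And>k. k \<in> K \<Longrightarrow> U *v k \<in> int_lattice"
      "\<And>x k. U *v k \<in> int_lattice \<Longrightarrow> f x \<noteq> 0 \<Longrightarrow> g (x + (2 * pi) *\<^sub>R k) \<noteq> 0 \<Longrightarrow> k \<in> K"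
  shows "((\<lambda>k. pairing f (dilate_modulate U k \<phi>) * pairing (dilate_modulate U k \<phi>') g) has_sum
    (2 * complex_of_real pi) ^ CARD('d) * (\<Sum>k\<in>K. \<integral>\<xi>. f \<xi> * cnj (g (\<xi> + (2 * pi) *\<^sub>R k)) *
        (cnj (\<phi> (U *v \<xi>)) * \<phi>' (U *v (\<xi> + (2 * pi) *\<^sub>R k))) \<partial>lebesgue)) int_lattice"
proof -
  interpret dilated_torus U
    by standard (rule U)
  define F where "F x = cnj (cnj (f x) * \<phi> (U *v x))" for x
  define G where "G x = cnj (cnj (g x) * \<phi>' (U *v x))" for x
  define w where "w = complex_of_real (sqrt \<bar>det U\<bar>)"
  have F: "square_integrable lebesgue F" "bounded {x. F x \<noteq> 0}"
    unfolding F_def[abs_def]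
    by (intro square_integrable_cnj square_integrable_mult_L2_loc bounded_with_bounded_support_cnj L2_loc_dilate U \<phi>
        test_function_bounded_with_bounded_support f)
      (rule bounded_subset[OF test_functionsD(3)[OF f]], auto)
  have G: "square_integrable lebesgue G" "bounded {x. G x \<noteq> 0}"
    unfolding G_def[abs_def]
    by (intro square_integrable_cnj square_integrable_mult_L2_loc bounded_with_bounded_support_cnj L2_loc_dilate U \<phi>
        test_function_bounded_with_bounded_support g)
      (rule bounded_subset[OF test_functionsD(3)[OF g]], auto)
  have per: "period (U *v k) = (2 * pi) *\<^sub>R k" for k
    using U by (simp add: period_def)
  have dm: "dilate_modulate U k \<theta> x = w * char k x * \<theta> (U *v x)" for k \<theta> x
    by (simp add: dilate_modulate_def char_def w_def)
  have p1: "pairing f (dilate_modulate U k \<phi>) = w * (\<integral>x. F x * cnj (char k x) \<partial>lebesgue)" for k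
  proof -
    have "pairing f (dilate_modulate U k \<phi>) = (\<integral>x. w * (F x * cnj (char k x)) \<partial>lebesgue)"
      unfolding pairing_def dm F_def by (intro Bochner_Integration.integral_cong refl) (simp add: w_def algebra_simps)
    then show ?thesis by simp
  qed
  have p2: "pairing (dilate_modulate U k \<phi>') g = w * cnj (\<integral>x. G x * cnj (char k x) \<partial>lebesgue)" for k
  proof -
    have "pairing (dilate_modulate U k \<phi>') g = (\<integral>x. w * cnj (G x * cnj (char k x)) \<partial>lebesgue)"
      unfolding pairing_def dm G_def by (intro Bochner_Integration.integral_cong refl) (simp add: algebra_simps)
    then show ?thesis by (simp only: integral_mult_right_zero Bochner_Integration.integral_cnj)
  qed
  have inj: "inj_on ((*v) U) K"
    by (rule inj_on_inverseI) (rule matrix_inv_vector(1)[OF U])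
  have hs: "((\<lambda>k. (\<integral>x. F x * cnj (char k x) \<partial>lebesgue) * cnj (\<integral>x. G x * cnj (char k x) \<partial>lebesgue)) has_sum
     (vol * (\<Sum>p\<in>(*v) U ` K. \<integral>x. F x * cnj (G (x + period p)) \<partial>lebesgue))) int_lattice"
  proof (rule lattice_parseval[OF F G])
    show "n \<in> (*v) U ` K" if "n \<in> int_lattice" "F x \<noteq> 0" "G (x + period n) \<noteq> 0" for x n
    proof -
      define k where "k = matrix_inv U *v n"
      have n: "n = U *v k" using U by (simp add: k_def)
      have "k \<in> K"
        using K(3)[of k x] that unfolding n per F_def G_def by auto
      then show ?thesis unfolding n by blast
    qed
  qed (use K in auto)
  have "((\<lambda>k. (w * w) * ((\<integral>x. F x * cnj (char k x) \<partial>lebesgue) * cnj (\<integral>x. G x * cnj (char k x) \<partial>lebesgue))) has_sum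
     (w * w) * (vol * (\<Sum>p\<in>(*v) U ` K. \<integral>x. F x * cnj (G (x + period p)) \<partial>lebesgue))) int_lattice"
    by (rule has_sum_cmult_right[OF hs])
  moreover have "pairing f (dilate_modulate U k \<phi>) * pairing (dilate_modulate U k \<phi>') g =
      (w * w) * ((\<integral>x. F x * cnj (char k x) \<partial>lebesgue) * cnj (\<integral>x. G x * cnj (char k x) \<partial>lebesgue))" for k
    unfolding p1 p2 by (simp only: mult.assoc mult.left_commute)
  moreover have "(w * w) * vol = (2 * complex_of_real pi) ^ CARD('d)"
  proof -
    have "w * w = complex_of_real \<bar>det U\<bar>"
      unfolding w_def of_real_mult[symmetric] by simp
    moreover have "\<bar>det U\<bar> * vol = (2 * pi) ^ CARD('d)"
      using U by (simp add: vol invertible_det_nz)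
    ultimately show ?thesis
      by (metis of_real_mult of_real_power of_real_numeral)
  qed
  moreover have "(\<Sum>p\<in>(*v) U ` K. \<integral>x. F x * cnj (G (x + period p)) \<partial>lebesgue)
      = (\<Sum>k\<in>K. \<integral>\<xi>. f \<xi> * cnj (g (\<xi> + (2 * pi) *\<^sub>R k)) *
        (cnj (\<phi> (U *v \<xi>)) * \<phi>' (U *v (\<xi> + (2 * pi) *\<^sub>R k))) \<partial>lebesgue)"
    unfolding sum.reindex[OF inj] o_def per F_def G_def
    by (intro sum.cong refl Bochner_Integration.integral_cong) (simp add: algebra_simps)
  ultimately show ?thesis
    by (simp only: mult.assoc[symmetric])
qed

definition overlap :: "(real ^ 'd \<Rightarrow> complex) \<Rightarrow> (real ^ 'd \<Rightarrow> complex) \<Rightarrow> real ^ 'd \<Rightarrow> real ^ 'd \<Rightarrow> complex" where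
  "overlap f g k \<xi> = f \<xi> * cnj (g (\<xi> + (2 * pi) *\<^sub>R k))"

lemma bounded_with_bounded_support_overlap:
  assumes "f \<in> test_functions" "g \<in> test_functions"
  shows "bounded_with_bounded_support (overlap f g k)"
  unfolding overlap_def[abs_def]
  by (intro bounded_with_bounded_support_mult bounded_with_bounded_support_cnj bounded_with_bounded_support_translation
      test_function_bounded_with_bounded_support assms)

text \<open>
  One scale of the frame series, for all generators. The right side sums over shifts \<open>k\<close> in the common
  set \<open>K\<close> rather than over integer vectors, which makes different scales comparable: a shift with
  \<open>U k\<close> outside the integer lattice contributes zero by the convention in \<^const>\<open>cross_sum\<close>.
\<close>

proposition scale_series:
  fixes U :: "real ^ 'd ^ 'd"
  assumes U: "invertible U" and f: "f \<in> test_functions" and g: "g \<in> test_functions"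
    and \<phi>: "\<And>l. l \<in> {1..r} \<Longrightarrow> \<phi> l \<in> L2_loc" "\<And>l. l \<in> {1..r} \<Longrightarrow> \<phi>' l \<in> L2_loc"
    and K: "finite K" "\<And>x k. U *v k \<in> int_lattice \<Longrightarrow> overlap f g k x \<noteq> 0 \<Longrightarrow> k \<in> K"
  shows "(\<lambda>(l, k). cmod (pairing f (dilate_modulate U k (\<phi> l)) * pairing (dilate_modulate U k (\<phi>' l)) g))
      summable_on ({1..r} \<times> int_lattice)"
    and "(\<Sum>l=1..r. \<Sum>\<^sub>\<infinity>k\<in>int_lattice. pairing f (dilate_modulate U k (\<phi> l)) * pairing (dilate_modulate U k (\<phi>' l)) g)
      = (2 * complex_of_real pi) ^ CARD('d) *
        (\<Sum>k\<in>K. \<integral>\<xi>. overlap f g k \<xi> * cross_sum r \<phi> \<phi>' (U *v k) (U *v \<xi>) \<partial>lebesgue)"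
proof -
  define L where "L = {k \<in> K. U *v k \<in> int_lattice}"
  define t where "t l k = pairing f (dilate_modulate U k (\<phi> l)) * pairing (dilate_modulate U k (\<phi>' l)) g" for l k
  define c where "c l k = (\<integral>\<xi>. overlap f g k \<xi> * (cnj (\<phi> l (U *v \<xi>)) * \<phi>' l (U *v (\<xi> + (2 * pi) *\<^sub>R k))) \<partial>lebesgue)" for l k
  have hs: "(t l has_sum (2 * complex_of_real pi) ^ CARD('d) * (\<Sum>k\<in>L. c l k)) int_lattice" if l: "l \<in> {1..r}" for l
  proof -
    have "k \<in> L" if "U *v k \<in> int_lattice" "f x \<noteq> 0" "g (x + (2 * pi) *\<^sub>R k) \<noteq> 0" for k x
      using K(2)[of k x] that by (simp add: L_def overlap_def)
    moreover have "finite L" "\<And>k. k \<in> L \<Longrightarrow> U *v k \<in> int_lattice"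
      using K(1) by (simp_all add: L_def)
    ultimately show ?thesis
      unfolding t_def[abs_def] c_def overlap_def
      using frame_series_has_sum[OF U f g \<phi>(1)[OF l] \<phi>(2)[OF l]] by blast
  qed
  have "(\<lambda>k. cmod (t l k)) summable_on int_lattice" if "l \<in> {1..r}" for l
    by (rule summable_on_iff_abs_summable_on_complex[THEN iffD1, OF has_sum_imp_summable[OF hs[OF that]]])
  then have "(\<lambda>(l, k). cmod (t l k)) summable_on ({1..r} \<times> int_lattice)"
    by (intro summable_on_SigmaI[where g = "\<lambda>l. \<Sum>\<^sub>\<infinity>k\<in>int_lattice. cmod (t l k)"]) (auto intro: has_sum_infsum)
  then show "(\<lambda>(l, k). cmod (pairing f (dilate_modulate U k (\<phi> l)) * pairing (dilate_modulate U k (\<phi>' l)) g))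
      summable_on ({1..r} \<times> int_lattice)"
    by (simp only: t_def)
  have "(\<Sum>l=1..r. \<Sum>\<^sub>\<infinity>k\<in>int_lattice. t l k) = (\<Sum>l=1..r. (2 * complex_of_real pi) ^ CARD('d) * (\<Sum>k\<in>L. c l k))"
    using hs by (intro sum.cong refl infsumI) auto
  also have "\<dots> = (2 * complex_of_real pi) ^ CARD('d) * (\<Sum>k\<in>L. \<Sum>l=1..r. c l k)"
    unfolding sum_distrib_left[symmetric] by (subst sum.swap) (rule refl)
  also have "(\<Sum>k\<in>L. \<Sum>l=1..r. c l k) = (\<Sum>k\<in>L. \<integral>\<xi>. overlap f g k \<xi> * cross_sum r \<phi> \<phi>' (U *v k) (U *v \<xi>) \<partial>lebesgue)"
  proof (rule sum.cong[OF refl])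
    fix k assume "k \<in> L"
    then have k: "U *v k \<in> int_lattice" by (simp add: L_def)
    have "(\<Sum>l=1..r. c l k) = (\<integral>\<xi>. (\<Sum>l=1..r. overlap f g k \<xi> * (cnj (\<phi> l (U *v \<xi>)) * \<phi>' l (U *v (\<xi> + (2 * pi) *\<^sub>R k)))) \<partial>lebesgue)"
      unfolding c_def
      by (intro Bochner_Integration.integral_sum[symmetric] integrable_cross_term U \<phi> bounded_with_bounded_support_overlap f g)
    then show "(\<Sum>l=1..r. c l k) = (\<integral>\<xi>. overlap f g k \<xi> * cross_sum r \<phi> \<phi>' (U *v k) (U *v \<xi>) \<partial>lebesgue)"
      unfolding cross_sum_dilate[OF k] sum_distrib_left .
  qed
  also have "\<dots> = (\<Sum>k\<in>K. \<integral>\<xi>. overlap f g k \<xi> * cross_sum r \<phi> \<phi>' (U *v k) (U *v \<xi>) \<partial>lebesgue)"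
    using K(1) by (intro sum.mono_neutral_left) (auto simp: L_def cross_sum_def)
  finally show "(\<Sum>l=1..r. \<Sum>\<^sub>\<infinity>k\<in>int_lattice. pairing f (dilate_modulate U k (\<phi> l)) * pairing (dilate_modulate U k (\<phi>' l)) g)
      = (2 * complex_of_real pi) ^ CARD('d) *
        (\<Sum>k\<in>K. \<integral>\<xi>. overlap f g k \<xi> * cross_sum r \<phi> \<phi>' (U *v k) (U *v \<xi>) \<partial>lebesgue)"
    by (simp only: t_def)
qed

section \<open>Locally integrable functions that vanish weakly\<close>

text \<open>
  By Lebesgue's differentiation theorem, a locally integrable function is almost everywhere the limit of its
  averages over shrinking cubes.
\<close>

lemma AE_zero_if_small_cube_integrals_zero:
  fixes X :: "'a::euclidean_space \<Rightarrow> 'b::euclidean_space"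
  assumes int: "\<And>a b. X integrable_on cbox a b"
    and e: "e > 0" and zero: "\<And>x h. 0 < h \<Longrightarrow> h < e \<Longrightarrow> integral (cbox x (x + h *\<^sub>R One)) X = 0"
  shows "AE x in lebesgue. X x = 0"
proof -
  obtain Z where Z: "negligible Z"
    "\<And>x \<epsilon>. \<lbrakk>x \<notin> Z; 0 < \<epsilon>\<rbrakk> \<Longrightarrow> \<exists>d>0. \<forall>h. 0 < h \<and> h < d \<longrightarrow>
        norm (integral (cbox x (x + h *\<^sub>R One)) X /\<^sub>R h ^ DIM('a) - X x) < \<epsilon>"
    using integrable_ccontinuous_explicit[OF int] by blast
  have "X x = 0" if x: "x \<notin> Z" for x
  proof (rule ccontr)
    assume "X x \<noteq> 0"
    then obtain d where d: "d > 0" "\<And>h. 0 < h \<Longrightarrow> h < d \<Longrightarrow>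
        norm (integral (cbox x (x + h *\<^sub>R One)) X /\<^sub>R h ^ DIM('a) - X x) < norm (X x)"
      using Z(2)[OF x, of "norm (X x)"] by auto
    define h where "h = min d e / 2"
    have "0 < h" "h < d" "h < e"
      using d(1) e by (auto simp: h_def)
    then show False
      using d(2)[of h] zero[of h x] by simp
  qed
  then have "{x \<in> space lebesgue. X x \<noteq> 0} \<subseteq> Z" by auto
  moreover have "Z \<in> null_sets lebesgue"
    using Z(1) negligible_iff_null_sets by blast
  ultimately show ?thesis
    by (rule AE_I'[rotated])
qed

text \<open>
  Dominated convergence. The bump is squared because testing with two bumps \<open>f\<close> and \<open>g\<close>, one a translate of the
  other, produces its square.
\<close>

lemma bump_square_integral_tendsto:
  fixes X :: "real ^ 'd \<Rightarrow> complex"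
  assumes X: "integrable lebesgue (\<lambda>x. indicator (cbox a b) x * X x)"
  shows "(\<lambda>n. \<integral>x. (complex_of_real (box_bump (real (Suc n)) a b x) * complex_of_real (box_bump (real (Suc n)) a b x)) * X x \<partial>lebesgue)
    \<longlonglongrightarrow> integral (cbox a b) X"
proof -
  define q where "q n x = complex_of_real (box_bump (real (Suc n)) a b x) * complex_of_real (box_bump (real (Suc n)) a b x)" for n x
  have nz: "x \<in> cbox a b" if "q n x \<noteq> 0" for n x
    using that box_bump_nonzero[of "real (Suc n)" a b x] box_subset_cbox[of a b] by (auto simp: q_def)
  have q_le: "cmod (q n x) \<le> 1" for n x
    unfolding q_def norm_mult norm_of_real using box_bump_bounds[of "real (Suc n)" a b x]
    by (simp add: mult_le_one)
  have qX: "q n x * X x = q n x * (indicator (cbox a b) x * X x)" for n x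
    using nz[of n x] by (cases "q n x = 0") auto
  have lim: "(\<lambda>n. q n x) \<longlonglongrightarrow> indicator (box a b) x" for x
  proof -
    have "(\<lambda>n. complex_of_real (box_bump (real (Suc n)) a b x)) \<longlonglongrightarrow> complex_of_real (indicator (box a b) x)"
      by (rule tendsto_of_real[OF box_bump_tendsto_indicator])
    from tendsto_mult[OF this this] show ?thesis
      unfolding q_def by (cases "x \<in> box a b") simp_all
  qed
  have box_cbox: "indicator (box a b) x * (indicator (cbox a b) x * X x) = indicator (box a b) x * X x" for x
    using box_subset_cbox[of a b] by (auto simp: indicator_def)
  have mq: "q n \<in> borel_measurable lebesgue" for n
  proof -
    have "bounded_with_bounded_support (\<lambda>x. complex_of_real (box_bump (real (Suc n)) a b x))"
      by (intro test_function_bounded_with_bounded_support box_bump_test_function) simp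
    from bounded_with_bounded_support_mult[OF this this] show ?thesis
      by (simp add: bounded_with_bounded_support_def q_def[abs_def])
  qed
  have mX: "(\<lambda>x. indicator (cbox a b) x * X x) \<in> borel_measurable lebesgue"
    by (rule borel_measurable_integrable[OF X])
  have ib: "(indicator (box a b) :: real ^ 'd \<Rightarrow> complex) \<in> borel_measurable lebesgue"
    by (rule borel_measurable_indicator) simp
  have "(\<lambda>n. \<integral>x. q n x * (indicator (cbox a b) x * X x) \<partial>lebesgue)
      \<longlonglongrightarrow> (\<integral>x. indicator (box a b) x * (indicator (cbox a b) x * X x) \<partial>lebesgue)"
  proof (rule integral_dominated_convergence[where w = "\<lambda>x. cmod (indicator (cbox a b) x * X x)"])
    show "integrable lebesgue (\<lambda>x. cmod (indicator (cbox a b) x * X x))"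
      by (rule integrable_norm[OF X])
    show "AE x in lebesgue. (\<lambda>n. q n x * (indicator (cbox a b) x * X x)) \<longlonglongrightarrow> indicator (box a b) x * (indicator (cbox a b) x * X x)"
      by (intro AE_I2 tendsto_mult lim tendsto_const)
    show "AE x in lebesgue. norm (q n x * (indicator (cbox a b) x * X x)) \<le> cmod (indicator (cbox a b) x * X x)" for n
    proof (rule AE_I2)
      fix x
      show "norm (q n x * (indicator (cbox a b) x * X x)) \<le> cmod (indicator (cbox a b) x * X x)"
        unfolding norm_mult[of "q n x"] by (rule mult_left_le_one_le) (simp_all add: q_le)
    qed
  qed (intro borel_measurable_times ib mq mX)+
  also have "(\<integral>x. indicator (box a b) x * (indicator (cbox a b) x * X x) \<partial>lebesgue) = integral (cbox a b) X"
  proof -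
    have "integrable lebesgue (\<lambda>x. indicator (box a b) x *\<^sub>R (indicator (cbox a b) x * X x))"
      by (rule integrable_mult_indicator[OF _ X]) simp
    moreover have "indicator (box a b) x *\<^sub>R (indicator (cbox a b) x * X x) = indicator (box a b) x *\<^sub>R X x" for x
      using box_subset_cbox[of a b] by (auto simp: indicator_def)
    ultimately have "set_integrable lebesgue (box a b) X"
      by (simp add: set_integrable_def)
    then have "(LINT x : box a b | lebesgue. X x) = integral (box a b) X"
      by (rule set_lebesgue_integral_eq_integral)
    moreover have "(\<integral>x. indicator (box a b) x * (indicator (cbox a b) x * X x) \<partial>lebesgue) = (LINT x : box a b | lebesgue. X x)"
      unfolding box_cbox set_lebesgue_integral_def
      by (intro Bochner_Integration.integral_cong refl) (simp add: indicator_def)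
    ultimately show ?thesis
      by (simp add: integral_open_interval)
  qed
  finally have "(\<lambda>n. \<integral>x. q n x * X x \<partial>lebesgue) \<longlonglongrightarrow> integral (cbox a b) X"
    by (simp only: qX)
  then show ?thesis
    unfolding q_def .
qed

section \<open>The characterization\<close>

locale nonstationary_generators =
  fixes J :: int
    and N :: "int \<Rightarrow> real ^ 'd ^ 'd"
    and r :: nat and s :: "int \<Rightarrow> nat"
    and \<phi> \<phi>' :: "nat \<Rightarrow> real ^ 'd \<Rightarrow> complex"
    and \<psi> \<psi>' :: "int \<Rightarrow> nat \<Rightarrow> real ^ 'd \<Rightarrow> complex"
  assumes invertible: "\<And>j. j \<ge> J \<Longrightarrow> invertible (N j)"
    and no_accumulation: "\<not> (\<exists>x. x islimpt union_lattice J N)"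
    and contraction: "\<And>k. k \<in> union_lattice J N \<Longrightarrow> ((\<lambda>j. norm (N j *v k)) \<longlongrightarrow> 0) at_top"
    and \<phi>: "\<And>l. l \<in> {1..r} \<Longrightarrow> \<phi> l \<in> L2_loc"
    and \<phi>': "\<And>l. l \<in> {1..r} \<Longrightarrow> \<phi>' l \<in> L2_loc"
    and \<psi>: "\<And>j l. j \<ge> J \<Longrightarrow> l \<in> {1..s j} \<Longrightarrow> \<psi> j l \<in> L2_loc"
    and \<psi>': "\<And>j l. j \<ge> J \<Longrightarrow> l \<in> {1..s j} \<Longrightarrow> \<psi>' j l \<in> L2_loc"
begin

lemma mem_union_lattice:
  assumes "j \<ge> J" "N j *v k \<in> int_lattice"
  shows "k \<in> union_lattice J N"
proof -
  have "k = matrix_inv (N j) *v (N j *v k)"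
    using invertible[OF assms(1)] by simp
  then show ?thesis
    using assms unfolding union_lattice_def by blast
qed

lemma zero_mem_union_lattice: "0 \<in> union_lattice J N"
  by (rule mem_union_lattice[of J]) simp_all

lemma finite_bounded_union_lattice:
  assumes "B \<subseteq> union_lattice J N" "bounded B"
  shows "finite B"
proof (rule ccontr)
  assume "infinite B"
  then obtain x where "x islimpt B"
    using assms(2) bounded_infinite_imp_islimpt[of B B] by auto
  then show False
    using no_accumulation islimpt_subset[OF _ assms(1)] by blast
qed

text \<open>
  A nonzero integer vector has norm at least 1, whereas \<open>N j *v k\<close> tends to zero and is never zero.
\<close>

lemma finite_active_scales:
  assumes k: "k \<in> union_lattice J N - {0}"
  shows "finite {j \<in> {J..}. N j *v k \<in> int_lattice}"
proof -
  have "\<forall>\<^sub>F j in at_top. norm (N j *v k) < 1"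
    using contraction[of k] k by (intro order_tendstoD(2)) auto
  then obtain j0 where j0: "\<And>j. j \<ge> j0 \<Longrightarrow> norm (N j *v k) < 1"
    by (auto simp: eventually_at_top_linorder)
  have "j < j0" if j: "j \<ge> J" "N j *v k \<in> int_lattice" for j
  proof (rule ccontr)
    assume "\<not> j < j0"
    then have small: "norm (N j *v k) < 1"
      using j0 by simp
    have "N j *v k = 0"
    proof (rule ccontr)
      assume "N j *v k \<noteq> 0"
      then obtain i where i: "(N j *v k) $ i \<noteq> 0"
        by (auto simp: vec_eq_iff)
      then have "1 \<le> \<bar>(N j *v k) $ i\<bar>"
        using j(2) by (intro Ints_nonzero_abs_ge1) (auto simp: int_lattice_def)
      then show False
        using component_le_norm_cart[of "N j *v k" i] small by linarith
    qed
    then have "k = 0"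
      using matrix_inv_vector(1)[OF invertible[OF j(1)], of k] by simp
    then show False using k by simp
  qed
  then have "{j \<in> {J..}. N j *v k \<in> int_lattice} \<subseteq> {J..<j0}"
    by auto
  then show ?thesis
    by (rule finite_subset) simp
qed

definition partial_cross_sum :: "int \<Rightarrow> real ^ 'd \<Rightarrow> real ^ 'd \<Rightarrow> complex" where
  "partial_cross_sum J' k \<xi> = cross_sum r \<phi> \<phi>' (N J *v k) (N J *v \<xi>) +
     (\<Sum>j\<in>{J..<J'}. cross_sum (s j) (\<psi> j) (\<psi>' j) (N j *v k) (N j *v \<xi>))"

definition full_cross_sum :: "real ^ 'd \<Rightarrow> real ^ 'd \<Rightarrow> complex" where
  "full_cross_sum k \<xi> = cross_sum r \<phi> \<phi>' (N J *v k) (N J *v \<xi>) +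
     (\<Sum>\<^sub>\<infinity>j\<in>{J..}. cross_sum (s j) (\<psi> j) (\<psi>' j) (N j *v k) (N j *v \<xi>))"

text \<open>
  Beyond the last active scale of \<open>k\<close> all further terms are zero by the convention in \<^const>\<open>cross_sum\<close>.
\<close>

lemma partial_cross_sum_stabilizes:
  assumes "k \<in> union_lattice J N - {0}"
  obtains j0 where "\<And>J'. J' \<ge> j0 \<Longrightarrow> partial_cross_sum J' k = full_cross_sum k"
proof -
  define A where "A = {j \<in> {J..}. N j *v k \<in> int_lattice}"
  have A: "finite A"
    unfolding A_def by (rule finite_active_scales[OF assms])
  define j0 where "j0 = Max (insert J A) + 1"
  have "partial_cross_sum J' k \<xi> = full_cross_sum k \<xi>" if "J' \<ge> j0" for J' \<xi>
  proof -
    have "A \<subseteq> {J..<J'}"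
    proof
      fix j assume j: "j \<in> A"
      then have "j \<le> Max (insert J A)" using A by (intro Max_ge) auto
      then show "j \<in> {J..<J'}"
        using j that by (auto simp: A_def j0_def)
    qed
    then have "(\<Sum>\<^sub>\<infinity>j\<in>{J..}. cross_sum (s j) (\<psi> j) (\<psi>' j) (N j *v k) (N j *v \<xi>))
        = (\<Sum>\<^sub>\<infinity>j\<in>{J..<J'}. cross_sum (s j) (\<psi> j) (\<psi>' j) (N j *v k) (N j *v \<xi>))"
      by (intro infsum_cong_neutral) (auto simp: A_def cross_sum_def)
    then show ?thesis
      by (simp add: partial_cross_sum_def full_cross_sum_def)
  qed
  then show thesis
    by (intro that[of j0] ext)
qed

lemma integrable_partial_cross_sum:
  assumes u: "bounded_with_bounded_support u"
  shows "integrable lebesgue (\<lambda>\<xi>. u \<xi> * partial_cross_sum J' k \<xi>)"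
proof -
  have 1: "integrable lebesgue (\<lambda>\<xi>. u \<xi> * cross_sum r \<phi> \<phi>' (N J *v k) (N J *v \<xi>))"
    by (rule integrable_cross_sum[OF invertible u \<phi> \<phi>']) simp_all
  have 2: "integrable lebesgue (\<lambda>\<xi>. u \<xi> * cross_sum (s j) (\<psi> j) (\<psi>' j) (N j *v k) (N j *v \<xi>))" if "j \<in> {J..<J'}" for j
    by (rule integrable_cross_sum[OF invertible u \<psi> \<psi>']) (use that in simp_all)
  have "integrable lebesgue (\<lambda>\<xi>. u \<xi> * cross_sum r \<phi> \<phi>' (N J *v k) (N J *v \<xi>) +
      (\<Sum>j\<in>{J..<J'}. u \<xi> * cross_sum (s j) (\<psi> j) (\<psi>' j) (N j *v k) (N j *v \<xi>)))"
    by (intro Bochner_Integration.integrable_add Bochner_Integration.integrable_sum 1 2)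
  then show ?thesis
    unfolding partial_cross_sum_def distrib_left sum_distrib_left .
qed

lemma integrable_full_cross_sum:
  assumes "k \<in> union_lattice J N - {0}" "bounded_with_bounded_support u"
  shows "integrable lebesgue (\<lambda>\<xi>. u \<xi> * full_cross_sum k \<xi>)"
proof -
  obtain j0 where "\<And>J'. J' \<ge> j0 \<Longrightarrow> partial_cross_sum J' k = full_cross_sum k"
    using partial_cross_sum_stabilizes[OF assms(1)] by blast
  from this[OF order_refl] show ?thesis
    using integrable_partial_cross_sum[OF assms(2), of j0 k] by simp
qed

definition partial_series :: "int \<Rightarrow> (real ^ 'd \<Rightarrow> complex) \<Rightarrow> (real ^ 'd \<Rightarrow> complex) \<Rightarrow> complex" where
  "partial_series J' f g =
     (\<Sum>l=1..r. \<Sum>\<^sub>\<infinity>k\<in>int_lattice. frame_term (FWS J N \<phi> \<psi>) (FWS J N \<phi>' \<psi>') f g (Scaling l k)) +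
     (\<Sum>j\<in>{J..<J'}. \<Sum>l=1..s j. \<Sum>\<^sub>\<infinity>k\<in>int_lattice.
        frame_term (FWS J N \<phi> \<psi>) (FWS J N \<phi>' \<psi>') f g (Wavelet j l k))"

text \<open>
  The only shifts that contribute to the frame series of \<open>f\<close> and \<open>g\<close>, at whatever scale.
\<close>

definition overlap_shifts :: "(real ^ 'd \<Rightarrow> complex) \<Rightarrow> (real ^ 'd \<Rightarrow> complex) \<Rightarrow> (real ^ 'd) set" where
  "overlap_shifts f g = {k \<in> union_lattice J N. \<exists>\<xi>. overlap f g k \<xi> \<noteq> 0}"

text \<open>
  Overlapping translates force the shift into a bounded set, and a bounded set of shifts without
  accumulation point is finite.
\<close>

lemma finite_overlap_shifts:
  assumes f: "f \<in> test_functions" and g: "g \<in> test_functions"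
  shows "finite (overlap_shifts f g)"
proof (rule finite_bounded_union_lattice)
  obtain A where A: "\<And>x. f x \<noteq> 0 \<Longrightarrow> norm x \<le> A"
    using test_functionsD(3)[OF f] by (auto simp: bounded_iff)
  obtain B where B: "\<And>x. g x \<noteq> 0 \<Longrightarrow> norm x \<le> B"
    using test_functionsD(3)[OF g] by (auto simp: bounded_iff)
  have "norm k \<le> (A + B) / (2 * pi)" if k: "k \<in> overlap_shifts f g" for k
  proof -
    obtain x where x: "f x \<noteq> 0" "g (x + (2 * pi) *\<^sub>R k) \<noteq> 0"
      using k by (auto simp: overlap_shifts_def overlap_def)
    have "norm ((2 * pi) *\<^sub>R k) \<le> norm (x + (2 * pi) *\<^sub>R k) + norm x"
      using norm_triangle_ineq4[of "x + (2 * pi) *\<^sub>R k" x] by simp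
    also have "\<dots> \<le> A + B"
      using A[OF x(1)] B[OF x(2)] by simp
    finally show ?thesis
      by (simp add: pos_le_divide_eq mult.commute)
  qed
  then show "bounded (overlap_shifts f g)"
    by (auto simp: bounded_iff)
qed (auto simp: overlap_shifts_def)

lemma frame_series_summable:
  assumes f: "f \<in> test_functions" and g: "g \<in> test_functions"
  shows "(\<lambda>(l, k). cmod (frame_term (FWS J N \<phi> \<psi>) (FWS J N \<phi>' \<psi>') f g (Scaling l k))) summable_on ({1..r} \<times> int_lattice)"
    and "j \<ge> J \<Longrightarrow> (\<lambda>(l, k). cmod (frame_term (FWS J N \<phi> \<psi>) (FWS J N \<phi>' \<psi>') f g (Wavelet j l k)))
      summable_on ({1..s j} \<times> int_lattice)"
proof -
  have mem: "k \<in> overlap_shifts f g" if "j \<ge> J" "N j *v k \<in> int_lattice" "overlap f g k x \<noteq> 0" for j k x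
    using mem_union_lattice[OF that(1,2)] that(3) by (auto simp: overlap_shifts_def)
  show "(\<lambda>(l, k). cmod (frame_term (FWS J N \<phi> \<psi>) (FWS J N \<phi>' \<psi>') f g (Scaling l k))) summable_on ({1..r} \<times> int_lattice)"
    unfolding frame_term_def FWS.simps
    by (rule scale_series(1)[OF invertible f g \<phi> \<phi>' finite_overlap_shifts[OF f g] mem[OF order_refl]]) simp_all
  show "(\<lambda>(l, k). cmod (frame_term (FWS J N \<phi> \<psi>) (FWS J N \<phi>' \<psi>') f g (Wavelet j l k)))
      summable_on ({1..s j} \<times> int_lattice)" if j: "j \<ge> J"
    unfolding frame_term_def FWS.simps
    by (rule scale_series(1)[OF invertible[OF j] f g \<psi>[OF j] \<psi>'[OF j] finite_overlap_shifts[OF f g] mem[OF j]]) simp_all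
qed

text \<open>
  All scales are summed over the same finite set of shifts, so the sum over scales can be moved inside the
  integral.
\<close>

lemma partial_series_eq:
  assumes f: "f \<in> test_functions" and g: "g \<in> test_functions"
    and K: "finite K" "overlap_shifts f g \<subseteq> K"
  shows "partial_series J' f g = (2 * complex_of_real pi) ^ CARD('d) *
    (\<Sum>k\<in>K. \<integral>\<xi>. overlap f g k \<xi> * partial_cross_sum J' k \<xi> \<partial>lebesgue)"
proof -
  note u = bounded_with_bounded_support_overlap[OF f g]
  have mem: "k \<in> K" if "j \<ge> J" "N j *v k \<in> int_lattice" "overlap f g k x \<noteq> 0" for j k x
    using mem_union_lattice[OF that(1,2)] that(3) K(2) by (auto simp: overlap_shifts_def)
  define a where "a k = (\<integral>\<xi>. overlap f g k \<xi> * cross_sum r \<phi> \<phi>' (N J *v k) (N J *v \<xi>) \<partial>lebesgue)" for k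
  define b where "b j k = (\<integral>\<xi>. overlap f g k \<xi> * cross_sum (s j) (\<psi> j) (\<psi>' j) (N j *v k) (N j *v \<xi>) \<partial>lebesgue)" for j k
  define c where "c = (2 * complex_of_real pi) ^ CARD('d)"
  have 1: "(\<Sum>l=1..r. \<Sum>\<^sub>\<infinity>k\<in>int_lattice. frame_term (FWS J N \<phi> \<psi>) (FWS J N \<phi>' \<psi>') f g (Scaling l k)) = c * (\<Sum>k\<in>K. a k)"
    unfolding frame_term_def FWS.simps a_def c_def
    by (rule scale_series(2)[OF invertible f g \<phi> \<phi>' K(1) mem[OF order_refl]]) simp_all
  have 2: "(\<Sum>l=1..s j. \<Sum>\<^sub>\<infinity>k\<in>int_lattice. frame_term (FWS J N \<phi> \<psi>) (FWS J N \<phi>' \<psi>') f g (Wavelet j l k)) = c * (\<Sum>k\<in>K. b j k)"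
    if "j \<in> {J..<J'}" for j
  proof -
    have j: "j \<ge> J" using that by simp
    show ?thesis
      unfolding frame_term_def FWS.simps b_def c_def
      by (rule scale_series(2)[OF invertible[OF j] f g \<psi>[OF j] \<psi>'[OF j] K(1) mem[OF j]]) simp_all
  qed
  have 3: "(\<integral>\<xi>. overlap f g k \<xi> * partial_cross_sum J' k \<xi> \<partial>lebesgue) = a k + (\<Sum>j\<in>{J..<J'}. b j k)" for k
    unfolding partial_cross_sum_def distrib_left sum_distrib_left a_def b_def
    by (rule has_bochner_integral_integral_eq)
      (intro has_bochner_integral_add has_bochner_integral_sum has_bochner_integral_integrable
        integrable_cross_sum invertible u \<phi> \<phi>' \<psi> \<psi>'; simp)
  have "partial_series J' f g = c * (\<Sum>k\<in>K. a k) + (\<Sum>j\<in>{J..<J'}. c * (\<Sum>k\<in>K. b j k))"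
    unfolding partial_series_def 1 by (intro arg_cong2[where f = "(+)"] refl sum.cong 2)
  also have "\<dots> = c * ((\<Sum>k\<in>K. a k) + (\<Sum>k\<in>K. \<Sum>j\<in>{J..<J'}. b j k))"
    unfolding sum_distrib_left[symmetric] distrib_left[symmetric] by (subst sum.swap) (rule refl)
  also have "\<dots> = c * (\<Sum>k\<in>K. \<integral>\<xi>. overlap f g k \<xi> * partial_cross_sum J' k \<xi> \<partial>lebesgue)"
    unfolding 3 sum.distrib ..
  finally show ?thesis
    unfolding c_def .
qed

lemma frames_iff_partial_series:
  "frequency_dual_wavelet_frames J r s (FWS J N \<phi> \<psi>) (FWS J N \<phi>' \<psi>') \<longleftrightarrow>
    (\<forall>f\<in>test_functions. \<forall>g\<in>test_functions.
      ((\<lambda>J'. partial_series J' f g) \<longlongrightarrow> (2 * complex_of_real pi) ^ CARD('d) * pairing f g) at_top)"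
  unfolding frequency_dual_wavelet_frames_def partial_series_def
  using frame_series_summable by blast

text \<open>
  If \<open>k0 \<noteq> 0\<close> is the only overlapping shift, then \<open>f\<close> and \<open>g\<close> are never nonzero at the same point, so the
  limit of the partial series is zero; on the other hand the partial series is eventually constant, equal
  to a nonzero multiple of the integral.
\<close>

lemma off_diagonal_integral_zero:
  assumes lim: "\<And>f g. f \<in> test_functions \<Longrightarrow> g \<in> test_functions \<Longrightarrow>
      ((\<lambda>J'. partial_series J' f g) \<longlongrightarrow> (2 * complex_of_real pi) ^ CARD('d) * pairing f g) at_top"
    and k0: "k0 \<in> union_lattice J N - {0}"
    and f: "f \<in> test_functions" and g: "g \<in> test_functions" and shifts: "overlap_shifts f g \<subseteq> {k0}"
  shows "(\<integral>\<xi>. overlap f g k0 \<xi> * full_cross_sum k0 \<xi> \<partial>lebesgue) = 0"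
proof -
  define c where "c = (2 * complex_of_real pi) ^ CARD('d)"
  have c: "c \<noteq> 0" by (simp add: c_def)
  have "0 \<notin> overlap_shifts f g"
    using shifts k0 by auto
  then have "f \<xi> * cnj (g \<xi>) = 0" for \<xi>
    using zero_mem_union_lattice by (simp add: overlap_shifts_def overlap_def)
  then have "pairing f g = 0"
    unfolding pairing_def by (simp only: Bochner_Integration.integral_zero)
  then have lim0: "((\<lambda>J'. partial_series J' f g) \<longlongrightarrow> 0) at_top"
    using lim[OF f g] by simp
  obtain j0 where j0: "\<And>J'. J' \<ge> j0 \<Longrightarrow> partial_cross_sum J' k0 = full_cross_sum k0"
    using partial_cross_sum_stabilizes[OF k0] by blast
  then have ev: "\<forall>\<^sub>F J' in at_top. partial_series J' f g = c * (\<integral>\<xi>. overlap f g k0 \<xi> * full_cross_sum k0 \<xi> \<partial>lebesgue)"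
    unfolding eventually_at_top_linorder
    using partial_series_eq[OF f g _ shifts] by (intro exI[of _ j0]) (simp add: c_def)
  have "((\<lambda>J' :: int. c * (\<integral>\<xi>. overlap f g k0 \<xi> * full_cross_sum k0 \<xi> \<partial>lebesgue)) \<longlongrightarrow> 0) at_top"
    by (rule tendsto_cong[THEN iffD1, OF ev lim0])
  then show ?thesis
    using c by (simp add: tendsto_const_iff)
qed

text \<open>
  Shifts are isolated: no other shift is closer to \<open>k0\<close> than some \<open>\<delta>\<close>. If \<open>f\<close> and \<open>g\<close> are bumps on a small cube and
  on its translate by \<open>2 pi k0\<close>, then \<open>k0\<close> is their only overlapping shift. Letting the bumps approach the
  indicators, the cross sum at \<open>k0\<close> has integral zero over every small cube.
\<close>

lemma off_diagonal_vanishes: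
  assumes lim: "\<And>f g. f \<in> test_functions \<Longrightarrow> g \<in> test_functions \<Longrightarrow>
      ((\<lambda>J'. partial_series J' f g) \<longlongrightarrow> (2 * complex_of_real pi) ^ CARD('d) * pairing f g) at_top"
    and k0: "k0 \<in> union_lattice J N - {0}"
  shows "AE \<xi> in lebesgue. full_cross_sum k0 \<xi> = 0"
proof -
  obtain \<delta> where \<delta>: "\<delta> > 0" "\<And>k. k \<in> union_lattice J N \<Longrightarrow> k \<noteq> k0 \<Longrightarrow> dist k k0 \<ge> \<delta>"
  proof -
    have "\<not> k0 islimpt union_lattice J N"
      using no_accumulation by blast
    then show thesis
      using that unfolding islimpt_approachable not_all not_imp not_ex not_le[symmetric] by (meson linorder_not_le)
  qed
  have loc: "integrable lebesgue (\<lambda>\<xi>. indicator (cbox a b) \<xi> * full_cross_sum k0 \<xi>)" for a b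
    by (intro integrable_full_cross_sum[OF k0] bounded_with_bounded_support_indicator) auto
  show ?thesis
  proof (rule AE_zero_if_small_cube_integrals_zero)
    show "full_cross_sum k0 integrable_on cbox a b" for a b
    proof -
      have "indicator (cbox a b) \<xi> *\<^sub>R full_cross_sum k0 \<xi> = indicator (cbox a b) \<xi> * full_cross_sum k0 \<xi>" for \<xi>
        by (simp add: indicator_def)
      then have "set_integrable lebesgue (cbox a b) (full_cross_sum k0)"
        using loc[of a b] by (simp add: set_integrable_def)
      then show ?thesis
        by (rule set_lebesgue_integral_eq_integral)
    qed
    \<comment> \<open>Two points of a cube of this side differ by less than 2 pi \<delta> in the sum norm of their coordinates.\<close>
    show "2 * pi * \<delta> / CARD('d) > 0"
      using \<delta>(1) by simp
    fix x :: "real ^ 'd" and h :: real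
    assume h: "0 < h" "h < 2 * pi * \<delta> / CARD('d)"
    define b where "b = x + h *\<^sub>R One"
    have b: "b $ i = x $ i + h" for i
    proof -
      have "(One :: real ^ 'd) $ i = 1"
        using inner_sum_left_Basis[of "axis i 1 :: real ^ 'd" "\<lambda>_. 1"]
        by (simp add: cart_eq_inner_axis axis_in_Basis_iff)
      then show ?thesis by (simp add: b_def)
    qed
    define f where "f n \<xi> = complex_of_real (box_bump (real (Suc n)) x b \<xi>)" for n \<xi>
    define g where "g n \<xi> = complex_of_real (box_bump (real (Suc n)) (x + (2 * pi) *\<^sub>R k0) (b + (2 * pi) *\<^sub>R k0) \<xi>)" for n \<xi>
    have fg: "f n \<in> test_functions" "g n \<in> test_functions" for n
      unfolding f_def[abs_def] g_def[abs_def] by (rule box_bump_test_function, simp)+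
    have shift: "g n (\<xi> + (2 * pi) *\<^sub>R k0) = f n \<xi>" for n \<xi>
      by (simp add: f_def g_def box_bump_def)
    have "k = k0" if k: "k \<in> overlap_shifts (f n) (g n)" for n k
    proof (rule ccontr)
      assume ne: "k \<noteq> k0"
      obtain \<xi> where \<xi>: "f n \<xi> \<noteq> 0" "g n (\<xi> + (2 * pi) *\<^sub>R k) \<noteq> 0"
        using k by (auto simp: overlap_shifts_def overlap_def)
      have box1: "\<xi> \<in> box x b"
        using \<xi>(1) box_bump_nonzero[of "real (Suc n)" x b \<xi>] by (simp add: f_def)
      have box2: "\<xi> + (2 * pi) *\<^sub>R k \<in> box (x + (2 * pi) *\<^sub>R k0) (b + (2 * pi) *\<^sub>R k0)"
        using \<xi>(2) box_bump_nonzero[of "real (Suc n)" "x + (2 * pi) *\<^sub>R k0" "b + (2 * pi) *\<^sub>R k0" "\<xi> + (2 * pi) *\<^sub>R k"]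
        by (simp add: g_def)
      have "\<bar>((2 * pi) *\<^sub>R (k - k0)) $ i\<bar> \<le> h" for i
      proof -
        have "x $ i < \<xi> $ i" "\<xi> $ i < x $ i + h"
          using box1 by (auto simp: mem_box_cart b)
        moreover have "x $ i + (2 * pi) * k0 $ i < \<xi> $ i + (2 * pi) * k $ i"
          "\<xi> $ i + (2 * pi) * k $ i < x $ i + h + (2 * pi) * k0 $ i"
          using box2 by (auto simp: mem_box_cart b)
        ultimately show ?thesis
          by (simp add: right_diff_distrib abs_le_iff)
      qed
      then have "norm ((2 * pi) *\<^sub>R (k - k0)) \<le> (\<Sum>i\<in>(UNIV :: 'd set). h)"
        by (intro order_trans[OF norm_le_l1_cart] sum_mono)
      then have "2 * pi * dist k k0 \<le> CARD('d) * h"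
        by (simp add: dist_norm)
      also have "\<dots> < 2 * pi * \<delta>"
        using h by (simp add: pos_less_divide_eq mult.commute)
      finally have "dist k k0 < \<delta>" by simp
      then show False
        using \<delta>(2)[of k] k ne by (simp add: overlap_shifts_def)
    qed
    then have sub: "overlap_shifts (f n) (g n) \<subseteq> {k0}" for n by blast
    have "(\<integral>\<xi>. overlap (f n) (g n) k0 \<xi> * full_cross_sum k0 \<xi> \<partial>lebesgue) = 0" for n
      by (rule off_diagonal_integral_zero[OF lim k0 fg sub])
    then have "(\<integral>\<xi>. (f n \<xi> * f n \<xi>) * full_cross_sum k0 \<xi> \<partial>lebesgue) = 0" for n
      unfolding overlap_def shift by (simp add: f_def)
    then have "(\<lambda>n. 0) \<longlonglongrightarrow> integral (cbox x b) (full_cross_sum k0)"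
      using bump_square_integral_tendsto[OF loc[of x b]] by (simp add: f_def)
    then show "integral (cbox x (x + h *\<^sub>R One)) (full_cross_sum k0) = 0"
      unfolding b_def by (rule LIMSEQ_unique[OF _ tendsto_const])
  qed
qed

text \<open>
  Of the finitely many overlapping shifts, each nonzero one contributes an integral that is eventually
  that of the vanishing full cross sum.
\<close>

lemma partial_series_eventually_diagonal:
  assumes off: "\<And>k. k \<in> union_lattice J N - {0} \<Longrightarrow> AE \<xi> in lebesgue. full_cross_sum k \<xi> = 0"
    and f: "f \<in> test_functions" and g: "g \<in> test_functions"
  shows "\<forall>\<^sub>F J' in at_top. partial_series J' f g = (2 * complex_of_real pi) ^ CARD('d) *
    pairing (partial_cross_sum J' 0) (\<lambda>\<xi>. cnj (f \<xi>) * g \<xi>)"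
proof -
  define K where "K = overlap_shifts f g - {0}"
  have K: "finite K" "K \<subseteq> union_lattice J N - {0}" "0 \<notin> K"
    using finite_overlap_shifts[OF f g] by (auto simp: K_def overlap_shifts_def)
  have "\<forall>\<^sub>F J' in at_top. (\<integral>\<xi>. overlap f g k \<xi> * partial_cross_sum J' k \<xi> \<partial>lebesgue) = 0" if "k \<in> K" for k
  proof -
    have k: "k \<in> union_lattice J N - {0}" using that K by blast
    obtain j0 where j0: "\<And>J'. J' \<ge> j0 \<Longrightarrow> partial_cross_sum J' k = full_cross_sum k"
      using partial_cross_sum_stabilizes[OF k] by blast
    have "AE \<xi> in lebesgue. overlap f g k \<xi> * full_cross_sum k \<xi> = 0"
      using off[OF k] by eventually_elim simp
    then have "(\<integral>\<xi>. overlap f g k \<xi> * full_cross_sum k \<xi> \<partial>lebesgue) = 0"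
      by (rule integral_eq_zero_AE)
    then show ?thesis
      unfolding eventually_at_top_linorder using j0 by (intro exI[of _ j0]) simp
  qed
  then have "\<forall>\<^sub>F J' in at_top. \<forall>k\<in>K. (\<integral>\<xi>. overlap f g k \<xi> * partial_cross_sum J' k \<xi> \<partial>lebesgue) = 0"
    using K(1) by (intro eventually_ball_finite) auto
  then show ?thesis
  proof eventually_elim
    case (elim J')
    have "partial_series J' f g = (2 * complex_of_real pi) ^ CARD('d) *
        (\<Sum>k\<in>insert 0 K. \<integral>\<xi>. overlap f g k \<xi> * partial_cross_sum J' k \<xi> \<partial>lebesgue)"
      using K(1) by (intro partial_series_eq f g) (auto simp: K_def)
    also have "(\<Sum>k\<in>insert 0 K. \<integral>\<xi>. overlap f g k \<xi> * partial_cross_sum J' k \<xi> \<partial>lebesgue)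
        = (\<integral>\<xi>. overlap f g 0 \<xi> * partial_cross_sum J' 0 \<xi> \<partial>lebesgue)"
      using K elim by simp
    also have "\<dots> = pairing (partial_cross_sum J' 0) (\<lambda>\<xi>. cnj (f \<xi>) * g \<xi>)"
      unfolding pairing_def overlap_def
      by (intro Bochner_Integration.integral_cong refl) (simp add: mult.commute mult.left_commute)
    finally show ?case .
  qed
qed

text \<open>
  Take \<open>f = cnj h\<close> and a cutoff \<open>g\<close> that is 1 on the support of \<open>h\<close>. So testing against pairs \<open>f\<close>, \<open>g\<close> is as
  strong as testing against a single function.
\<close>

lemma test_function_factorization:
  fixes h :: "real ^ 'd \<Rightarrow> complex"
  assumes h: "h \<in> test_functions"
  obtains f g where "f \<in> test_functions" "g \<in> test_functions" "\<And>\<xi>. cnj (f \<xi>) * g \<xi> = h \<xi>"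
proof -
  obtain R where R: "\<And>x. h x \<noteq> 0 \<Longrightarrow> norm x \<le> R"
    using test_functionsD(3)[OF h] by (auto simp: bounded_iff)
  define g :: "real ^ 'd \<Rightarrow> complex" where "g x = complex_of_real (box_bump 1 (\<chi> i. - (R + 1)) (\<chi> i. R + 1) x)" for x
  have "cnj (cnj (h \<xi>)) * g \<xi> = h \<xi>" for \<xi>
  proof (cases "h \<xi> = 0")
    case False
    have "0 \<le> \<xi> $ i + R" "\<xi> $ i \<le> R" for i
      using R[OF False] component_le_norm_cart[of \<xi> i] by linarith+
    then have "box_bump 1 (\<chi> i. - (R + 1)) (\<chi> i. R + 1) \<xi> = 1"
      by (intro box_bump_eq_1) simp_all
    then show ?thesis by (simp add: g_def)
  qed simp
  moreover have "g \<in> test_functions"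
    unfolding g_def[abs_def] by (rule box_bump_test_function) simp
  ultimately show thesis
    using test_functions_cnj[OF h] that by blast
qed

text \<open>
  Once the cross sums at nonzero shifts vanish, the partial series is eventually its diagonal term, and the
  limit condition for \<open>f\<close> and \<open>g\<close> is the first condition for \<open>h = cnj f * g\<close>.
\<close>

theorem frames_iff:
  "frequency_dual_wavelet_frames J r s (FWS J N \<phi> \<psi>) (FWS J N \<phi>' \<psi>') \<longleftrightarrow>
    (\<forall>h\<in>test_functions. ((\<lambda>J'. pairing (partial_cross_sum J' 0) h) \<longlongrightarrow> pairing (\<lambda>\<xi>. 1) h) at_top) \<and>
    (\<forall>k \<in> union_lattice J N - {0}. AE \<xi> in lebesgue. full_cross_sum k \<xi> = 0)"
    (is "?frames \<longleftrightarrow> ?diagonal \<and> ?off_diagonal")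
proof -
  define c where "c = (2 * complex_of_real pi) ^ CARD('d)"
  have c: "c \<noteq> 0" by (simp add: c_def)
  have one: "pairing (\<lambda>\<xi>. 1) (\<lambda>\<xi>. cnj (f \<xi>) * g \<xi>) = pairing f g" for f g
    by (simp add: pairing_def)
  have transfer: "((\<lambda>J'. partial_series J' f g) \<longlongrightarrow> c * pairing f g) at_top \<longleftrightarrow>
      ((\<lambda>J'. pairing (partial_cross_sum J' 0) (\<lambda>\<xi>. cnj (f \<xi>) * g \<xi>)) \<longlongrightarrow> pairing (\<lambda>\<xi>. 1) (\<lambda>\<xi>. cnj (f \<xi>) * g \<xi>)) at_top"
    if "?off_diagonal" "f \<in> test_functions" "g \<in> test_functions" for f g
  proof -
    have "((\<lambda>J'. partial_series J' f g) \<longlongrightarrow> c * pairing f g) at_top \<longleftrightarrow>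
        ((\<lambda>J'. c * pairing (partial_cross_sum J' 0) (\<lambda>\<xi>. cnj (f \<xi>) * g \<xi>)) \<longlongrightarrow> c * pairing f g) at_top"
      using partial_series_eventually_diagonal[of f g] that unfolding c_def by (intro tendsto_cong) blast
    also have "\<dots> \<longleftrightarrow> ((\<lambda>J'. pairing (partial_cross_sum J' 0) (\<lambda>\<xi>. cnj (f \<xi>) * g \<xi>)) \<longlongrightarrow> pairing f g) at_top"
      by (rule tendsto_mult_left_iff[OF c])
    finally show ?thesis unfolding one .
  qed
  show ?thesis
  proof
    assume ?frames
    then have lim: "((\<lambda>J'. partial_series J' f g) \<longlongrightarrow> c * pairing f g) at_top"
      if "f \<in> test_functions" "g \<in> test_functions" for f g
      using that unfolding frames_iff_partial_series c_def by blast
    have off: ?off_diagonal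
      using off_diagonal_vanishes lim unfolding c_def by blast
    moreover have ?diagonal
    proof
      fix h :: "real ^ 'd \<Rightarrow> complex"
      assume "h \<in> test_functions"
      then obtain f g where fg: "f \<in> test_functions" "g \<in> test_functions" "\<And>\<xi>. cnj (f \<xi>) * g \<xi> = h \<xi>"
        using test_function_factorization by metis
      show "((\<lambda>J'. pairing (partial_cross_sum J' 0) h) \<longlongrightarrow> pairing (\<lambda>\<xi>. 1) h) at_top"
        using transfer[OF off fg(1,2)] lim[OF fg(1,2)] unfolding fg(3) by blast
    qed
    ultimately show "?diagonal \<and> ?off_diagonal" by blast
  next
    assume *: "?diagonal \<and> ?off_diagonal"
    show ?frames
      unfolding frames_iff_partial_series c_def[symmetric]
    proof (intro ballI)
      fix f g :: "real ^ 'd \<Rightarrow> complex"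
      assume fg: "f \<in> test_functions" "g \<in> test_functions"
      have "(\<lambda>\<xi>. cnj (f \<xi>) * g \<xi>) \<in> test_functions"
        by (intro test_functions_mult test_functions_cnj fg)
      then show "((\<lambda>J'. partial_series J' f g) \<longlongrightarrow> c * pairing f g) at_top"
        using * transfer[OF conjunct2[OF *] fg] by blast
    qed
  qed
qed

end

theorem theorem11:
  fixes J :: int
    and N :: "int \<Rightarrow> real ^ 'd ^ 'd"
    and r :: nat and s :: "int \<Rightarrow> nat"
    and \<phi> \<phi>' :: "nat \<Rightarrow> real ^ 'd \<Rightarrow> complex"
    and \<psi> \<psi>' :: "int \<Rightarrow> nat \<Rightarrow> real ^ 'd \<Rightarrow> complex"
  assumes "\<And>j. j \<ge> J \<Longrightarrow> invertible (N j)"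
    and "\<not> (\<exists>x. x islimpt union_lattice J N)"
    and "\<And>k. k \<in> union_lattice J N \<Longrightarrow> ((\<lambda>j. norm (N j *v k)) \<longlongrightarrow> 0) at_top"
    and "\<And>l. l \<in> {1..r} \<Longrightarrow> \<phi> l \<in> L2_loc"
    and "\<And>l. l \<in> {1..r} \<Longrightarrow> \<phi>' l \<in> L2_loc"
    and "\<And>j l. j \<ge> J \<Longrightarrow> l \<in> {1..s j} \<Longrightarrow> \<psi> j l \<in> L2_loc"
    and "\<And>j l. j \<ge> J \<Longrightarrow> l \<in> {1..s j} \<Longrightarrow> \<psi>' j l \<in> L2_loc"
  shows "(frequency_dual_wavelet_frames J r s (FWS J N \<phi> \<psi>) (FWS J N \<phi>' \<psi>') \<longleftrightarrow>
      (\<forall>h\<in>test_functions.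
         ((\<lambda>J'. pairing (\<lambda>\<xi>. cross_sum r \<phi> \<phi>' 0 (N J *v \<xi>) +
                              (\<Sum>j\<in>{J..<J'}. cross_sum (s j) (\<psi> j) (\<psi>' j) 0 (N j *v \<xi>))) h)
            \<longlongrightarrow> pairing (\<lambda>\<xi>. 1) h) at_top) \<and>
      (\<forall>k \<in> union_lattice J N - {0}. AE \<xi> in lebesgue.
         cross_sum r \<phi> \<phi>' (N J *v k) (N J *v \<xi>) +
         (\<Sum>\<^sub>\<infinity>j\<in>{J..}. cross_sum (s j) (\<psi> j) (\<psi>' j) (N j *v k) (N j *v \<xi>)) = 0)) \<and>
    (\<forall>k \<in> union_lattice J N - {0}. finite {j \<in> {J..}. N j *v k \<in> int_lattice})"
proof -
  interpret nonstationary_generators J N r s \<phi> \<phi>' \<psi> \<psi>'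
    by standard (fact assms)+
  note iff = frames_iff[unfolded partial_cross_sum_def[abs_def] full_cross_sum_def matrix_vector_mult_0_right]
  show ?thesis
    by (rule conjI[OF iff]) (rule ballI, rule finite_active_scales)
qed

end
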